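(* Let $n\geqslant 1$ be a fixed integer. Let $p$ be a prime, $H$ an integer with $1\leqslant H\leqslant p-1$, and $\mathbf{a}=(a_1,a_2)\in(\mathbb{F}_p^* )^2$. Then $$V_{\mathbf{a},p}(H)\lesssim\begin{cases}H^2p^{89/92}+H^2p^{1-3/(13n)}, & \text{if } H\geqslant p^{1/n},\\ p^{89/92+2/n}+p^{1+23/(13n)}, & \text{if } H<p^{1/n}.\end{cases}$$
   Context: $\mathbb{F}_p$ is represented by $\{0,1,\ldots,p-1\}$ and $\mathbf{e}_p(z)=\exp(2\pi i z/p)$. For $\mathbf{a}=(a_1,a_2)\in\mathbb{F}_p^2$ and $\mathbf{h}=(h_1,h_2)$ put $S(\mathbf{a},\mathbf{h};p)=\sum_{x=1}^{p-1}\mathbf{e}_p(a_1h_1^x+a_2h_2^x)$, and $V_{\mathbf{a},p}(H)=\sum_{h_1,h_2=1}^{H}|S(\mathbf{a},\mathbf{h};p)|$. The notation $A\lesssim B$ means $|A|\leqslant Bp^{o(1)}$ as $p\to\infty$ (the $o(1)$ may depend on $n$ but is uniform in $\mathbf{a}$ and $H$). *)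

theory Defs
  imports Complex_Main "HOL-Computational_Algebra.Primes"
begin

(* Elements of F_p are represented by natural numbers in {0..<p}.  The argument of e_p need not be
   reduced modulo p, because z |-> e_p p z is p-periodic on the integers. *)

definition e_p :: "nat \<Rightarrow> nat \<Rightarrow> complex" where
  "e_p p z = exp (2 * of_real pi * \<i> * of_nat z / of_nat p)"

definition S :: "nat \<times> nat \<Rightarrow> nat \<times> nat \<Rightarrow> nat \<Rightarrow> complex" where
  "S a h p = (\<Sum>x = 1..p - 1. e_p p (fst a * fst h ^ x + snd a * snd h ^ x))"

definition V :: "nat \<times> nat \<Rightarrow> nat \<Rightarrow> nat \<Rightarrow> real" where
  "V a p H = (\<Sum>h1 = 1..H. \<Sum>h2 = 1..H. norm (S a (h1, h2) p))"

end

theory Submission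
  imports Defs "HOL-Number_Theory.Number_Theory" "HOL-Computational_Algebra.Polynomial"
    "HOL-Library.Discrete_Functions"
begin

text \<open>
  Let \<open>\<Gamma>\<close> be the cyclic group generated by \<open>(h\<^sub>1, h\<^sub>2)\<close> in \<open>(\<int>/p)\<^sup>* \<times> (\<int>/p)\<^sup>*\<close>, let \<open>t\<close> be its order and
  \<open>d = (p - 1)/t\<close>. Since the sum \<open>S/d\<close> over \<open>\<Gamma>\<close> does not change when \<open>(a\<^sub>1, a\<^sub>2)\<close> is multiplied by
  an element of \<open>\<Gamma>\<close>, Hoelder's inequality bounds \<open>|S/d|\<^sup>4\<close> by \<open>p\<close> times the additive energy of \<open>\<Gamma>\<close>,
  so it suffices that every \<open>s \<noteq> 0\<close> has \<open>O(t\<^bsup>20/23\<^esup>)\<close> representations as a difference of two elements of \<open>\<Gamma>\<close>.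

  By the pigeonhole principle \<open>h\<^sub>1\<^sup>l = h\<^sub>2\<^bsup>\<plusminus>k\<^esup>\<close> for some \<open>0 < k, l \<le> \<surd>t\<close>. Hence \<open>\<Gamma>\<close> consists of \<open>f\<close> cosets of
  curves \<open>(z\<^sup>a, z\<^bsup>\<plusminus>b\<^esup>)\<close> with \<open>a, b\<close> coprime and \<open>f a, f b \<le> \<surd>t\<close>, and the representations of \<open>s\<close> in one coset
  are solutions of \<open>(z\<^sup>a - \<sigma>)\<^bsup>fb\<^esup> = \<omega> (z\<^sup>b - \<tau>)\<^bsup>fa\<^esup>\<close> (or its analogue for the other sign) with
  \<open>z\<^bsup>t/f\<^esup> = 1\<close>. They are counted by Stepanov's method, and \<open>|S| \<le> 4 p\<^bsup>89/92\<^esup> d\<^bsup>13/46\<^esup>\<close> follows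
  unless \<open>h\<^sub>1\<close>, \<open>h\<^sub>2\<close> or \<open>h\<^sub>1/h\<^sub>2\<close> has small order.

  The pairs with small orders or large \<open>d\<close> are rare: the \<open>n\<close>-fold products of elements of \<open>[1, H]\<close> in a coset
  of a subgroup of order \<open>e\<close> lie in a coset as well, and by the divisor bound each product arises from
  \<open>p\<^bsup>o(1)\<^esup>\<close> tuples, so there are at most \<open>H (e/p)\<^bsup>1/n\<^esup> p\<^bsup>o(1)\<^esup>\<close> such elements.

  Polynomials over \<open>\<int>/p\<close> are represented by integer polynomials, with divisibility by the constant
  polynomial \<open>p\<close> playing the role of vanishing.
\<close>

section \<open>Integer polynomials modulo a prime\<close>

text \<open>If every nonzero difference has r = O(t^(20/23)) representations, the energy is about
  t^2 r and |S| is at most about d (p t^2 r)^(1/4), which for t = p/d equals p^(89/92) d^(13/46).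
  This becomes trivial at d = p^(3/26). There the weight (t/p)^(2/n), the squared density of a
  subgroup of order t in [1, H], has dropped to p^(-3/(13n)); the elements of order below p^(10/13)
  obey the same density bound. Hence the second term of the result.

  The order conditions answer three degeneracies. The pigeonhole relation must involve both h1 and
  h2. A difference with one zero coordinate, to which the curve argument does not apply, can only be
  bounded by (t/o1)(t/o2) representations, where o1 and o2 are the orders of h1 and h2. And for a =
  b = 1 the curve equation may become an identity in one coset; that coset contributes up to t/f, so
  f, and with it the order of h1/h2, must be large.\<close>

locale prime_modulus =
  fixes p :: int
  assumes prime_p: "prime p"
begin

definition mzero :: "int poly \<Rightarrow> bool" where
  "mzero F \<longleftrightarrow> [:p:] dvd F"

definition mdvd :: "int poly \<Rightarrow> int poly \<Rightarrow> bool" where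
  "mdvd T F \<longleftrightarrow> (\<exists>Q. mzero (F - T * Q))"

lemma p_gt_1: "p > 1"
  using prime_p by (simp add: prime_gt_1_int)

lemma mzero_iff: "mzero F \<longleftrightarrow> (\<forall>n. p dvd coeff F n)"
  by (simp add: mzero_def const_poly_dvd_iff)

lemma mzero_0 [simp]: "mzero 0"
  by (simp add: mzero_def)

lemma mzero_add: "mzero F \<Longrightarrow> mzero G \<Longrightarrow> mzero (F + G)"
  by (simp add: mzero_def)

lemma mzero_diff: "mzero F \<Longrightarrow> mzero G \<Longrightarrow> mzero (F - G)"
  by (simp add: mzero_def)

lemma mzero_multl: "mzero F \<Longrightarrow> mzero (F * G)"
  by (simp add: mzero_def)

lemma mzero_multr: "mzero G \<Longrightarrow> mzero (F * G)"
  by (simp add: mzero_def)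

lemma mzero_sum: "(\<And>i. i \<in> I \<Longrightarrow> mzero (f i)) \<Longrightarrow> mzero (sum f I)"
  unfolding mzero_def by (rule dvd_sum)

lemma mzero_mult_iff: "mzero (F * G) \<longleftrightarrow> mzero F \<or> mzero G"
proof -
  have "prime_elem [:p:]"
    using prime_imp_prime_elem[OF prime_p] by (simp only: prime_elem_const_poly_iff)
  then show ?thesis
    unfolding mzero_def by (rule prime_elem_dvd_mult_iff)
qed

lemma mzero_power_iff: "mzero (F ^ n) \<longleftrightarrow> mzero F \<and> n > 0"
proof (induction n)
  case 0
  show ?case using p_gt_1 by (auto simp: mzero_iff coeff_1 intro!: exI[of _ 0])
qed (auto simp: mzero_mult_iff)

lemma mzero_const_iff [simp]: "mzero [:c:] \<longleftrightarrow> p dvd c"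
  by (auto simp: mzero_iff coeff_pCons split: nat.splits)

lemma mzero_poly: "mzero F \<Longrightarrow> p dvd poly F x"
  unfolding mzero_def by (metis poly_mult dvd_def poly_pCons poly_0 mult_zero_right add.right_neutral)

lemma mzero_pderiv: "mzero F \<Longrightarrow> mzero (pderiv F)"
  by (simp add: mzero_iff coeff_pderiv)

lemma monic_not_mzero: "lead_coeff F = 1 \<Longrightarrow> \<not> mzero F"
  using p_gt_1 by (auto simp: mzero_iff intro!: exI[of _ "degree F"])

lemma mdvd_mzero: "mzero F \<Longrightarrow> mdvd T F"
  unfolding mdvd_def by (rule exI[of _ 0]) simp

lemma mdvd_dvd: "T dvd F \<Longrightarrow> mdvd T F"
  unfolding mdvd_def by (elim dvdE) (metis diff_self mzero_0)

lemma mdvd_add: "mdvd T F \<Longrightarrow> mdvd T G \<Longrightarrow> mdvd T (F + G)"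
  unfolding mdvd_def
  by (elim exE, rename_tac Q R, rule_tac x = "Q + R" in exI)
     (metis (no_types, lifting) add_diff_add distrib_left mzero_add)

lemma mdvd_mult: "mdvd T F \<Longrightarrow> mdvd T (F * G)"
  unfolding mdvd_def
  by (elim exE, rename_tac Q, rule_tac x = "Q * G" in exI)
     (metis left_diff_distrib mult.assoc mzero_multl)

lemma mdvd_mult2: "mdvd T F \<Longrightarrow> mdvd T (G * F)"
  using mdvd_mult by (simp add: mult.commute)

lemma mdvd_uminus: "mdvd T F \<Longrightarrow> mdvd T (- F)"
  using mdvd_mult[of T F "-1"] by simp

lemma mdvd_diff: "mdvd T F \<Longrightarrow> mdvd T G \<Longrightarrow> mdvd T (F - G)"
  using mdvd_add[of T F "- G"] mdvd_uminus by simp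

lemma mdvd_cong: "mzero (F - G) \<Longrightarrow> mdvd T F \<longleftrightarrow> mdvd T G"
  by (metis mdvd_diff mdvd_add mdvd_mzero diff_add_cancel diff_diff_eq2 add_diff_cancel_left')

lemma mdvd_mono: "R dvd T \<Longrightarrow> mdvd T F \<Longrightarrow> mdvd R F"
  unfolding mdvd_def by (metis dvdE mult.assoc)

lemma mdvd_cancel:
  assumes "\<not> mzero T" "mdvd (T * R) (T * F)"
  shows "mdvd R F"
proof -
  from assms(2) obtain Q where "mzero (T * F - T * R * Q)"
    by (auto simp: mdvd_def)
  then have "mzero (T * (F - R * Q))"
    by (simp add: algebra_simps)
  with assms(1) show ?thesis
    by (auto simp: mzero_mult_iff mdvd_def)
qed

lemma unit_inverse: "\<not> p dvd c \<Longrightarrow> \<exists>d. p dvd c * d - 1"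
proof -
  assume "\<not> p dvd c"
  then have "coprime c p"
    using prime_p by (metis coprime_commute prime_imp_coprime)
  then obtain d where "[c * d = 1] (mod p)"
    by (metis cong_solve_coprime_int)
  then show ?thesis by (auto simp: cong_iff_dvd_diff)
qed

lemma mdvd_unit:
  assumes "\<not> p dvd c" "mdvd T ([:c:] * F)"
  shows "mdvd T F"
proof -
  from unit_inverse[OF assms(1)] obtain d where d: "p dvd c * d - 1" by blast
  have "mdvd T ([:d:] * ([:c:] * F))" using assms(2) by (rule mdvd_mult2)
  moreover have "[:d:] * ([:c:] * F) - F = [:c * d - 1:] * F"
    by (simp add: algebra_simps smult_diff_left)
  then have "mzero ([:d:] * ([:c:] * F) - F)" using d by (metis mzero_const_iff mzero_multl)
  ultimately show ?thesis using mdvd_cong by blast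
qed

lemma prime_dvd_mult_cancel: "\<not> p dvd a \<Longrightarrow> p dvd a * b \<Longrightarrow> p dvd b"
  using prime_p prime_dvd_mult_iff by blast

lemma not_dvd_power: "\<not> p dvd a \<Longrightarrow> \<not> p dvd a ^ n"
  using prime_p prime_dvd_power by blast

subsection \<open>Roots with multiplicity\<close>

lemma mdvd_linear_iff: "mdvd [:-\<alpha>, 1:] F \<longleftrightarrow> p dvd poly F \<alpha>"
proof
  assume "mdvd [:-\<alpha>, 1:] F"
  then obtain Q where "mzero (F - [:-\<alpha>, 1:] * Q)" by (auto simp: mdvd_def)
  from mzero_poly[OF this, of \<alpha>] show "p dvd poly F \<alpha>" by simp
next
  assume "p dvd poly F \<alpha>"
  then have "mzero [:poly F \<alpha>:]" by simp
  moreover have "F - [:-\<alpha>, 1:] * synthetic_div F \<alpha> = [:poly F \<alpha>:]"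
    using synthetic_div_correct'[of \<alpha> F] by (metis add_diff_cancel_left')
  ultimately show "mdvd [:-\<alpha>, 1:] F" unfolding mdvd_def by metis
qed

lemma linear_power_not_mzero: "\<not> mzero ([:-\<alpha>, 1:] ^ m)"
  using monic_not_mzero[of "[:-\<alpha>, 1:]"] by (simp add: mzero_power_iff)

text \<open>The degree is that of the integer polynomial and may exceed the degree modulo p.
  Synthetic division lowers this integer degree by one for every linear factor, so zeros can be
  counted against it without reducing coefficients.\<close>

lemma mdvd_linear_power_degree:
  assumes "mdvd ([:-\<alpha>, 1:] ^ m) F" "\<not> mzero F"
  shows "\<exists>Q. mzero (F - [:-\<alpha>, 1:] ^ m * Q) \<and> degree Q + m \<le> degree F"
  using assms
proof (induction m arbitrary: F)
  case 0
  then show ?case by (intro exI[of _ F]) simp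
next
  case (Suc m)
  let ?L = "[:-\<alpha>, 1:]"
  let ?R = "synthetic_div F \<alpha>"
  have "mdvd ?L F" using Suc.prems(1) by (rule mdvd_mono[rotated]) (simp only: power_Suc dvd_triv_left)
  then have root: "p dvd poly F \<alpha>" by (simp only: mdvd_linear_iff)
  have "F - ?L * ?R = [:poly F \<alpha>:]"
    using synthetic_div_correct'[of \<alpha> F] by (metis add_diff_cancel_left')
  with root have FR: "mzero (F - ?L * ?R)" by simp
  have R: "\<not> mzero ?R"
    using FR Suc.prems(2) by (metis diff_add_cancel mzero_add mzero_multr)
  have "mdvd (?L * ?L ^ m) (?L * ?R)"
    using Suc.prems(1) mdvd_cong[OF FR] by simp
  then have "mdvd (?L ^ m) ?R"
    using mdvd_cancel linear_power_not_mzero[of \<alpha> 1] by (simp only: power_one_right)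
  from Suc.IH[OF this R] obtain Q where Q: "mzero (?R - ?L ^ m * Q)" "degree Q + m \<le> degree ?R"
    by blast
  \<comment> \<open>For a constant the truncated \<open>degree F - 1\<close> would not drop; its
    synthetic quotient is 0, which \<open>R\<close> excludes.\<close>
  have deg: "degree F \<noteq> 0"
  proof
    assume "degree F = 0"
    then have "?R = 0" by (simp add: synthetic_div_eq_0_iff)
    with R show False by simp
  qed
  have "F - ?L ^ Suc m * Q = (F - ?L * ?R) + ?L * (?R - ?L ^ m * Q)"
    by (simp only: power_Suc right_diff_distrib mult.assoc add_diff_eq diff_add_cancel)
  then have "mzero (F - ?L ^ Suc m * Q)"
    using FR Q(1) by (simp only: mzero_add mzero_multr)
  moreover have "degree Q + Suc m \<le> degree F"
    using Q(2) deg by (simp add: degree_synthetic_div)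
  ultimately show ?case by blast
qed

lemma mdvd_linear_power_coprime:
  assumes "\<not> p dvd poly A \<beta>" "mdvd ([:-\<beta>, 1:] ^ m) (A * Q)"
  shows "mdvd ([:-\<beta>, 1:] ^ m) Q"
  using assms(2)
proof (induction m arbitrary: Q)
  case 0
  then show ?case by (simp add: mdvd_dvd)
next
  case (Suc m)
  let ?L = "[:-\<beta>, 1:]"
  have "mdvd ?L (A * Q)" using Suc.prems by (rule mdvd_mono[rotated]) (simp only: power_Suc dvd_triv_left)
  then have "p dvd poly A \<beta> * poly Q \<beta>" by (simp only: mdvd_linear_iff poly_mult)
  then have "p dvd poly Q \<beta>"
    using assms(1) prime_dvd_mult_cancel by blast
  then have "mdvd ?L Q" by (simp only: mdvd_linear_iff)
  then obtain R where R: "mzero (Q - ?L * R)" by (auto simp only: mdvd_def)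
  have "A * Q - ?L * (A * R) = A * (Q - ?L * R)"
    by (simp only: right_diff_distrib mult.left_commute)
  then have "mzero (A * Q - ?L * (A * R))" using R by (simp only: mzero_multr)
  then have "mdvd (?L * ?L ^ m) (?L * (A * R))"
    using Suc.prems mdvd_cong by (simp only: power_Suc)
  then have "mdvd (?L ^ m) (A * R)"
    using mdvd_cancel linear_power_not_mzero[of \<beta> 1] by (simp only: power_one_right)
  then have "mdvd (?L ^ m) R" by (rule Suc.IH)
  then obtain S where S: "mzero (R - ?L ^ m * S)" by (auto simp only: mdvd_def)
  have "Q - ?L ^ Suc m * S = (Q - ?L * R) + ?L * (R - ?L ^ m * S)"
    by (simp only: power_Suc right_diff_distrib mult.assoc add_diff_eq diff_add_cancel)
  then have "mzero (Q - ?L ^ Suc m * S)"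
    using R S by (simp only: mzero_add mzero_multr)
  then show ?case unfolding mdvd_def by blast
qed

text \<open>Roots are removed one at a time. Since they are pairwise incongruent, the factor removed
  takes a unit value at every remaining root and does not affect the multiplicity there.\<close>

lemma card_roots_mult_le_degree:
  assumes "finite Z" "\<And>\<alpha>. \<alpha> \<in> Z \<Longrightarrow> mdvd ([:-\<alpha>, 1:] ^ m) F" "\<not> mzero F"
    and "\<And>\<alpha> \<beta>. \<alpha> \<in> Z \<Longrightarrow> \<beta> \<in> Z \<Longrightarrow> p dvd \<alpha> - \<beta> \<Longrightarrow> \<alpha> = \<beta>"
  shows "card Z * m \<le> degree F"
  using assms
proof (induction Z arbitrary: F rule: finite_induct)
  case empty
  then show ?case by simp
next
  case (insert \<beta> Z)
  have "mdvd ([:-\<beta>, 1:] ^ m) F" using insert.prems by simp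
  from mdvd_linear_power_degree[OF this insert.prems(2)] obtain Q
    where Q: "mzero (F - [:-\<beta>, 1:] ^ m * Q)" "degree Q + m \<le> degree F" by blast
  have "\<not> mzero Q"
    using Q(1) insert.prems(2) by (metis diff_add_cancel mzero_add mzero_multr)
  moreover have "mdvd ([:-\<alpha>, 1:] ^ m) Q" if "\<alpha> \<in> Z" for \<alpha>
  proof (rule mdvd_linear_power_coprime)
    have "\<not> p dvd \<alpha> - \<beta>" using insert.prems(3)[of \<alpha> \<beta>] insert.hyps that by auto
    then show "\<not> p dvd poly ([:-\<beta>, 1:] ^ m) \<alpha>"
      by (simp add: poly_power not_dvd_power)
    show "mdvd ([:-\<alpha>, 1:] ^ m) ([:-\<beta>, 1:] ^ m * Q)"
      using insert.prems(1)[of \<alpha>] mdvd_cong[OF Q(1)] that by blast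
  qed
  ultimately have "card Z * m \<le> degree Q"
    using insert.IH insert.prems(3) by simp
  then show ?case using Q(2) insert.hyps by simp
qed

lemma card_roots_le_degree:
  assumes "\<not> mzero F"
  shows "card {x \<in> {0..<p}. p dvd poly F x} \<le> degree F"
proof -
  have "card {x \<in> {0..<p}. p dvd poly F x} * 1 \<le> degree F"
  proof (rule card_roots_mult_le_degree[OF _ _ assms])
    fix \<alpha> \<beta> assume *: "\<alpha> \<in> {x \<in> {0..<p}. p dvd poly F x}" "\<beta> \<in> {x \<in> {0..<p}. p dvd poly F x}" "p dvd \<alpha> - \<beta>"
    from *(3) have "\<alpha> mod p = \<beta> mod p" by (simp only: mod_eq_dvd_iff)
    with * show "\<alpha> = \<beta>"
      by (metis (no_types, lifting) atLeastLessThan_iff mem_Collect_eq mod_pos_pos_trivial)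
  next
    show "finite {x \<in> {0..<p}. p dvd poly F x}"
      by (rule finite_subset[of _ "{0..<p}"]) auto
  qed (simp only: power_one_right mdvd_linear_iff mem_Collect_eq)
  then show ?thesis by simp
qed

text \<open>Each application of W d/dx lowers the order at \<alpha> by one and multiplies the value
  of the cofactor by that order and by W(\<alpha>). After m steps (x - \<alpha>)^m Q has the value
  m! W(\<alpha>)^m Q(\<alpha>), so its vanishing forces a further zero of Q.\<close>

lemma mdvd_linear_power_if_iterated_derivs:
  assumes W: "\<not> p dvd poly W \<alpha>" and "int m \<le> p"
    and "\<And>k. k < m \<Longrightarrow> p dvd poly (((\<lambda>G. W * pderiv G) ^^ k) F) \<alpha>"
  shows "mdvd ([:-\<alpha>, 1:] ^ m) F"
  using assms(2,3)
proof (induction m)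
  case 0
  then show ?case by (simp add: mdvd_dvd)
next
  case (Suc m)
  let ?L = "[:-\<alpha>, 1:]"
  let ?D = "\<lambda>G. W * pderiv G"
  have "mdvd (?L ^ m) F" using Suc by simp
  then obtain Q where Q: "mzero (F - ?L ^ m * Q)" by (auto simp only: mdvd_def)
  have mz: "mzero ((?D ^^ k) F - (?D ^^ k) (?L ^ m * Q))" for k
  proof (induction k)
    case (Suc k)
    have "(?D ^^ Suc k) F - (?D ^^ Suc k) (?L ^ m * Q)
        = W * pderiv ((?D ^^ k) F - (?D ^^ k) (?L ^ m * Q))"
      by (simp add: pderiv_diff right_diff_distrib)
    then show ?case using Suc by (simp only: mzero_multr mzero_pderiv)
  qed (use Q in simp)
  have "\<exists>R. (?D ^^ k) (?L ^ m * Q) = ?L ^ (m - k) * R \<and>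
      poly R \<alpha> = (\<Prod>i<k. int (m - i)) * poly W \<alpha> ^ k * poly Q \<alpha>" if "k \<le> m" for k
    using that
  proof (induction k)
    case 0
    then show ?case by (intro exI[of _ Q]) simp
  next
    case (Suc k)
    then obtain R where R: "(?D ^^ k) (?L ^ m * Q) = ?L ^ (m - k) * R"
      "poly R \<alpha> = (\<Prod>i<k. int (m - i)) * poly W \<alpha> ^ k * poly Q \<alpha>" by auto
    obtain j where j: "m - k = Suc j" "m - Suc k = j"
      using Suc.prems by (metis Suc_diff_Suc Suc_le_lessD)
    have mk: "int m = 1 + int j + int k" using j by linarith
    have pL: "pderiv (?L ^ Suc j) = smult (of_nat (Suc j)) (?L ^ j)"
      by (simp add: pderiv_power_Suc pderiv_pCons del: power_Suc)
    have "(?D ^^ Suc k) (?L ^ m * Q) = W * pderiv (?L ^ Suc j * R)"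
      using R(1) j by simp
    also have "\<dots> = ?L ^ j * (W * (?L * pderiv R + smult (int (Suc j)) R))"
      by (simp only: pderiv_mult pL) (simp add: algebra_simps)
    finally have 1: "(?D ^^ Suc k) (?L ^ m * Q)
        = ?L ^ j * (W * (?L * pderiv R + smult (int (Suc j)) R))" .
    have "poly (W * (?L * pderiv R + smult (int (Suc j)) R)) \<alpha>
        = (\<Prod>i<Suc k. int (m - i)) * poly W \<alpha> ^ Suc k * poly Q \<alpha>"
      using R(2) mk by (simp add: algebra_simps)
    with 1 j show ?case by blast
  qed
  then obtain R where R: "(?D ^^ m) (?L ^ m * Q) = R"
    "poly R \<alpha> = (\<Prod>i<m. int (m - i)) * poly W \<alpha> ^ m * poly Q \<alpha>" by force
  have "p dvd poly ((?D ^^ m) F) \<alpha>" using Suc.prems by simp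
  then have "p dvd poly R \<alpha>"
    using mzero_poly[OF mz[of m], of \<alpha>] R(1) by (simp add: dvd_diff_right_iff)
  \<comment> \<open>The product is m!, and m < p because the induction step provides
    \<open>int (Suc m) \<le> p\<close>.\<close>
  moreover have "\<not> p dvd (\<Prod>i<m. int (m - i))"
  proof
    assume "p dvd (\<Prod>i<m. int (m - i))"
    then obtain i where "i < m" "p dvd int (m - i)"
      using prime_p by (auto simp: prime_dvd_prod_iff)
    then show False using Suc.prems(1) zdvd_imp_le[of p "int (m - i)"] by auto
  qed
  ultimately have "p dvd poly Q \<alpha>"
    using R(2) W not_dvd_power[of "poly W \<alpha>" m] prime_p by (simp add: prime_dvd_mult_iff)
  then have "mdvd ?L Q" by (simp only: mdvd_linear_iff)
  then obtain S where S: "mzero (Q - ?L * S)" by (auto simp only: mdvd_def)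
  have "F - ?L ^ Suc m * S = (F - ?L ^ m * Q) + ?L ^ m * (Q - ?L * S)"
    by (simp only: power_Suc right_diff_distrib mult.assoc mult.left_commute[of ?L]
      add_diff_eq diff_add_cancel)
  then have "mzero (F - ?L ^ Suc m * S)"
    using Q S by (simp only: mzero_add mzero_multr)
  then show ?case unfolding mdvd_def by blast
qed

subsection \<open>Linear systems modulo a prime\<close>

text \<open>Counting replaces rank: there are more coefficient vectors with entries in
  \<open>{0..<p}\<close> than values of the system, so two distinct vectors share a value and their
  difference is a nontrivial solution.\<close>

lemma homogeneous_system_mod:
  fixes c :: "'e \<Rightarrow> 'i \<Rightarrow> int"
  assumes "finite I" "finite E" "card E < card I"
  shows "\<exists>v. (\<exists>i\<in>I. \<not> p dvd v i) \<and> (\<forall>e\<in>E. p dvd (\<Sum>i\<in>I. v i * c e i))"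
proof -
  let ?U = "I \<rightarrow>\<^sub>E {0..<p}" and ?Y = "E \<rightarrow>\<^sub>E {0..<p}"
  define g where "g = (\<lambda>v. \<lambda>e\<in>E. (\<Sum>i\<in>I. v i * c e i) mod p)"
  have "g ` ?U \<subseteq> ?Y" using p_gt_1 by (auto simp: g_def)
  moreover have "card ?Y < card ?U"
    using assms p_gt_1 by (simp add: card_PiE power_strict_increasing)
  moreover have "finite ?Y" using assms by (intro finite_PiE) auto
  ultimately have "\<not> inj_on g ?U"
    by (metis card_inj_on_le leD)
  then obtain v w where vw: "v \<in> ?U" "w \<in> ?U" "g v = g w" "v \<noteq> w"
    by (auto simp: inj_on_def)
  obtain i where i: "i \<in> I" "v i \<noteq> w i" using vw by (metis PiE_ext)
  have "\<not> p dvd v i - w i"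
  proof
    assume "p dvd v i - w i"
    then have "v i mod p = w i mod p" by (simp add: mod_eq_dvd_iff)
    moreover have "v i \<in> {0..<p}" "w i \<in> {0..<p}" using vw i by auto
    ultimately show False using i by simp
  qed
  moreover have "p dvd (\<Sum>i\<in>I. (v i - w i) * c e i)" if "e \<in> E" for e
  proof -
    have "(\<Sum>i\<in>I. v i * c e i) mod p = (\<Sum>i\<in>I. w i * c e i) mod p"
      using fun_cong[OF vw(3), of e] that by (simp add: g_def)
    then show ?thesis
      by (simp add: mod_eq_dvd_iff left_diff_distrib sum_subtractf)
  qed
  ultimately show ?thesis using i by (intro exI[of _ "\<lambda>i. v i - w i"]) auto
qed

end

lemma diff_dvd_power_diff: "x - y dvd x ^ n - (y :: 'a :: comm_ring_1) ^ n"
  by (simp add: power_diff_sumr2)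

context prime_modulus
begin

subsection \<open>Divisibility by powers of a binomial\<close>

abbreviation binom :: "nat \<Rightarrow> int \<Rightarrow> int poly" where
  "binom a \<sigma> \<equiv> monom 1 a - [:\<sigma>:]"

lemma degree_binom: "a > 0 \<Longrightarrow> degree (binom a \<sigma>) = a"
  by (rule antisym, intro degree_diff_le, simp_all add: degree_monom_le)
     (rule le_degree, simp add: coeff_pCons split: nat.splits)

lemma lead_coeff_binom: "a > 0 \<Longrightarrow> lead_coeff (binom a \<sigma>) = 1"
  by (simp add: degree_binom coeff_pCons split: nat.splits)

lemma binom_not_mzero: "a > 0 \<Longrightarrow> \<not> mzero (binom a \<sigma>)"
  by (rule monic_not_mzero) (rule lead_coeff_binom)

lemma coeff_binom_mult:
  "coeff (binom a \<sigma> * Q) n = (if a \<le> n then coeff Q (n - a) else 0) - \<sigma> * coeff Q n"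
  by (simp add: left_diff_distrib coeff_monom_mult)

lemma binom_division: "a > 0 \<Longrightarrow> \<exists>Q R. F = binom a \<sigma> * Q + R \<and> (\<forall>n\<ge>a. coeff R n = 0)"
proof (induction F)
  case 0
  then show ?case by (intro exI[of _ 0]) simp
next
  case (pCons c F)
  then obtain Q R where QR: "F = binom a \<sigma> * Q + R" "\<forall>n\<ge>a. coeff R n = 0" by auto
  \<comment> \<open>Multiplying the remainder by x may create a term of degree a; subtracting
    \<open>?u\<close> times the binomial removes it.\<close>
  let ?u = "coeff R (a - 1)"
  let ?R = "pCons c R - smult ?u (binom a \<sigma>)"
  have "pCons c F = binom a \<sigma> * (pCons 0 Q + [:?u:]) + ?R"
    using QR(1) by (simp add: algebra_simps)
  moreover have "coeff ?R n = 0" if "n \<ge> a" for n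
    using that QR(2) pCons.prems
    by (cases "n = a") (auto simp: coeff_pCons split: nat.splits)
  ultimately show ?case by blast
qed

text \<open>Reading off the coefficients of \<open>x\<^sup>0, x\<^sup>a, x\<^sup>2\<^sup>a, \<dots>\<close> with weights \<open>1, \<sigma>, \<sigma>\<^sup>2, \<dots>\<close>
  is a linear functional on \<open>\<int>[x] / (x\<^sup>a - \<sigma>)\<close>; its translates by powers of \<open>x\<close> separate points.\<close>

definition bin_fun :: "nat \<Rightarrow> int \<Rightarrow> int poly \<Rightarrow> int" where
  "bin_fun a \<sigma> F = (\<Sum>j\<le>degree F. \<sigma> ^ j * coeff F (a * j))"

lemma bin_fun_eq:
  assumes "a > 0" "degree F \<le> N"
  shows "bin_fun a \<sigma> F = (\<Sum>j\<le>N. \<sigma> ^ j * coeff F (a * j))"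
  unfolding bin_fun_def
proof (rule sum.mono_neutral_left)
  show "\<forall>i\<in>{..N} - {..degree F}. \<sigma> ^ i * coeff F (a * i) = 0"
  proof
    fix i assume "i \<in> {..N} - {..degree F}"
    then have "degree F < i" by auto
    also have "i \<le> a * i" using assms(1) by simp
    finally show "\<sigma> ^ i * coeff F (a * i) = 0" by (simp add: coeff_eq_0)
  qed
qed (use assms in auto)

lemma bin_fun_add:
  assumes "a > 0"
  shows "bin_fun a \<sigma> (F + G) = bin_fun a \<sigma> F + bin_fun a \<sigma> G"
proof -
  define N where "N = max (degree F) (degree G)"
  have "degree F \<le> N" "degree G \<le> N" "degree (F + G) \<le> N"
    by (auto simp: N_def degree_add_le)
  then show ?thesis
    using assms by (simp add: bin_fun_eq[of _ _ N] sum.distrib algebra_simps)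
qed

lemma bin_fun_smult:
  assumes "a > 0"
  shows "bin_fun a \<sigma> (smult c F) = c * bin_fun a \<sigma> F"
  using assms
  by (simp add: bin_fun_eq[of _ _ "degree F"] degree_smult_le sum_distrib_left algebra_simps)

lemma bin_fun_diff:
  assumes "a > 0"
  shows "bin_fun a \<sigma> (F - G) = bin_fun a \<sigma> F - bin_fun a \<sigma> G"
  using bin_fun_add[OF assms, of \<sigma> F "smult (-1) G"] bin_fun_smult[OF assms, of \<sigma> "-1" G] by simp

lemma bin_fun_shift:
  assumes "a > 0"
  shows "bin_fun a \<sigma> (monom 1 a * F) = \<sigma> * bin_fun a \<sigma> F"
proof -
  define N where "N = degree (monom 1 a * F) + degree F + 1"
  have "bin_fun a \<sigma> (monom 1 a * F) = (\<Sum>j\<le>Suc N. \<sigma> ^ j * coeff (monom 1 a * F) (a * j))"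
    by (rule bin_fun_eq) (use assms in \<open>auto simp: N_def\<close>)
  also have "\<dots> = (\<Sum>j\<le>N. \<sigma> ^ Suc j * coeff F (a * j))"
    by (subst sum.atMost_Suc_shift) (use assms in \<open>simp add: coeff_monom_mult\<close>)
  also have "\<dots> = \<sigma> * bin_fun a \<sigma> F"
    by (subst bin_fun_eq[of _ _ N]) (use assms in \<open>auto simp: N_def sum_distrib_left algebra_simps\<close>)
  finally show ?thesis .
qed

lemma bin_fun_binom_mult: "a > 0 \<Longrightarrow> bin_fun a \<sigma> (binom a \<sigma> * F) = 0"
  by (simp add: left_diff_distrib bin_fun_diff bin_fun_shift bin_fun_smult)

lemma bin_fun_mzero: "mzero F \<Longrightarrow> p dvd bin_fun a \<sigma> F"
  unfolding bin_fun_def by (intro dvd_sum dvd_mult) (simp add: mzero_iff)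

lemma mdvd_binom_iff:
  assumes "a > 0" "\<not> p dvd \<sigma>"
  shows "mdvd (binom a \<sigma>) F \<longleftrightarrow> (\<forall>k. p dvd bin_fun a \<sigma> (monom 1 k * F))"
proof
  assume "mdvd (binom a \<sigma>) F"
  then obtain Q where Q: "mzero (F - binom a \<sigma> * Q)" by (auto simp: mdvd_def)
  show "\<forall>k. p dvd bin_fun a \<sigma> (monom 1 k * F)"
  proof
    fix k
    have "monom 1 k * F = monom 1 k * (F - binom a \<sigma> * Q) + binom a \<sigma> * (monom 1 k * Q)"
      by (simp add: algebra_simps)
    moreover have "p dvd bin_fun a \<sigma> (monom 1 k * (F - binom a \<sigma> * Q))"
      by (intro bin_fun_mzero mzero_multr Q)
    ultimately show "p dvd bin_fun a \<sigma> (monom 1 k * F)"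
      using assms by (metis bin_fun_add bin_fun_binom_mult add.right_neutral)
  qed
next
  assume *: "\<forall>k. p dvd bin_fun a \<sigma> (monom 1 k * F)"
  obtain Q R where QR: "F = binom a \<sigma> * Q + R" "\<forall>n\<ge>a. coeff R n = 0"
    using binom_division[OF assms(1)] by blast
  have R: "p dvd bin_fun a \<sigma> (monom 1 k * R)" for k
  proof -
    have "monom 1 k * F = binom a \<sigma> * (monom 1 k * Q) + monom 1 k * R"
      unfolding QR(1) by (simp add: algebra_simps)
    then show ?thesis using *[rule_format, of k] assms
      by (metis bin_fun_add bin_fun_binom_mult add.left_neutral)
  qed
  have "p dvd coeff R n" for n
  proof (cases "n < a")
    case True
    \<comment> \<open>Shifting by a - n moves the coefficient of x^n to x^a. As R has degree below
      a, no other exponent of the shifted polynomial is a multiple of a, so the functional returns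
      \<sigma> times that coefficient.\<close>
    have "bin_fun a \<sigma> (monom 1 (a - n) * R)
        = (\<Sum>j\<le>degree (monom 1 (a - n) * R) + 1. \<sigma> ^ j * coeff (monom 1 (a - n) * R) (a * j))"
      by (rule bin_fun_eq) (use assms in auto)
    also have "\<dots> = (\<Sum>j\<in>{1}. \<sigma> ^ j * coeff (monom 1 (a - n) * R) (a * j))"
    proof (rule sum.mono_neutral_right)
      show "\<forall>i\<in>{..degree (monom 1 (a - n) * R) + 1} - {1}.
          \<sigma> ^ i * coeff (monom 1 (a - n) * R) (a * i) = 0"
      proof
        fix i assume "i \<in> {..degree (monom 1 (a - n) * R) + 1} - {1}"
        then have "i = 0 \<or> i \<ge> 2" by auto
        then show "\<sigma> ^ i * coeff (monom 1 (a - n) * R) (a * i) = 0"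
        proof
          assume "i = 0"
          then show ?thesis using True by (simp add: coeff_monom_mult)
        next
          assume "i \<ge> 2"
          then have "a * 2 \<le> a * i" by simp
          then have "a * i - (a - n) \<ge> a" by linarith
          then show ?thesis using QR(2) by (simp add: coeff_monom_mult)
        qed
      qed
    qed auto
    also have "\<dots> = \<sigma> * coeff R n" using True by (simp add: coeff_monom_mult)
    finally show ?thesis using R[of "a - n"] assms(2) prime_dvd_mult_cancel by metis
  qed (use QR in simp)
  then have "mzero (F - binom a \<sigma> * Q)" using QR(1) by (simp add: mzero_iff)
  then show "mdvd (binom a \<sigma>) F" unfolding mdvd_def by blast
qed

lemma monom_power: "monom (1::int) a ^ n = monom 1 (a * n)"
  by (induction n) (simp_all add: mult_monom monom_0 flip: one_pCons)

lemma binom_dvd_monom_diff: "binom a \<sigma> dvd monom 1 (a * m) - [:\<sigma> ^ m:]"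
proof -
  have "monom 1 a - [:\<sigma>:] dvd monom 1 a ^ m - [:\<sigma>:] ^ m"
    by (rule diff_dvd_power_diff) 
  then show ?thesis by (simp add: monom_power poly_const_pow)
qed

text \<open>Modulo x^a - \<sigma> the variable x is a unit: completing x^m to x^(a m) turns it into
  the constant \<sigma>^m.\<close>

lemma mdvd_binom_monom_cancel:
  assumes "a > 0" "\<not> p dvd \<sigma>" "mdvd (binom a \<sigma>) (F * monom 1 m)"
  shows "mdvd (binom a \<sigma>) F"
proof -
  have "mdvd (binom a \<sigma>) (F * monom 1 m * monom 1 ((a - 1) * m))"
    by (rule mdvd_mult) fact
  moreover have "monom 1 m * monom 1 ((a - 1) * m) = monom (1::int) (a * m)"
    using assms(1) by (simp add: mult_monom algebra_simps)
  ultimately have "mdvd (binom a \<sigma>) (F * monom 1 (a * m))" by (simp add: mult.assoc)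
  moreover have "mdvd (binom a \<sigma>) (F * (monom 1 (a * m) - [:\<sigma> ^ m:]))"
    by (intro mdvd_mult2 mdvd_dvd binom_dvd_monom_diff)
  ultimately have "mdvd (binom a \<sigma>) (F * monom 1 (a * m) - F * (monom 1 (a * m) - [:\<sigma> ^ m:]))"
    by (rule mdvd_diff)
  then have "mdvd (binom a \<sigma>) ([:\<sigma> ^ m:] * F)" by (simp add: algebra_simps)
  then show ?thesis by (rule mdvd_unit[rotated]) (rule not_dvd_power, fact)
qed

definition misses_class :: "nat \<Rightarrow> nat \<Rightarrow> int poly \<Rightarrow> bool" where
  "misses_class a r F \<longleftrightarrow> (\<forall>n. n mod a = r \<longrightarrow> p dvd coeff F n)"

text \<open>Let f(k) be the functional applied to x^k F. Then f(k + a) = \<sigma> f(k), and the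
  divisibility hypothesis gives f(k + b) = \<tau> f(k) modulo p. As a and b are coprime, one zero of
  f forces f to vanish everywhere. The missing class supplies it: f(a - r) reads only coefficients
  at exponents congruent to r modulo a.\<close>

lemma mdvd_binom_binom_cancel_missing:
  assumes a: "a > 0" and \<sigma>: "\<not> p dvd \<sigma>" and \<tau>: "\<not> p dvd \<tau>" and ab: "coprime a b"
    and r: "r < a" "misses_class a r F"
    and dvd: "mdvd (binom a \<sigma>) (F * binom b \<tau>)"
  shows "mdvd (binom a \<sigma>) F"
proof -
  let ?f = "\<lambda>k. bin_fun a \<sigma> (monom 1 k * F)"
  have shift_b: "p dvd ?f (k + b) \<longleftrightarrow> p dvd ?f k" for k
  proof -
    have "p dvd bin_fun a \<sigma> (monom 1 k * (F * binom b \<tau>))"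
      using dvd mdvd_binom_iff[OF a \<sigma>] by blast
    moreover have "monom 1 k * (F * binom b \<tau>) = monom 1 (k + b) * F - smult \<tau> (monom 1 k * F)"
      by (simp add: algebra_simps mult_monom)
    ultimately have "p dvd ?f (k + b) - \<tau> * ?f k"
      using a by (simp add: bin_fun_diff bin_fun_smult)
    then have "p dvd ?f (k + b) \<longleftrightarrow> p dvd \<tau> * ?f k"
      using dvd_add_left_iff[of p "?f (k + b) - \<tau> * ?f k" "\<tau> * ?f k"] by auto
    then show ?thesis using \<tau> prime_p by (simp add: prime_dvd_mult_iff)
  qed
  have shift_a: "p dvd ?f (k + a) \<longleftrightarrow> p dvd ?f k" for k
  proof -
    have "monom 1 (k + a) * F = monom 1 a * (monom 1 k * F)"
      by (simp add: mult_monom add.commute flip: mult.assoc)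
    then have "?f (k + a) = \<sigma> * ?f k" by (simp only: bin_fun_shift[OF a])
    then show ?thesis using \<sigma> prime_dvd_mult_cancel by (metis dvd_mult)
  qed
  have shift_am: "p dvd ?f (k + a * m) \<longleftrightarrow> p dvd ?f k" for k m
  proof (induction m)
    case (Suc m)
    have "k + a * Suc m = (k + a * m) + a" by simp
    then show ?case using Suc by (simp only: shift_a)
  qed simp
  have shift_bm: "p dvd ?f (k + b * m) \<longleftrightarrow> p dvd ?f k" for k m
  proof (induction m)
    case (Suc m)
    have "k + b * Suc m = (k + b * m) + b" by simp
    then show ?case using Suc by (simp only: shift_b)
  qed simp
  define k0 where "k0 = a - r"
  have base: "p dvd ?f k0"
    unfolding bin_fun_def
  proof (intro dvd_sum dvd_mult)
    fix j
    show "p dvd coeff (monom 1 k0 * F) (a * j)"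
    proof (cases "k0 \<le> a * j")
      case True
      have "(a * j - k0) mod a = r"
      proof -
        have "j \<noteq> 0" using True r(1) by (cases "j = 0") (simp_all add: k0_def)
        then obtain i where "j = Suc i" by (cases j) auto
        then have "a * j - k0 = r + a * i" using r by (simp add: k0_def)
        then show ?thesis using r by simp
      qed
      then show ?thesis using r True by (simp add: coeff_monom_mult misses_class_def)
    qed (simp add: coeff_monom_mult)
  qed
  have "p dvd ?f k" for k
  proof -
    obtain y where "[b * y = 1] (mod a)"
      using ab cong_solve_coprime_nat[of b a] by (auto simp: coprime_commute)
    \<comment> \<open>\<open>k + (a - 1) * k0\<close> stands for k - k0 modulo a without subtraction
      of natural numbers.\<close>
    from cong_scalar_right[OF this, of "k + (a - 1) * k0"]
    obtain x where x: "[b * x = k + (a - 1) * k0] (mod a)"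
      by (auto simp: mult.assoc)
    have "[k0 + b * x = k0 + (k + (a - 1) * k0)] (mod a)"
      using x by (rule cong_add[OF cong_refl])
    also have "k0 + (k + (a - 1) * k0) = k + a * k0"
      using a by (cases a) simp_all
    also have "[k + a * k0 = k] (mod a)" by (simp add: cong_def)
    finally have "[k0 + b * x = k] (mod a)" .
    then obtain m1 m2 where "k + m2 * a = k0 + b * x + m1 * a"
      unfolding cong_iff_lin_nat by blast
    then have eq: "k + a * m2 = (k0 + b * x) + a * m1" by (simp add: algebra_simps)
    have "p dvd ?f ((k0 + b * x) + a * m1)" unfolding shift_am shift_bm by (rule base)
    then show ?thesis unfolding eq[symmetric] shift_am .
  qed
  then show ?thesis using mdvd_binom_iff[OF a \<sigma>] by blast
qed

text \<open>Up to sign \<sigma>^b - \<tau>^a is the resultant of the binomials. If it is a unit,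
  they are coprime and any power cancels. Otherwise x^a - \<sigma> divides (x^b - \<tau>) W = x^(ab)
  - \<tau>^a modulo p, and W is the unit a \<tau>^(a-1) modulo x^b - \<tau>. Hence a higher power of
  x^b - \<tau> can be lowered to the first one, where the missing class takes over.\<close>

lemma mdvd_binom_binom_power_cancel:
  assumes a: "a > 0" and \<sigma>: "\<not> p dvd \<sigma>" and \<tau>: "\<not> p dvd \<tau>" and ab: "coprime a b"
    and pa: "\<not> p dvd int a"
    and r: "r < a" "misses_class a r F \<or> \<not> p dvd \<sigma> ^ b - \<tau> ^ a"
    and dvd: "mdvd (binom a \<sigma>) (F * binom b \<tau> ^ c)"
  shows "mdvd (binom a \<sigma>) F"
proof -
  let ?T = "binom a \<sigma>" and ?H = "binom b \<tau>"
  define W where "W = (\<Sum>j<a. [:\<tau>:] ^ (a - Suc j) * monom 1 b ^ j)"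
  have HW: "?H * W = monom 1 (a * b) - [:\<tau> ^ a:]"
    unfolding W_def
    by (subst power_diff_sumr2[symmetric]) (simp add: monom_power poly_const_pow mult.commute)
  have "?T dvd (monom 1 (a * b) - [:\<sigma> ^ b:])" by (rule binom_dvd_monom_diff)
  moreover have "?H * W - [:\<sigma> ^ b - \<tau> ^ a:] = monom 1 (a * b) - [:\<sigma> ^ b:]"
    by (simp add: HW)
  ultimately have HW': "?T dvd ?H * W - [:\<sigma> ^ b - \<tau> ^ a:]" by metis
  show ?thesis
  proof (cases "p dvd \<sigma> ^ b - \<tau> ^ a")
    case False
    have "?T dvd (?H * W) ^ c - [:\<sigma> ^ b - \<tau> ^ a:] ^ c"
      using HW' by (meson dvd_trans diff_dvd_power_diff)
    then have "mdvd ?T (F * ((?H * W) ^ c - [:\<sigma> ^ b - \<tau> ^ a:] ^ c))"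
      by (intro mdvd_mult2 mdvd_dvd)
    moreover have "mdvd ?T (F * ?H ^ c * W ^ c)" using dvd by (rule mdvd_mult)
    ultimately have "mdvd ?T (F * ?H ^ c * W ^ c - F * ((?H * W) ^ c - [:\<sigma> ^ b - \<tau> ^ a:] ^ c))"
      by (intro mdvd_diff)
    also have "F * ?H ^ c * W ^ c - F * ((?H * W) ^ c - [:\<sigma> ^ b - \<tau> ^ a:] ^ c)
        = [:(\<sigma> ^ b - \<tau> ^ a) ^ c:] * F"
      by (simp add: power_mult_distrib right_diff_distrib poly_const_pow mult.assoc)
    finally show ?thesis using False not_dvd_power mdvd_unit by blast
  next
    case True
    have "mdvd ?T (?H * W - [:\<sigma> ^ b - \<tau> ^ a:] + [:\<sigma> ^ b - \<tau> ^ a:])"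
      by (rule mdvd_add[OF mdvd_dvd[OF HW'] mdvd_mzero]) (use True in simp)
    then have THW: "mdvd ?T (?H * W)" by simp
    have "?H dvd W - [:int a * \<tau> ^ (a - 1):]"
    proof -
      have "[:int a * \<tau> ^ (a - 1):] = (\<Sum>j<a. [:\<tau>:] ^ (a - Suc j) * [:\<tau>:] ^ j)"
        by (simp add: poly_const_pow of_nat_poly flip: power_add)
      then have "W - [:int a * \<tau> ^ (a - 1):]
          = (\<Sum>j<a. [:\<tau>:] ^ (a - Suc j) * (monom 1 b ^ j - [:\<tau>:] ^ j))"
        by (simp add: W_def sum_subtractf right_diff_distrib)
      then show ?thesis by (auto intro!: dvd_sum dvd_mult diff_dvd_power_diff)
    qed
    then obtain W2 where W2: "W - [:int a * \<tau> ^ (a - 1):] = ?H * W2" by (elim dvdE)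
    have unit: "\<not> p dvd int a * \<tau> ^ (a - 1)"
      using pa \<tau> not_dvd_power prime_dvd_mult_cancel by blast
    have ring: "F * h ^ m * (h * W) - F * h ^ Suc (Suc m) * W2 = F * h ^ Suc m * (W - h * W2)"
      for h m by (simp add: algebra_simps)
    have down: "mdvd ?T (F * ?H ^ Suc m)" if "mdvd ?T (F * ?H ^ Suc (Suc m))" for m
    proof -
      have "mdvd ?T (F * ?H ^ m * (?H * W))" by (rule mdvd_mult2) (rule THW)
      moreover have "mdvd ?T (F * ?H ^ Suc (Suc m) * W2)" using that by (rule mdvd_mult)
      ultimately have "mdvd ?T (F * ?H ^ m * (?H * W) - F * ?H ^ Suc (Suc m) * W2)"
        by (rule mdvd_diff)
      also have "F * ?H ^ m * (?H * W) - F * ?H ^ Suc (Suc m) * W2 = F * ?H ^ Suc m * (W - ?H * W2)"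
        by (rule ring)
      also have "W - ?H * W2 = [:int a * \<tau> ^ (a - 1):]"
        using W2 by (simp only: flip: W2)
      finally show ?thesis using unit mdvd_unit by (metis mult.commute)
    qed
    have "mdvd ?T (F * ?H ^ Suc m) \<Longrightarrow> mdvd ?T (F * ?H)" for m
      by (induction m) (use down in auto)
    then have "mdvd ?T (F * ?H)" using dvd
      by (cases c) (auto intro: mdvd_mult)
    then show ?thesis
      using mdvd_binom_binom_cancel_missing[OF a \<sigma> \<tau> ab r(1)] r(2) True by blast
  qed
qed

text \<open>Comparing coefficients gives the recursion Q_(n-a) - \<sigma> Q_n = F_n, which stays
  inside one residue class modulo a.\<close>

lemma misses_class_quotient:
  assumes "\<not> p dvd \<sigma>" "misses_class a r F" "mzero (F - binom a \<sigma> * Q)" "a > 0"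
  shows "misses_class a r Q"
proof -
  have "p dvd coeff Q n" if "n mod a = r" for n
    using that
  proof (induction n rule: less_induct)
    case (less n)
    have 1: "p dvd coeff F n" using assms(2) less.prems by (simp add: misses_class_def)
    have "p dvd coeff F n - coeff (binom a \<sigma> * Q) n"
      using assms(3) by (simp add: mzero_iff)
    from dvd_diff[OF 1 this]
    have 2: "p dvd (if a \<le> n then coeff Q (n - a) else 0) - \<sigma> * coeff Q n"
      by (simp add: coeff_binom_mult)
    have "p dvd (if a \<le> n then coeff Q (n - a) else 0)"
      using less assms(4) by (auto simp: le_mod_geq)
    from dvd_diff[OF this 2] have "p dvd \<sigma> * coeff Q n" by simp
    then show ?case using assms(1) prime_dvd_mult_cancel by blast
  qed
  then show ?thesis by (simp add: misses_class_def)
qed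

text \<open>One factor x^a - \<sigma> is split off at a time. The quotient again misses the class r,
  so the cancellation hypothesis can be applied to it.\<close>

lemma mdvd_binom_power_peel:
  assumes a: "a > 0" and \<sigma>: "\<not> p dvd \<sigma>"
    and cancel: "\<And>F. misses_class a r F \<or> c \<Longrightarrow> mdvd (binom a \<sigma>) (F * H) \<Longrightarrow> mdvd (binom a \<sigma>) F"
    and "misses_class a r F \<or> c" "mdvd (binom a \<sigma> ^ n) (F * H)"
  shows "mdvd (binom a \<sigma> ^ n) F"
  using assms(4,5)
proof (induction n arbitrary: F)
  case 0
  then show ?case by (simp add: mdvd_dvd)
next
  case (Suc n)
  let ?T = "binom a \<sigma>"
  have "mdvd ?T (F * H)" using Suc.prems(2) by (rule mdvd_mono[rotated]) (simp only: power_Suc dvd_triv_left)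
  with Suc.prems(1) have "mdvd ?T F" by (rule cancel)
  then obtain Q where Q: "mzero (F - ?T * Q)" by (auto simp: mdvd_def)
  have "F * H - ?T * (Q * H) = (F - ?T * Q) * H" by (simp only: left_diff_distrib mult.assoc)
  then have "mzero (F * H - ?T * (Q * H))" using Q by (simp only: mzero_multl)
  then have "mdvd (?T * ?T ^ n) (?T * (Q * H))"
    using Suc.prems(2) mdvd_cong by (simp only: power_Suc)
  then have "mdvd (?T ^ n) (Q * H)" using mdvd_cancel binom_not_mzero[OF a] by blast
  moreover have "misses_class a r Q \<or> c" using Suc.prems(1) misses_class_quotient[OF \<sigma> _ Q a] by blast
  ultimately have "mdvd (?T ^ n) Q" using Suc.IH by blast
  then obtain R where R: "mzero (Q - ?T ^ n * R)" by (auto simp: mdvd_def)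
  have "F - ?T ^ Suc n * R = (F - ?T * Q) + ?T * (Q - ?T ^ n * R)"
    by (simp only: power_Suc right_diff_distrib mult.assoc add_diff_eq diff_add_cancel)
  then have "mzero (F - ?T ^ Suc n * R)" using Q R by (simp only: mzero_add mzero_multr)
  then show ?case unfolding mdvd_def by blast
qed


text \<open>The operator x d/dx - e0 kills the monomial x^e0, multiplies the other coefficients by
  the units e - e0, and costs one power of the binomial. By induction only c x^e0 remains, and x^a -
  \<sigma> divides it only if c vanishes, since x is a unit modulo the binomial.\<close>

lemma mdvd_binom_power_sparse:
  assumes a: "a > 0" and \<sigma>: "\<not> p dvd \<sigma>" and "finite E" "card E \<le> n"
    and "\<And>e. e \<notin> E \<Longrightarrow> p dvd coeff F e"
    and "\<And>e e'. e \<in> E \<Longrightarrow> e' \<in> E \<Longrightarrow> p dvd int e - int e' \<Longrightarrow> e = e'"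
    and "mdvd (binom a \<sigma> ^ n) F"
  shows "mzero F"
  using assms(3-)
proof (induction E arbitrary: F n rule: finite_induct)
  case empty
  then show ?case by (simp add: mzero_iff)
next
  case (insert e0 E)
  let ?T = "binom a \<sigma>"
  obtain m where m: "n = Suc m" "card E \<le> m"
    using insert.prems(1) insert.hyps by (cases n) auto
  define G where "G = monom 1 1 * pderiv F - smult (int e0) F"
  have cG: "coeff G k = (int k - int e0) * coeff F k" for k
    by (cases k) (simp_all add: G_def coeff_monom_mult coeff_pderiv left_diff_distrib distrib_right)
  obtain Q where Q: "mzero (F - ?T ^ Suc m * Q)"
    using insert.prems(4) m by (auto simp: mdvd_def)
  have "mdvd (?T ^ m) (pderiv F)"
  proof -
    have "mzero (pderiv F - pderiv (?T ^ Suc m * Q))"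
      using mzero_pderiv[OF Q] by (simp only: pderiv_diff)
    moreover have "pderiv (u ^ Suc m * Q) = u ^ m * (u * pderiv Q + smult (int (Suc m)) (pderiv u * Q))"
      for u by (simp only: pderiv_mult pderiv_power_Suc) (simp add: algebra_simps)
    then have "?T ^ m dvd pderiv (?T ^ Suc m * Q)" by (simp only: dvd_triv_left)
    ultimately show ?thesis using mdvd_cong mdvd_dvd by blast
  qed
  moreover have TF: "mdvd (?T ^ m) F"
    using insert.prems(4) m(1) by (intro mdvd_mono[of "?T ^ m" "?T ^ n"]) simp_all
  ultimately have "mdvd (?T ^ m) G"
    unfolding G_def using mdvd_mult2[OF TF, of "[:int e0:]"]
    by (intro mdvd_diff mdvd_mult2) simp_all
  moreover have "p dvd coeff G e" if "e \<notin> E" for e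
    using that insert.prems(2)[of e] by (cases "e = e0") (simp_all add: cG)
  ultimately have "mzero G"
    using insert.IH[OF m(2)] insert.prems(3) by blast
  have other: "p dvd coeff F e" if "e \<noteq> e0" for e
  proof (cases "e \<in> E")
    case True
    have "\<not> p dvd int e - int e0" using insert.prems(3)[of e e0] True that by auto
    moreover have "p dvd (int e - int e0) * coeff F e"
      using \<open>mzero G\<close> by (simp add: mzero_iff flip: cG)
    ultimately show ?thesis using prime_dvd_mult_cancel by blast
  qed (use insert.prems(2) that in simp)
  have "mzero (F - [:coeff F e0:] * monom 1 e0)"
    unfolding mzero_iff using other by simp
  moreover have "mdvd ?T F" using insert.prems(4) m by (intro mdvd_mono[of ?T "?T ^ n"]) auto
  ultimately have "mdvd ?T ([:coeff F e0:] * monom 1 e0)" using mdvd_cong by blast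
  then have "mdvd ?T [:coeff F e0:]" by (rule mdvd_binom_monom_cancel[OF a \<sigma>])
  then have "p dvd bin_fun a \<sigma> (monom 1 0 * [:coeff F e0:])"
    using mdvd_binom_iff[OF a \<sigma>] by blast
  then have "p dvd coeff F e0" by (simp add: bin_fun_def monom_0)
  with other show ?case unfolding mzero_iff by metis
qed

definition class_part :: "nat \<Rightarrow> nat \<Rightarrow> int poly \<Rightarrow> int poly" where
  "class_part a r F = (\<Sum>i\<le>degree F. if i mod a = r then monom (coeff F i) i else 0)"

lemma coeff_class_part: "coeff (class_part a r F) n = (if n mod a = r then coeff F n else 0)"
proof -
  have "coeff (class_part a r F) n = (\<Sum>i\<le>degree F. if i = n then (if n mod a = r then coeff F n else 0) else 0)"
    unfolding class_part_def coeff_sum by (rule sum.cong) auto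
  also have "\<dots> = (if n mod a = r then coeff F n else 0)"
    by (auto simp: coeff_eq_0)
  finally show ?thesis .
qed

lemma class_part_binom_mult: "a > 0 \<Longrightarrow> class_part a r (binom a \<sigma> * Q) = binom a \<sigma> * class_part a r Q"
  by (rule poly_eqI) (auto simp: coeff_class_part coeff_binom_mult le_mod_geq)

lemma class_part_binom_power_mult:
  "a > 0 \<Longrightarrow> class_part a r (binom a \<sigma> ^ n * Q) = binom a \<sigma> ^ n * class_part a r Q"
  by (induction n) (simp_all add: class_part_binom_mult mult.assoc)

lemma mdvd_class_part:
  assumes "a > 0" "mdvd (binom a \<sigma> ^ n) F"
  shows "mdvd (binom a \<sigma> ^ n) (class_part a r F)"
proof -
  from assms obtain Q where Q: "mzero (F - binom a \<sigma> ^ n * Q)" by (auto simp: mdvd_def)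
  have "mzero (class_part a r F - binom a \<sigma> ^ n * class_part a r Q)"
    using Q unfolding class_part_binom_power_mult[OF assms(1), symmetric]
    by (simp add: mzero_iff coeff_class_part)
  then show ?thesis unfolding mdvd_def by blast
qed

text \<open>Multiplication by x^a - \<sigma> preserves the residue classes of exponents modulo a, so
  the sparse case applies in each class separately. This admits n monomials per class, a n in
  all.\<close>

lemma mzero_if_mdvd_binom_power:
  assumes a: "a > 0" and \<sigma>: "\<not> p dvd \<sigma>" and "finite E"
    and supp: "\<And>e. e \<notin> E \<Longrightarrow> p dvd coeff F e"
    and small: "\<And>r. r < a \<Longrightarrow> card {e \<in> E. e mod a = r} \<le> n"
    and inj: "\<And>e e'. e \<in> E \<Longrightarrow> e' \<in> E \<Longrightarrow> e mod a = e' mod a \<Longrightarrow> p dvd int e - int e' \<Longrightarrow> e = e'"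
    and dvd: "mdvd (binom a \<sigma> ^ n) F"
  shows "mzero F"
proof -
  have "mzero (class_part a r F)" if "r < a" for r
  proof (rule mdvd_binom_power_sparse[OF a \<sigma>, of "{e \<in> E. e mod a = r}" n])
    show "mdvd (binom a \<sigma> ^ n) (class_part a r F)" by (rule mdvd_class_part[OF a dvd])
  qed (use assms that in \<open>auto simp: coeff_class_part\<close>)
  then have "p dvd coeff (class_part a (e mod a) F) e" for e
    using a by (simp add: mzero_iff)
  then show ?thesis by (simp add: coeff_class_part mzero_iff)
qed

text \<open>If \<open>x\<^sup>a - \<sigma>\<close> and \<open>x\<^sup>b - \<tau>\<close> have a common root, their powers are not coprime. The coefficients still
  vanish provided that no exponent is congruent to \<open>r\<close> modulo \<open>a\<close>: this excludes the multiples of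
  \<open>(x\<^sup>a - \<sigma>) / (x - \<xi>)\<close>, which have monomials in every residue class.\<close>

lemma binom_power_combination_mzero:
  fixes P :: "nat \<Rightarrow> int poly"
  assumes a: "a > 0" and \<sigma>: "\<not> p dvd \<sigma>" and "finite E"
    and supp: "\<And>j e. e \<notin> E \<Longrightarrow> coeff (P j) e = 0"
    and small: "\<And>r. r < a \<Longrightarrow> card {e \<in> E. e mod a = r} \<le> n"
    and inj: "\<And>e e'. e \<in> E \<Longrightarrow> e' \<in> E \<Longrightarrow> e mod a = e' mod a \<Longrightarrow> p dvd int e - int e' \<Longrightarrow> e = e'"
    and cancel: "\<And>F m. misses_class a r F \<or> c \<Longrightarrow> mdvd (binom a \<sigma>) (F * H ^ m) \<Longrightarrow> mdvd (binom a \<sigma>) F"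
    and miss: "(\<forall>e\<in>E. e mod a \<noteq> r) \<or> c"
    and G: "binom a \<sigma> ^ n dvd G" "\<not> mzero G"
    and zero: "mzero (\<Sum>j<J. P j * G ^ j * H ^ (J - 1 - j))"
    and "j < J"
  shows "mzero (P j)"
proof (rule ccontr)
  assume "\<not> mzero (P j)"
  with \<open>j < J\<close> have ex: "\<exists>k<J. \<not> mzero (P k)" by blast
  \<comment> \<open>The lowest surviving index is chosen. After cancelling G^k all later terms keep
    a factor G, hence the n-th power of the binomial, which therefore divides P k times a power of
    H.\<close>
  define k where "k = (LEAST k. k < J \<and> \<not> mzero (P k))"
  have k: "k < J" "\<not> mzero (P k)" using LeastI_ex[OF ex] by (auto simp: k_def)
  have below: "mzero (P i)" if "i < k" for i
    using not_less_Least[of i "\<lambda>k. k < J \<and> \<not> mzero (P k)"] that k(1) by (auto simp: k_def)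
  let ?t = "\<lambda>i. P i * G ^ i * H ^ (J - 1 - i)"
  define R where "R = (\<Sum>i\<in>{Suc k..<J}. P i * G ^ (i - Suc k) * H ^ (J - 1 - i))"
  have "{..<J} = {..<k} \<union> insert k {Suc k..<J}" using k(1) by auto
  then have "sum ?t {..<J} = sum ?t ({..<k} \<union> insert k {Suc k..<J})" by simp
  also have "\<dots> = sum ?t {..<k} + sum ?t (insert k {Suc k..<J})"
    by (rule sum.union_disjoint) auto
  also have "\<dots> = sum ?t {..<k} + ?t k + sum ?t {Suc k..<J}" by simp
  also have "sum ?t {Suc k..<J} = G ^ k * (G * R)"
    unfolding R_def sum_distrib_left
  proof (rule sum.cong)
    fix i assume "i \<in> {Suc k..<J}"
    then have "G ^ i = G ^ k * (G * G ^ (i - Suc k))"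
      by (simp flip: power_Suc power_add)
    then show "?t i = G ^ k * (G * (P i * G ^ (i - Suc k) * H ^ (J - 1 - i)))"
      by (simp only: mult_ac)
  qed simp
  finally have split: "sum ?t {..<J} = sum ?t {..<k} + G ^ k * (P k * H ^ (J - 1 - k) + G * R)"
    by (simp only: distrib_left add.assoc mult_ac)
  have "mzero (sum ?t {..<k})"
    by (intro mzero_sum mzero_multl below) simp
  from mzero_diff[OF zero this] have "mzero (G ^ k * (P k * H ^ (J - 1 - k) + G * R))"
    unfolding split add_diff_cancel_left' .
  then have "mzero (P k * H ^ (J - 1 - k) + G * R)"
    using G(2) by (auto simp: mzero_mult_iff mzero_power_iff)
  then have "mdvd (binom a \<sigma> ^ n) (P k * H ^ (J - 1 - k) + G * R)" by (rule mdvd_mzero)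
  moreover have "mdvd (binom a \<sigma> ^ n) (G * R)" using G(1) by (intro mdvd_mult mdvd_dvd)
  ultimately have "mdvd (binom a \<sigma> ^ n) (P k * H ^ (J - 1 - k))"
    by (metis add_diff_cancel_right' mdvd_diff)
  moreover have "misses_class a r (P k) \<or> c"
    using miss supp by (auto simp: misses_class_def)
  ultimately have "mdvd (binom a \<sigma> ^ n) (P k)"
    using mdvd_binom_power_peel[OF a \<sigma>, of r c "H ^ (J - 1 - k)" "P k" n] cancel by blast
  then have "mzero (P k)"
    by (rule mzero_if_mdvd_binom_power[OF a \<sigma> \<open>finite E\<close> _ small inj, rotated -1]) (simp_all add: supp)
  with k(2) show False by blast
qed

subsection \<open>Auxiliary polynomials vanishing to high order\<close>

text \<open>The derivation \<open>W d/dx\<close> with \<open>W = x (x\<^sup>a - \<sigma>) (x\<^sup>b - \<tau>)\<close> maps each product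
  \<open>x\<^sup>e (x\<^sup>a - \<sigma>)\<^sup>m (x\<^sup>b - \<tau>)\<^sup>n\<close> to a multiple of itself by a cofactor of degree at most \<open>a + b\<close>,
  however large the exponents are.\<close>

definition der_poly :: "nat \<Rightarrow> int \<Rightarrow> nat \<Rightarrow> int \<Rightarrow> int poly" where
  "der_poly a \<sigma> b \<tau> = monom 1 1 * binom a \<sigma> * binom b \<tau>"

definition cofactor :: "nat \<Rightarrow> int \<Rightarrow> nat \<Rightarrow> int \<Rightarrow> nat \<Rightarrow> nat \<Rightarrow> nat \<Rightarrow> int poly" where
  "cofactor a \<sigma> b \<tau> e m n = smult (int e) (binom a \<sigma> * binom b \<tau>)
     + smult (int (m * a)) (monom 1 a * binom b \<tau>) + smult (int (n * b)) (monom 1 b * binom a \<sigma>)"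

definition bi_term :: "nat \<Rightarrow> int \<Rightarrow> nat \<Rightarrow> int \<Rightarrow> nat \<Rightarrow> nat \<Rightarrow> nat \<Rightarrow> int poly" where
  "bi_term a \<sigma> b \<tau> e m n = monom 1 e * binom a \<sigma> ^ m * binom b \<tau> ^ n"

fun iter_cofactor :: "nat \<Rightarrow> int \<Rightarrow> nat \<Rightarrow> int \<Rightarrow> nat \<Rightarrow> nat \<Rightarrow> nat \<Rightarrow> nat \<Rightarrow> int poly" where
  "iter_cofactor a \<sigma> b \<tau> e m n 0 = 1"
| "iter_cofactor a \<sigma> b \<tau> e m n (Suc k) = cofactor a \<sigma> b \<tau> e m n * iter_cofactor a \<sigma> b \<tau> e m n k
     + der_poly a \<sigma> b \<tau> * pderiv (iter_cofactor a \<sigma> b \<tau> e m n k)"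

lemma x_pderiv_monom: "monom (1::int) 1 * pderiv (monom 1 e) = smult (int e) (monom 1 e)"
  by (cases e) (simp_all add: pderiv_monom mult_monom smult_monom monom_0)

lemma x_pderiv_binom_power:
  "monom 1 1 * binom a \<sigma> * pderiv (binom a \<sigma> ^ m) = smult (int (m * a)) (monom 1 a * binom a \<sigma> ^ m)"
proof (cases m)
  case (Suc k)
  have "monom 1 1 * binom a \<sigma> * pderiv (binom a \<sigma> ^ m)
      = smult (int m) (binom a \<sigma> ^ m * (monom 1 1 * pderiv (binom a \<sigma>)))"
    using Suc by (simp only: pderiv_power_Suc) (simp only: power_Suc mult_ac mult_smult_left mult_smult_right of_nat_id)
  also have "monom 1 1 * pderiv (binom a \<sigma>) = smult (int a) (monom 1 a)"
    using x_pderiv_monom[of a] by (simp add: pderiv_diff pderiv_pCons)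
  finally show ?thesis by (simp add: mult.commute)
qed simp

lemma der_bi_term:
  "der_poly a \<sigma> b \<tau> * pderiv (bi_term a \<sigma> b \<tau> e m n) = bi_term a \<sigma> b \<tau> e m n * cofactor a \<sigma> b \<tau> e m n"
proof -
  define X A B where "X = monom (1::int) e" and "A = binom a \<sigma> ^ m" and "B = binom b \<tau> ^ n"
  define x u v where "x = monom (1::int) 1" and "u = binom a \<sigma>" and "v = binom b \<tau>"
  have 1: "x * pderiv X = smult (int e) X"
    unfolding x_def X_def by (rule x_pderiv_monom)
  have 2: "x * u * pderiv A = smult (int (m * a)) (monom 1 a * A)"
    unfolding x_def u_def A_def by (rule x_pderiv_binom_power)
  have 3: "x * v * pderiv B = smult (int (n * b)) (monom 1 b * B)"
    unfolding x_def v_def B_def by (rule x_pderiv_binom_power)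
  have "x * u * v * pderiv (X * A * B)
      = (x * pderiv X) * u * v * A * B + (x * u * pderiv A) * v * X * B + (x * v * pderiv B) * u * X * A"
    by (simp add: pderiv_mult algebra_simps)
  also have "\<dots> = X * A * B * (smult (int e) (u * v) + smult (int (m * a)) (monom 1 a * v)
      + smult (int (n * b)) (monom 1 b * u))"
    unfolding 1 2 3 by (simp add: algebra_simps)
  finally show ?thesis
    by (simp only: der_poly_def bi_term_def cofactor_def X_def A_def B_def x_def u_def v_def)
qed

lemma iterated_der_bi_term:
  "((\<lambda>G. der_poly a \<sigma> b \<tau> * pderiv G) ^^ k) (bi_term a \<sigma> b \<tau> e m n)
     = bi_term a \<sigma> b \<tau> e m n * iter_cofactor a \<sigma> b \<tau> e m n k"
proof (induction k)
  case (Suc k)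
  let ?M = "bi_term a \<sigma> b \<tau> e m n" and ?Q = "iter_cofactor a \<sigma> b \<tau> e m n k"
  have "der_poly a \<sigma> b \<tau> * pderiv (?M * ?Q)
      = (der_poly a \<sigma> b \<tau> * pderiv ?M) * ?Q + ?M * (der_poly a \<sigma> b \<tau> * pderiv ?Q)"
    by (simp add: pderiv_mult algebra_simps)
  also have "\<dots> = ?M * iter_cofactor a \<sigma> b \<tau> e m n (Suc k)"
    unfolding der_bi_term by (simp add: algebra_simps)
  finally show ?case using Suc by simp
qed simp

lemma degree_binom_le: "degree (binom a \<sigma>) \<le> a"
  by (intro degree_diff_le) (simp_all add: degree_monom_le)

lemma degree_mult_le_add: "degree F \<le> m \<Longrightarrow> degree G \<le> n \<Longrightarrow> degree (F * G :: int poly) \<le> m + n"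
  using degree_mult_le[of F G] by linarith

text \<open>Differentiation takes away the degree that the factor x of the derivation adds, so a
  step costs only a + b. A constant, whose degree cannot drop, has derivative 0.\<close>

lemma degree_iter_cofactor: "degree (iter_cofactor a \<sigma> b \<tau> e m n k) \<le> k * (a + b)"
proof (induction k)
  case (Suc k)
  let ?Q = "iter_cofactor a \<sigma> b \<tau> e m n k"
  have c: "degree (cofactor a \<sigma> b \<tau> e m n) \<le> a + b"
    unfolding cofactor_def
    by (intro degree_add_le order.trans[OF degree_smult_le] degree_mult_le_add degree_binom_le
        order.trans[OF degree_mult_le_add[OF degree_monom_le degree_binom_le]]) simp_all
  have w: "degree (der_poly a \<sigma> b \<tau>) \<le> 1 + a + b"
    unfolding der_poly_def by (intro degree_mult_le_add degree_monom_le degree_binom_le)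
  have "degree (der_poly a \<sigma> b \<tau> * pderiv ?Q) \<le> Suc k * (a + b)"
  proof (cases "degree ?Q = 0")
    case True
    then have "pderiv ?Q = 0" by (simp add: pderiv_eq_0_iff)
    then show ?thesis by simp
  next
    case False
    then have "degree (pderiv ?Q) \<le> k * (a + b) - 1" "k * (a + b) \<ge> 1"
      using Suc by (simp_all only: degree_pderiv)
    with degree_mult_le_add[OF w, of "pderiv ?Q" "k * (a + b) - 1"] show ?thesis
      unfolding mult_Suc by linarith
  qed
  moreover have "degree (cofactor a \<sigma> b \<tau> e m n * ?Q) \<le> Suc k * (a + b)"
    using degree_mult_le_add[OF c Suc] by simp
  ultimately show ?case by (simp add: degree_add_le)
qed simp

lemma pderiv_sum: "pderiv (\<Sum>i\<in>I. f i :: int poly) = (\<Sum>i\<in>I. pderiv (f i))"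
  by (induction I rule: infinite_finite_induct) (simp_all add: pderiv_add)

text \<open>At \<alpha> in Z each product of the family equals, up to its constant, \<alpha>^d
  g(\<alpha>) with the same g(\<alpha>). The k-th iterated derivative of a combination is therefore
  g(\<alpha>) times the value of one polynomial of degree below A + M (a + b). Making the
  coefficients of these M polynomials vanish is a linear system whose size does not depend on
  Z.\<close>

lemma exists_vanishing_combination:
  fixes I :: "'i set"
  assumes "finite I" and M: "int M \<le> p"
    and big: "M * (A + M * (a + b)) < card I"
    and deg: "\<And>\<iota>. \<iota> \<in> I \<Longrightarrow> d \<iota> < A"
    and val: "\<And>\<iota> \<alpha>. \<iota> \<in> I \<Longrightarrow> \<alpha> \<in> Z \<Longrightarrow>
        p dvd \<kappa> \<iota> * poly (bi_term a \<sigma> b \<tau> (e \<iota>) (m \<iota>) (n \<iota>)) \<alpha> - \<alpha> ^ d \<iota> * g \<alpha>"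
    and W: "\<And>\<alpha>. \<alpha> \<in> Z \<Longrightarrow> \<not> p dvd poly (der_poly a \<sigma> b \<tau>) \<alpha>"
  shows "\<exists>v. (\<exists>\<iota>\<in>I. \<not> p dvd v \<iota>) \<and> (\<forall>\<alpha>\<in>Z. mdvd ([:-\<alpha>, 1:] ^ M)
           (\<Sum>\<iota>\<in>I. smult (v \<iota> * \<kappa> \<iota>) (bi_term a \<sigma> b \<tau> (e \<iota>) (m \<iota>) (n \<iota>))))"
proof -
  let ?B = "\<lambda>\<iota>. bi_term a \<sigma> b \<tau> (e \<iota>) (m \<iota>) (n \<iota>)"
  let ?Q = "\<lambda>\<iota> k. monom 1 (d \<iota>) * iter_cofactor a \<sigma> b \<tau> (e \<iota>) (m \<iota>) (n \<iota>) k"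
  let ?D = "\<lambda>G. der_poly a \<sigma> b \<tau> * pderiv G"
  have "card ({..<M} \<times> {..<A + M * (a + b)}) < card I" using big by simp
  from homogeneous_system_mod[OF \<open>finite I\<close> _ this, of "\<lambda>(k, l) \<iota>. coeff (?Q \<iota> k) l"]
  obtain v where v: "\<exists>\<iota>\<in>I. \<not> p dvd v \<iota>"
    "\<And>k l. k < M \<Longrightarrow> l < A + M * (a + b) \<Longrightarrow> p dvd (\<Sum>\<iota>\<in>I. v \<iota> * coeff (?Q \<iota> k) l)"
    by force
  have zero: "mzero (\<Sum>\<iota>\<in>I. smult (v \<iota>) (?Q \<iota> k))" if "k < M" for k
    unfolding mzero_iff
  proof
    fix l
    show "p dvd coeff (\<Sum>\<iota>\<in>I. smult (v \<iota>) (?Q \<iota> k)) l"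
    proof (cases "l < A + M * (a + b)")
      case True
      then show ?thesis using v(2)[OF that True] by (simp add: coeff_sum)
    next
      case False
      have "coeff (?Q \<iota> k) l = 0" if "\<iota> \<in> I" for \<iota>
      proof (rule coeff_eq_0)
        have "degree (?Q \<iota> k) \<le> d \<iota> + k * (a + b)"
          by (intro degree_mult_le_add degree_monom_le degree_iter_cofactor)
        also have "\<dots> < A + M * (a + b)"
          using deg[OF that] \<open>k < M\<close> by (intro add_less_le_mono mult_right_mono) simp_all
        finally show "degree (?Q \<iota> k) < l" using False by simp
      qed
      then show ?thesis by (simp add: coeff_sum)
    qed
  qed
  let ?F = "\<Sum>\<iota>\<in>I. smult (v \<iota> * \<kappa> \<iota>) (?B \<iota>)"
  have iter: "(?D ^^ k) ?F = (\<Sum>\<iota>\<in>I. smult (v \<iota> * \<kappa> \<iota>) (?B \<iota> * iter_cofactor a \<sigma> b \<tau> (e \<iota>) (m \<iota>) (n \<iota>) k))"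
    for k
  proof -
    have "(?D ^^ k) ?F = (\<Sum>\<iota>\<in>I. smult (v \<iota> * \<kappa> \<iota>) ((?D ^^ k) (?B \<iota>)))"
      by (induction k) (simp_all add: pderiv_sum pderiv_smult sum_distrib_left)
    then show ?thesis by (simp only: iterated_der_bi_term)
  qed
  have "mdvd ([:-\<alpha>, 1:] ^ M) ?F" if \<alpha>: "\<alpha> \<in> Z" for \<alpha>
  proof (rule mdvd_linear_power_if_iterated_derivs[OF W[OF \<alpha>] M])
    fix k assume k: "k < M"
    let ?q = "\<lambda>\<iota>. poly (iter_cofactor a \<sigma> b \<tau> (e \<iota>) (m \<iota>) (n \<iota>) k) \<alpha>"
    have "poly ((?D ^^ k) ?F) \<alpha> = (\<Sum>\<iota>\<in>I. v \<iota> * (\<kappa> \<iota> * poly (?B \<iota>) \<alpha>) * ?q \<iota>)"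
      unfolding iter by (simp add: poly_sum algebra_simps)
    moreover have 1: "p dvd (\<Sum>\<iota>\<in>I. v \<iota> * (\<kappa> \<iota> * poly (?B \<iota>) \<alpha>) * ?q \<iota>) - g \<alpha> * (\<Sum>\<iota>\<in>I. v \<iota> * (\<alpha> ^ d \<iota> * ?q \<iota>))"
    proof -
      have "(\<Sum>\<iota>\<in>I. v \<iota> * (\<kappa> \<iota> * poly (?B \<iota>) \<alpha>) * ?q \<iota>) - g \<alpha> * (\<Sum>\<iota>\<in>I. v \<iota> * (\<alpha> ^ d \<iota> * ?q \<iota>))
          = (\<Sum>\<iota>\<in>I. (\<kappa> \<iota> * poly (?B \<iota>) \<alpha> - \<alpha> ^ d \<iota> * g \<alpha>) * (v \<iota> * ?q \<iota>))"
        by (simp add: sum_subtractf sum_distrib_left algebra_simps)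
      then show ?thesis using val \<alpha> by (auto intro!: dvd_sum dvd_mult2)
    qed
    have 2: "p dvd g \<alpha> * (\<Sum>\<iota>\<in>I. v \<iota> * (\<alpha> ^ d \<iota> * ?q \<iota>))"
      using mzero_poly[OF zero[OF k], of \<alpha>] by (simp add: poly_sum poly_monom)
    ultimately show "p dvd poly ((?D ^^ k) ?F) \<alpha>"
      using dvd_add[OF 1 2] by simp
  qed
  with v(1) show ?thesis by blast
qed

end

text \<open>Exponents d + t u with d < a A and u < B; at t-th roots of unity x^e reduces to x^d. The
  last condition leaves the class a - 1 modulo a empty when a \<ge> 2, so that the second binomial
  can be cancelled; for a = 1 the maximum retains the only class.\<close>

definition exp_set :: "nat \<Rightarrow> nat \<Rightarrow> nat \<Rightarrow> nat \<Rightarrow> nat set" where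
  "exp_set a t A B = {e. e mod t < a * A \<and> e div t < B \<and> e mod a < max 1 (a - 1)}"

lemma
  assumes "a > 0" "t > 0" "a * A \<le> t" "r < max 1 (a - 1)"
  shows card_exp_set_class: "card {e \<in> exp_set a t A B. e mod a = r} = A * B"
    and finite_exp_set_class: "finite {e \<in> exp_set a t A B. e mod a = r}"
proof -
  \<comment> \<open>\<open>(a - 1) * (t * u)\<close> represents -t u modulo a, so the inner
    remainder is the offset that puts the whole exponent into the class r.\<close>
  define \<phi> where "\<phi> = (\<lambda>(i, u). t * u + (a * i + (r + (a - 1) * (t * u)) mod a))"
  have ra: "r < a" using assms by (auto simp: max_def split: if_splits)
  have sm: "a * i + (r + (a - 1) * (t * u)) mod a < a * A" if "i < A" for i u
  proof -
    have "a * i + (r + (a - 1) * (t * u)) mod a < a * i + a" using assms(1) by simp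
    also have "\<dots> = a * Suc i" by simp
    also have "\<dots> \<le> a * A" using that by (intro mult_left_mono) auto
    finally show ?thesis .
  qed
  have "{e \<in> exp_set a t A B. e mod a = r} = \<phi> ` ({..<A} \<times> {..<B})"
  proof (intro equalityI subsetI)
    fix e assume "e \<in> {e \<in> exp_set a t A B. e mod a = r}"
    then have e: "e mod t < a * A" "e div t < B" "e mod a = r" by (auto simp: exp_set_def)
    define u d where "u = e div t" and "d = e mod t"
    have eud: "e = t * u + d" by (simp add: u_def d_def)
    have "(r + (a - 1) * (t * u)) mod a = (e + (a - 1) * (t * u)) mod a"
      using e(3) by (metis mod_add_left_eq)
    also have "e + (a - 1) * (t * u) = d + a * (t * u)"
      using assms(1) eud by (cases a) (simp_all add: algebra_simps)
    finally have "(r + (a - 1) * (t * u)) mod a = d mod a" by simp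
    then have "e = \<phi> (d div a, u)" unfolding \<phi>_def eud by simp
    moreover have "d div a < A" using e(1) assms(1) d_def by (simp add: less_mult_imp_div_less mult.commute)
    moreover have "u < B" using e(2) by (simp add: u_def)
    ultimately show "e \<in> \<phi> ` ({..<A} \<times> {..<B})" by (intro image_eqI[of _ _ "(d div a, u)"]) auto
  next
    fix e assume "e \<in> \<phi> ` ({..<A} \<times> {..<B})"
    then obtain i u where iu: "i < A" "u < B" "e = t * u + (a * i + (r + (a - 1) * (t * u)) mod a)"
      by (auto simp: \<phi>_def)
    have lt: "a * i + (r + (a - 1) * (t * u)) mod a < t" using sm[OF iu(1)] assms(3) by (rule less_le_trans)
    then have "e mod t = a * i + (r + (a - 1) * (t * u)) mod a" "e div t = u"
      using iu(3) assms(2) by simp_all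
    moreover have "e mod a = r"
    proof -
      have "e mod a = (t * u + (a * i + (r + (a - 1) * (t * u)))) mod a"
        unfolding iu(3) by (metis mod_add_right_eq)
      also have "t * u + (a * i + (r + (a - 1) * (t * u))) = r + a * (i + t * u)"
        using assms(1) by (cases a) (simp_all add: algebra_simps)
      finally show ?thesis using ra by simp
    qed
    ultimately show "e \<in> {e \<in> exp_set a t A B. e mod a = r}"
      using sm[OF iu(1)] iu(2) assms(4) by (simp add: exp_set_def)
  qed
  moreover have "inj_on \<phi> ({..<A} \<times> {..<B})"
  proof (rule inj_onI, clarify)
    fix i u i' u' assume *: "i < A" "i' < A" "\<phi> (i, u) = \<phi> (i', u')"
    have lt: "a * i + (r + (a - 1) * (t * u)) mod a < t" "a * i' + (r + (a - 1) * (t * u')) mod a < t"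
      using sm[OF *(1), of u] sm[OF *(2), of u'] assms(3) by linarith+
    have "\<phi> (i, u) div t = u" "\<phi> (i', u') div t = u'"
      using lt assms(2) by (simp_all add: \<phi>_def)
    then have u: "u = u'" using *(3) by simp
    then have "a * i = a * i'" using *(3) by (simp add: \<phi>_def)
    then show "i = i' \<and> u = u'" using assms(1) u by simp
  qed
  ultimately show "card {e \<in> exp_set a t A B. e mod a = r} = A * B"
    "finite {e \<in> exp_set a t A B. e mod a = r}"
    by (simp_all add: card_image)
qed

lemma
  assumes "a > 0" "t > 0" "a * A \<le> t"
  shows card_exp_set: "card (exp_set a t A B) = max 1 (a - 1) * (A * B)"
    and finite_exp_set: "finite (exp_set a t A B)"
proof -
  have un: "exp_set a t A B = (\<Union>r<max 1 (a - 1). {e \<in> exp_set a t A B. e mod a = r})"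
    by (auto simp: exp_set_def)
  show "finite (exp_set a t A B)"
    by (subst un) (use finite_exp_set_class[OF assms] in blast)
  have "card (\<Union>r<max 1 (a - 1). {e \<in> exp_set a t A B. e mod a = r})
      = (\<Sum>r<max 1 (a - 1). card {e \<in> exp_set a t A B. e mod a = r})"
    by (rule card_UN_disjoint) (use finite_exp_set_class[OF assms] in auto)
  also have "\<dots> = (\<Sum>r<max 1 (a - 1). A * B)"
    by (rule sum.cong) (use card_exp_set_class[OF assms] in auto)
  finally show "card (exp_set a t A B) = max 1 (a - 1) * (A * B)"
    using un by simp
qed

section \<open>Stepanov's method for the curve equations\<close>

context prime_modulus
begin

text \<open>On Z the relations z^t = 1 and G(z) = H(z) identify many of the products x^e G^j
  H^(J-1-j), so few conditions make a combination vanish to order M there. As polynomials they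
  remain independent modulo p: each P j has at most N monomials per class, while G contains the N-th
  power of the binomial. The zeros are then counted against the degree.\<close>

lemma stepanov_core:
  assumes ab: "a > 0" and pa: "\<not> p dvd int a" and \<sigma>: "\<not> p dvd \<sigma>" and t: "t > 0"
    and params: "a * A \<le> t" "int (t * B) \<le> int a * p" "A * B \<le> N" "int M \<le> p"
      "M * (a * A + M * (a + b)) < J * (max 1 (a - 1) * (A * B))"
    and Z: "finite Z" "\<And>\<alpha> \<beta>. \<alpha> \<in> Z \<Longrightarrow> \<beta> \<in> Z \<Longrightarrow> p dvd \<alpha> - \<beta> \<Longrightarrow> \<alpha> = \<beta>"
      "\<And>z. z \<in> Z \<Longrightarrow> \<not> p dvd poly (der_poly a \<sigma> b \<tau>) z" "\<And>z. z \<in> Z \<Longrightarrow> p dvd z ^ t - 1"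
      "\<And>z. z \<in> Z \<Longrightarrow> p dvd poly G z - poly H z"
    and G: "binom a \<sigma> ^ N dvd G" "\<not> mzero G"
    and cancel: "\<And>F m. misses_class a (a - 1) F \<or> c \<Longrightarrow> mdvd (binom a \<sigma>) (F * H ^ m) \<Longrightarrow> mdvd (binom a \<sigma>) F"
    and c: "a \<ge> 2 \<or> c"
    and repr: "\<And>j e. j < J \<Longrightarrow> monom 1 e * G ^ j * H ^ (J - 1 - j)
        = smult (\<kappa> j) (bi_term a \<sigma> b \<tau> (e + e0 j) (m j) (n j))"
    and deg: "degree G \<le> D" "degree H \<le> D"
  shows "card Z * M \<le> t * (B - 1) + a * A + D * J"
proof -
  let ?E = "exp_set a t A B"
  let ?I = "{..<J} \<times> ?E"
  have finE: "finite ?E" by (rule finite_exp_set[OF ab t params(1)])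
  have "card ?I = J * (max 1 (a - 1) * (A * B))"
    by (simp add: card_cartesian_product card_exp_set[OF ab t params(1)])
  then have big: "M * (a * A + M * (a + b)) < card ?I" using params(5) by simp
  have pw: "p dvd z ^ e - z ^ (e mod t)" if "z \<in> Z" for z e
  proof -
    have "z ^ t - 1 dvd (z ^ t) ^ (e div t) - 1"
      using diff_dvd_power_diff[of "z ^ t" 1 "e div t"] by simp
    then have "p dvd ((z ^ t) ^ (e div t) - 1) * z ^ (e mod t)"
      using Z(4)[OF that] by (meson dvd_mult2 dvd_trans)
    moreover have "(z ^ t) ^ (e div t) * z ^ (e mod t) = z ^ e"
      by (metis mult_div_mod_eq power_add power_mult)
    ultimately show ?thesis by (simp add: left_diff_distrib)
  qed
  have GH: "p dvd poly H z ^ k - poly G z ^ k" if "z \<in> Z" for z k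
    using Z(5)[OF that] diff_dvd_power_diff[of "poly H z" "poly G z" k]
    by (meson dvd_diff_commute dvd_trans)
  have val: "p dvd \<kappa> (fst \<iota>) * poly (bi_term a \<sigma> b \<tau> (snd \<iota> + e0 (fst \<iota>)) (m (fst \<iota>)) (n (fst \<iota>))) \<alpha>
      - \<alpha> ^ (snd \<iota> mod t) * poly G \<alpha> ^ (J - 1)" if "\<iota> \<in> ?I" "\<alpha> \<in> Z" for \<iota> \<alpha>
  proof -
    obtain j e where je: "\<iota> = (j, e)" "j < J" using \<open>\<iota> \<in> ?I\<close> by auto
    let ?g = "poly G \<alpha>" and ?h = "poly H \<alpha>"
    have "\<kappa> j * poly (bi_term a \<sigma> b \<tau> (e + e0 j) (m j) (n j)) \<alpha> = \<alpha> ^ e * ?g ^ j * ?h ^ (J - 1 - j)"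
      using arg_cong[OF repr[OF je(2), of e], of "\<lambda>F. poly F \<alpha>"] by (simp add: poly_monom)
    moreover have "?g ^ (J - 1) = ?g ^ j * ?g ^ (J - 1 - j)"
      using je(2) by (simp flip: power_add)
    then have "\<alpha> ^ e * ?g ^ j * ?h ^ (J - 1 - j) - \<alpha> ^ (e mod t) * ?g ^ (J - 1)
        = ?g ^ j * (\<alpha> ^ e * (?h ^ (J - 1 - j) - ?g ^ (J - 1 - j)) + (\<alpha> ^ e - \<alpha> ^ (e mod t)) * ?g ^ (J - 1 - j))"
      by (simp add: algebra_simps)
    moreover have "p dvd ?g ^ j * (\<alpha> ^ e * (?h ^ (J - 1 - j) - ?g ^ (J - 1 - j)) + (\<alpha> ^ e - \<alpha> ^ (e mod t)) * ?g ^ (J - 1 - j))"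
      by (intro dvd_mult dvd_add dvd_mult2 pw GH that)
    ultimately show ?thesis using je by simp
  qed
  have dlt: "snd \<iota> mod t < a * A" if "\<iota> \<in> ?I" for \<iota>
    using that by (auto simp: exp_set_def)
  have "finite ?I" using finE by simp
  from exists_vanishing_combination[where I = ?I and d = "\<lambda>\<iota>. snd \<iota> mod t" and Z = Z and g = "\<lambda>\<alpha>. poly G \<alpha> ^ (J - 1)",
      OF this params(4) big dlt val Z(3)]
  obtain v where v: "\<exists>\<iota>\<in>?I. \<not> p dvd v \<iota>" "\<And>\<alpha>. \<alpha> \<in> Z \<Longrightarrow> mdvd ([:-\<alpha>, 1:] ^ M)
      (\<Sum>\<iota>\<in>?I. smult (v \<iota> * \<kappa> (fst \<iota>)) (bi_term a \<sigma> b \<tau> (snd \<iota> + e0 (fst \<iota>)) (m (fst \<iota>)) (n (fst \<iota>))))"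
    by blast
  define P where "P = (\<lambda>j. \<Sum>e\<in>?E. monom (v (j, e)) e)"
  define F where "F = (\<Sum>j<J. P j * G ^ j * H ^ (J - 1 - j))"
  have "F = (\<Sum>j<J. \<Sum>e\<in>?E. smult (v (j, e)) (monom 1 e * G ^ j * H ^ (J - 1 - j)))"
    unfolding F_def P_def by (intro sum.cong refl) (simp add: sum_distrib_right smult_monom flip: mult_smult_left)
  also have "\<dots> = (\<Sum>j<J. \<Sum>e\<in>?E. smult (v (j, e) * \<kappa> j) (bi_term a \<sigma> b \<tau> (e + e0 j) (m j) (n j)))"
    by (intro sum.cong refl) (simp only: lessThan_iff repr smult_smult)
  also have "\<dots> = (\<Sum>\<iota>\<in>?I. smult (v \<iota> * \<kappa> (fst \<iota>)) (bi_term a \<sigma> b \<tau> (snd \<iota> + e0 (fst \<iota>)) (m (fst \<iota>)) (n (fst \<iota>))))"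
    by (subst sum.cartesian_product) (simp add: case_prod_beta)
  finally have vanish: "mdvd ([:-\<alpha>, 1:] ^ M) F" if "\<alpha> \<in> Z" for \<alpha> using v(2)[OF that] by simp
  have coeffP: "coeff (P j) e = (if e \<in> ?E then v (j, e) else 0)" for j e
    unfolding P_def coeff_sum using finE by (simp add: coeff_monom)
  have "\<not> mzero F"
  proof
    assume zero: "mzero F"
    \<comment> \<open>Exponents lie below t B \<le> a p, so a congruence modulo the coprime numbers
      a and p is an equality.\<close>
    have inj: "e = e'" if "e \<in> ?E" "e' \<in> ?E" "e mod a = e' mod a" "p dvd int e - int e'" for e e'
    proof -
      have lt: "e < t * B" "e' < t * B"
        using that(1,2) t by (auto simp: exp_set_def mult.commute div_less_iff_less_mult)
      have ad: "int a dvd int e - int e'" using that(3) by (metis mod_eq_dvd_iff zmod_int)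
      have "coprime (int a) p" using pa prime_p by (metis coprime_commute prime_imp_coprime)
      then have dvd: "int a * p dvd int e - int e'" by (rule divides_mult[OF ad that(4)])
      have "\<bar>int e - int e'\<bar> < int (t * B)" using lt by linarith
      then have "\<bar>int e - int e'\<bar> < int a * p" using params(2) by linarith
      then show "e = e'" using dvd zdvd_imp_le[of "int a * p" "\<bar>int e - int e'\<bar>"] by fastforce
    qed
    have "mzero (P j)" if "j < J" for j
    proof (rule binom_power_combination_mzero[where r = "a - 1" and c = c and E = ?E and P = P
          and H = H and J = J and n = N, OF ab \<sigma> finE _ _ _ _ _ G])
      show "card {e \<in> ?E. e mod a = r} \<le> N" if "r < a" for r
      proof (cases "r < max 1 (a - 1)")
        case True
        then show ?thesis using card_exp_set_class[OF ab t params(1)] params(3) by simp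
      next
        case False
        then have empty: "{e \<in> ?E. e mod a = r} = {}" by (auto simp: exp_set_def)
        show ?thesis unfolding empty by simp
      qed
      show "(\<forall>e\<in>?E. e mod a \<noteq> a - 1) \<or> c" using c by (auto simp: exp_set_def)
      show "mzero (\<Sum>j<J. P j * G ^ j * H ^ (J - 1 - j))" using zero by (simp only: F_def)
      show "e = e'" if "e \<in> ?E" "e' \<in> ?E" "e mod a = e' mod a" "p dvd int e - int e'" for e e'
        using that by (rule inj)
      show "mdvd (binom a \<sigma>) F'" if "misses_class a (a - 1) F' \<or> c" "mdvd (binom a \<sigma>) (F' * H ^ m')" for F' m'
        using that by (rule cancel)
    qed (use that in \<open>auto simp: coeffP\<close>)
    moreover obtain j e where "j < J" "e \<in> ?E" "\<not> p dvd v (j, e)" using v(1) by auto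
    ultimately have "p dvd coeff (P j) e" by (simp only: mzero_iff)
    then show False using coeffP[of j e] \<open>e \<in> ?E\<close> \<open>\<not> p dvd v (j, e)\<close> by simp
  qed
  then have "card Z * M \<le> degree F"
    using card_roots_mult_le_degree[OF Z(1) vanish _ Z(2)] by blast
  also have "degree F \<le> t * (B - 1) + a * A + D * J"
    unfolding F_def
  proof (rule degree_sum_le)
    fix j assume j: "j \<in> {..<J}"
    have "degree (P j) \<le> t * (B - 1) + a * A"
      unfolding P_def
    proof (rule degree_sum_le[OF finE])
      fix e assume "e \<in> ?E"
      then have "e div t \<le> B - 1" "e mod t \<le> a * A" by (auto simp: exp_set_def)
      then have "t * (e div t) + e mod t \<le> t * (B - 1) + a * A"
        by (intro add_mono mult_left_mono) simp_all
      then show "degree (monom (v (j, e)) e) \<le> t * (B - 1) + a * A"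
        using degree_monom_le[of "v (j, e)" e] by simp
    qed
    moreover have "degree (G ^ j) \<le> D * j" "degree (H ^ (J - 1 - j)) \<le> D * (J - 1 - j)"
      using deg by (meson degree_power_le mult_le_mono1 order.trans)+
    ultimately have "degree (P j * G ^ j * H ^ (J - 1 - j)) \<le> t * (B - 1) + a * A + D * j + D * (J - 1 - j)"
      by (intro degree_mult_le_add)
    also have "\<dots> = t * (B - 1) + a * A + D * (j + (J - 1 - j))" by (simp only: distrib_left add.assoc)
    also have "\<dots> \<le> t * (B - 1) + a * A + D * J" using j by (intro add_mono mult_left_mono) auto
    finally show "degree (P j * G ^ j * H ^ (J - 1 - j)) \<le> t * (B - 1) + a * A + D * J" .
  qed simp
  finally show ?thesis .
qed

text \<open>G and H are powers of the two binomials. For a = 1 no class can be left out, so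
  cancellation has to come from a nonzero resultant; for a = b = 1 and \<sigma> = \<tau> the
  equation can even be an identity. The degree term is doubled to share its form with
  \<open>stepanov_neg\<close>.\<close>

lemma stepanov_pos:
  assumes a: "a > 0" and b: "b > 0" and ab: "coprime a b" and pa: "\<not> p dvd int a"
    and \<sigma>: "\<not> p dvd \<sigma>" and \<tau>: "\<not> p dvd \<tau>" and \<omega>: "\<not> p dvd \<omega>" and f: "f > 0" and t: "t > 0"
    and params: "a * A \<le> t" "int (t * B) \<le> int a * p" "A * B \<le> f * b" "int M \<le> p"
      "M * (a * A + M * (a + b)) < J * (max 1 (a - 1) * (A * B))"
    and Z: "finite Z" "\<And>\<alpha> \<beta>. \<alpha> \<in> Z \<Longrightarrow> \<beta> \<in> Z \<Longrightarrow> p dvd \<alpha> - \<beta> \<Longrightarrow> \<alpha> = \<beta>"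
      "\<And>z. z \<in> Z \<Longrightarrow> \<not> p dvd z" "\<And>z. z \<in> Z \<Longrightarrow> p dvd z ^ t - 1"
      "\<And>z. z \<in> Z \<Longrightarrow> \<not> p dvd z ^ a - \<sigma>" "\<And>z. z \<in> Z \<Longrightarrow> \<not> p dvd z ^ b - \<tau>"
      "\<And>z. z \<in> Z \<Longrightarrow> p dvd (z ^ a - \<sigma>) ^ (f * b) - \<omega> * (z ^ b - \<tau>) ^ (f * a)"
    and c: "a \<ge> 2 \<or> \<not> p dvd \<sigma> ^ b - \<tau> ^ a"
  shows "card Z * M \<le> t * (B - 1) + a * A + 2 * (f * a * b) * J"
proof -
  let ?G = "binom a \<sigma> ^ (f * b)" and ?H = "smult \<omega> (binom b \<tau> ^ (f * a))"
  have "card Z * M \<le> t * (B - 1) + a * A + (f * a * b) * J"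
  proof (rule stepanov_core[where G = ?G and H = ?H and \<kappa> = "\<lambda>j. \<omega> ^ (J - 1 - j)" and ?e0.0 = "\<lambda>j. 0"
        and m = "\<lambda>j. f * b * j" and n = "\<lambda>j. f * a * (J - 1 - j)" and c = "\<not> p dvd \<sigma> ^ b - \<tau> ^ a"
        and \<tau> = \<tau> and b = b and N = "f * b", OF a pa \<sigma> t params Z(1,2)])
    show "\<not> p dvd poly (der_poly a \<sigma> b \<tau>) z" if "z \<in> Z" for z
      using Z(3,5,6)[OF that] prime_p by (simp add: der_poly_def poly_monom prime_dvd_mult_iff)
    show "p dvd z ^ t - 1" if "z \<in> Z" for z using Z(4) that .
    show "p dvd poly ?G z - poly ?H z" if "z \<in> Z" for z using Z(7)[OF that] by (simp add: poly_power poly_monom)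
    show "\<not> mzero ?G" using binom_not_mzero[OF a] by (simp add: mzero_power_iff)
    show "mdvd (binom a \<sigma>) F" if "misses_class a (a - 1) F \<or> \<not> p dvd \<sigma> ^ b - \<tau> ^ a"
      "mdvd (binom a \<sigma>) (F * ?H ^ m)" for F m
    proof -
      have "F * ?H ^ m = [:\<omega> ^ m:] * (F * binom b \<tau> ^ (f * a * m))"
        by (simp add: smult_power power_mult)
      then have "mdvd (binom a \<sigma>) (F * binom b \<tau> ^ (f * a * m))"
        using that(2) mdvd_unit[OF not_dvd_power[OF \<omega>, of m]] by metis
      then show ?thesis
        using mdvd_binom_binom_power_cancel[OF a \<sigma> \<tau> ab pa _ that(1)] a by simp
    qed
    show "monom 1 e * ?G ^ j * ?H ^ (J - 1 - j) = smult (\<omega> ^ (J - 1 - j))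
        (bi_term a \<sigma> b \<tau> (e + 0) (f * b * j) (f * a * (J - 1 - j)))" for j e
      by (simp add: bi_term_def smult_power power_mult)
    show "degree ?G \<le> f * a * b"
      using degree_power_le[of "binom a \<sigma>" "f * b"] degree_binom[OF a, of \<sigma>] by (simp add: mult_ac)
    have "degree (binom b \<tau> ^ (f * a)) \<le> f * a * b"
      using degree_power_le[of "binom b \<tau>" "f * a"] degree_binom[OF b, of \<tau>] by (simp add: mult_ac)
    then show "degree ?H \<le> f * a * b" using degree_smult_le order.trans by blast
  qed (use c in simp_all)
  also have "\<dots> \<le> t * (B - 1) + a * A + 2 * (f * a * b) * J" by simp
  finally show ?thesis .
qed

text \<open>With a negative exponent, clearing denominators puts both binomials on one side and
  leaves a monomial as H. It is a unit modulo x^a - \<sigma>, so cancellation is unconditional and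
  \<open>c\<close> is \<open>True\<close>; the price is a G of degree 2 f a b.\<close>

lemma stepanov_neg:
  assumes a: "a > 0" and b: "b > 0" and pa: "\<not> p dvd int a"
    and \<sigma>: "\<not> p dvd \<sigma>" and \<omega>: "\<not> p dvd \<omega>" and f: "f > 0" and t: "t > 0"
    and params: "a * A \<le> t" "int (t * B) \<le> int a * p" "A * B \<le> f * b" "int M \<le> p"
      "M * (a * A + M * (a + b)) < J * (max 1 (a - 1) * (A * B))"
    and Z: "finite Z" "\<And>\<alpha> \<beta>. \<alpha> \<in> Z \<Longrightarrow> \<beta> \<in> Z \<Longrightarrow> p dvd \<alpha> - \<beta> \<Longrightarrow> \<alpha> = \<beta>"
      "\<And>z. z \<in> Z \<Longrightarrow> \<not> p dvd z" "\<And>z. z \<in> Z \<Longrightarrow> p dvd z ^ t - 1"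
      "\<And>z. z \<in> Z \<Longrightarrow> \<not> p dvd z ^ a - \<sigma>" "\<And>z. z \<in> Z \<Longrightarrow> \<not> p dvd z ^ b - \<tau>"
      "\<And>z. z \<in> Z \<Longrightarrow> p dvd \<omega> * (z ^ a - \<sigma>) ^ (f * b) * (z ^ b - \<tau>) ^ (f * a) - z ^ (f * a * b)"
  shows "card Z * M \<le> t * (B - 1) + a * A + 2 * (f * a * b) * J"
proof (rule stepanov_core[where G = "smult \<omega> (binom a \<sigma> ^ (f * b) * binom b \<tau> ^ (f * a))"
      and H = "monom 1 (f * a * b)" and \<kappa> = "\<lambda>j. \<omega> ^ j" and ?e0.0 = "\<lambda>j. f * a * b * (J - 1 - j)"
      and m = "\<lambda>j. f * b * j" and n = "\<lambda>j. f * a * j" and c = True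
      and \<tau> = \<tau> and b = b and N = "f * b", OF a pa \<sigma> t params Z(1,2)])
  let ?G = "smult \<omega> (binom a \<sigma> ^ (f * b) * binom b \<tau> ^ (f * a))" and ?H = "monom (1::int) (f * a * b)"
  show "\<not> p dvd poly (der_poly a \<sigma> b \<tau>) z" if "z \<in> Z" for z
    using Z(3,5,6)[OF that] prime_p by (simp add: der_poly_def poly_monom prime_dvd_mult_iff)
  show "p dvd z ^ t - 1" if "z \<in> Z" for z using Z(4) that .
  show "p dvd poly ?G z - poly ?H z" if "z \<in> Z" for z
    using Z(7)[OF that] by (simp add: poly_power poly_monom mult.assoc)
  have "?G = [:\<omega>:] * (binom a \<sigma> ^ (f * b) * binom b \<tau> ^ (f * a))" by simp
  then show "\<not> mzero ?G"
    using binom_not_mzero[OF a] binom_not_mzero[OF b] \<omega>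
    by (simp only: mzero_mult_iff mzero_power_iff mzero_const_iff) simp
  show "mdvd (binom a \<sigma>) F" if "mdvd (binom a \<sigma>) (F * ?H ^ m)" for F m
    using that mdvd_binom_monom_cancel[OF a \<sigma>] unfolding monom_power by blast
  show "monom 1 e * ?G ^ j * ?H ^ (J - 1 - j) = smult (\<omega> ^ j)
      (bi_term a \<sigma> b \<tau> (e + f * a * b * (J - 1 - j)) (f * b * j) (f * a * j))" for j e
  proof -
    have "?G ^ j = smult (\<omega> ^ j) (binom a \<sigma> ^ (f * b * j) * binom b \<tau> ^ (f * a * j))"
      by (simp add: smult_power power_mult power_mult_distrib)
    moreover have "monom 1 (e + f * a * b * (J - 1 - j)) = monom 1 e * ?H ^ (J - 1 - j)"
      by (simp add: monom_power mult_monom)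
    ultimately show ?thesis
      by (simp only: bi_term_def mult_smult_left mult_smult_right mult_ac)
  qed
  have "degree (binom a \<sigma> ^ (f * b)) \<le> f * a * b"
    using degree_power_le[of "binom a \<sigma>" "f * b"] degree_binom[OF a, of \<sigma>] by (simp add: mult_ac)
  moreover have "degree (binom b \<tau> ^ (f * a)) \<le> f * a * b"
    using degree_power_le[of "binom b \<tau>" "f * a"] degree_binom[OF b, of \<tau>] by (simp add: mult_ac)
  ultimately have "degree (binom a \<sigma> ^ (f * b) * binom b \<tau> ^ (f * a)) \<le> f * a * b + f * a * b"
    by (rule degree_mult_le_add)
  then show "degree ?G \<le> 2 * (f * a * b)" using degree_smult_le order.trans by (metis mult_2)
  show "binom a \<sigma> ^ (f * b) dvd ?G" by (intro dvd_smult) simp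
  show "degree ?H \<le> 2 * (f * a * b)" using degree_monom_le[of "1::int" "f * a * b"] by linarith
qed simp_all


subsection \<open>Differences in a cyclic subgroup of pairs\<close>

lemma not_dvd_iff_coprime: "\<not> p dvd x \<longleftrightarrow> coprime x p"
  using prime_imp_coprime[OF prime_p, of x] coprime_common_divisor[of x p p] not_prime_unit[of p] prime_p
  by (auto simp: coprime_commute)

lemma cong_not_dvd: "[x = y] (mod p) \<Longrightarrow> \<not> p dvd y \<Longrightarrow> \<not> p dvd x"
  by (simp add: cong_dvd_iff)

lemma inverse_mod: "\<not> p dvd x \<Longrightarrow> \<exists>y. [x * y = 1] (mod p)"
  using unit_inverse by (simp add: cong_iff_dvd_diff)

lemma cong_1_pow_mult: "[x ^ m = 1] (mod p) \<Longrightarrow> [x ^ (m * k) = 1] (mod p)"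
  using cong_pow[of "x ^ m" 1 p k] by (simp add: power_mult)

lemma cong_cancel: "\<not> p dvd k \<Longrightarrow> [k * x = k * y] (mod p) \<longleftrightarrow> [x = y] (mod p)"
  by (simp add: not_dvd_iff_coprime cong_mult_lcancel)

lemma not_dvd_mult: "\<not> p dvd x \<Longrightarrow> \<not> p dvd y \<Longrightarrow> \<not> p dvd x * y"
  using prime_p by (simp add: prime_dvd_mult_iff)

lemma fermat: "\<not> p dvd x \<Longrightarrow> [x ^ (nat p - 1) = 1] (mod p)"
proof -
  assume x: "\<not> p dvd x"
  define y where "y = nat (x mod p)"
  have y: "int y = x mod p" using p_gt_1 by (simp add: y_def)
  have pn: "int (nat p) = p" using p_gt_1 by simp
  have "\<not> nat p dvd y"
  proof
    assume "nat p dvd y"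
    then have "int (nat p) dvd int y" by (simp only: int_dvd_int_iff)
    then have "p dvd x mod p" unfolding pn y .
    with x show False by (simp add: dvd_mod_iff)
  qed
  moreover have "prime (nat p)" using prime_p using prime_int_nat_transfer[of p] by blast
  ultimately have "[y ^ (nat p - 1) = 1] (mod nat p)" by (intro fermat_theorem)
  then have "[int (y ^ (nat p - 1)) = int 1] (mod int (nat p))" by (simp only: cong_int_iff)
  then have "[(x mod p) ^ (nat p - 1) = 1] (mod p)" unfolding pn by (simp add: y)
  then show ?thesis by (simp add: cong_def power_mod)
qed

text \<open>Bezout's identity a x - b y = 1 dictates z = g^x g'^(-y). The negative exponent is
  written as (N - 1) y, because N-th powers of units are 1.\<close>

lemma common_root_mod:
  assumes ab: "coprime a b" "a > 0" and u: "\<not> p dvd g" "\<not> p dvd g'" and eq: "[g ^ b = g' ^ a] (mod p)"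
  shows "\<exists>z. [z ^ a = g] (mod p) \<and> [z ^ b = g'] (mod p)"
proof -
  define N where "N = nat p - 1"
  have N: "N > 0" using p_gt_1 by (simp add: N_def)
  obtain x y where "a * x = b * y + gcd a b"
    using bezout_nat[of a b] ab by blast
  then have xy: "a * x = b * y + 1" using ab by (simp only: coprime_iff_gcd_eq_1)
  have x': "y + (N - 1) * y = N * y" using N by (cases N) simp_all
  define z where "z = g ^ x * g' ^ ((N - 1) * y)"
  have one: "[h ^ (N * k) = 1] (mod p)" if "\<not> p dvd h" for h k
    using cong_1_pow_mult[OF fermat[OF that]] by (simp add: N_def)
  have "[z ^ a = g] (mod p)"
  proof -
    have "z ^ a = g * (g ^ b) ^ y * (g' ^ a) ^ ((N - 1) * y)"
      using xy by (simp add: z_def power_mult_distrib mult.commute mult.left_commute flip: power_mult power_Suc power_add)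
    also have "[\<dots> = g * (g' ^ a) ^ y * (g' ^ a) ^ ((N - 1) * y)] (mod p)"
      by (intro cong_mult cong_pow eq cong_refl)
    also have "g * (g' ^ a) ^ y * (g' ^ a) ^ ((N - 1) * y) = g * g' ^ (N * (a * y))"
      unfolding mult.assoc power_add[symmetric] x' by (simp add: mult_ac flip: power_mult)
    also have "[g * g' ^ (N * (a * y)) = g * 1] (mod p)"
      by (intro cong_mult cong_refl one u)
    finally show ?thesis by simp
  qed
  moreover have "[z ^ b = g'] (mod p)"
  proof -
    have "z ^ b = (g ^ b) ^ x * g' ^ (b * ((N - 1) * y))"
      by (simp add: z_def power_mult_distrib mult.commute flip: power_mult)
    also have "[\<dots> = (g' ^ a) ^ x * g' ^ (b * ((N - 1) * y))] (mod p)"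
      by (intro cong_mult cong_pow eq cong_refl)
    also have "(g' ^ a) ^ x * g' ^ (b * ((N - 1) * y)) = g' ^ (b * y + 1 + b * ((N - 1) * y))"
      unfolding xy[symmetric] by (simp add: power_add power_mult)
    also have "b * y + 1 + b * ((N - 1) * y) = 1 + b * (y + (N - 1) * y)" by (simp add: algebra_simps)
    also have "\<dots> = 1 + N * (b * y)" unfolding x' by simp
    also have "g' ^ (1 + N * (b * y)) = g' * g' ^ (N * (b * y))" by simp
    also have "[g' * g' ^ (N * (b * y)) = g' * 1] (mod p)"
      by (intro cong_mult cong_refl one u)
    finally show ?thesis by simp
  qed
  ultimately show ?thesis by blast
qed

text \<open>The pair (h^f, h'^f) has order s, and for coprime a and b the element z has the same
  order as the pair (z^a, z^b).\<close>

lemma common_root_order: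
  assumes ab: "coprime a b" and z: "[z ^ a = h ^ f] (mod p)" "[z ^ b = h' ^ f] (mod p)" "\<not> p dvd z"
    and t: "\<And>m. [h ^ m = 1] (mod p) \<and> [h' ^ m = 1] (mod p) \<longleftrightarrow> f * s dvd m" and f: "f > 0"
  shows "[z ^ m = 1] (mod p) \<longleftrightarrow> s dvd m"
proof -
  have 1: "[h ^ (f * m) = 1] (mod p) \<longleftrightarrow> [z ^ (a * m) = 1] (mod p)"
    using cong_pow[OF z(1), of m] by (auto simp: cong_def power_mult)
  have 2: "[h' ^ (f * m) = 1] (mod p) \<longleftrightarrow> [z ^ (b * m) = 1] (mod p)"
    using cong_pow[OF z(2), of m] by (auto simp: cong_def power_mult)
  have "[z ^ (a * m) = 1] (mod p) \<and> [z ^ (b * m) = 1] (mod p) \<longleftrightarrow> [z ^ m = 1] (mod p)"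
  proof
    assume *: "[z ^ (a * m) = 1] (mod p) \<and> [z ^ (b * m) = 1] (mod p)"
    define w where "w = z ^ m"
    have w: "[w ^ a = 1] (mod p)" "[w ^ b = 1] (mod p)"
      using * by (simp_all add: w_def mult.commute flip: power_mult)
    show "[z ^ m = 1] (mod p)"
    proof (cases "a = 0")
      case True
      then show ?thesis using ab w by (simp add: w_def)
    next
      case False
      then obtain x y where "a * x = b * y + gcd a b"
        using bezout_nat[of a b] by blast
      then have xy: "a * x = b * y + 1" using ab by (simp only: coprime_iff_gcd_eq_1)
      have 3: "[w ^ (a * x) = 1] (mod p)" and 4: "[w ^ (b * y) = 1] (mod p)"
        using cong_1_pow_mult w by blast+
      have "[w ^ (a * x) = w] (mod p)"
        unfolding xy using cong_mult[OF 4 cong_refl[of w p]] by (simp add: mult.commute)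
      from cong_trans[OF cong_sym[OF this] 3] show ?thesis by (simp add: w_def)
    qed
  next
    assume "[z ^ m = 1] (mod p)"
    from cong_1_pow_mult[OF this, of a] cong_1_pow_mult[OF this, of b]
    show "[z ^ (a * m) = 1] (mod p) \<and> [z ^ (b * m) = 1] (mod p)" by (simp add: mult.commute)
  qed
  moreover have "f * s dvd f * m \<longleftrightarrow> s dvd m" using f by simp
  ultimately show ?thesis using t[of "f * m"] 1 2 by blast
qed

lemma cong_powers_imp_eq:
  assumes "\<And>m. [z ^ m = 1] (mod p) \<longleftrightarrow> s dvd m" "\<not> p dvd z" "i < s" "j < s" "[z ^ i = z ^ j] (mod p)"
  shows "i = j"
proof -
  have *: "i = j" if "i \<le> j" "j < s" "[z ^ i = z ^ j] (mod p)" for i j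
  proof -
    have "z ^ j = z ^ i * z ^ (j - i)" using that(1) by (simp flip: power_add)
    then have "[z ^ i * z ^ (j - i) = z ^ i * 1] (mod p)" using that(3) by (simp add: cong_sym)
    then have "[z ^ (j - i) = 1] (mod p)"
      using cong_cancel[OF not_dvd_power[OF assms(2)]] by blast
    then have "s dvd j - i" using assms(1) by blast
    then show ?thesis using that(1,2) by (auto dest!: dvd_imp_le)
  qed
  show ?thesis
    using *[of i j] *[of j i] assms(3-) by (cases "i \<le> j") (auto simp: cong_sym)
qed


text \<open>Only x is recorded: when t is the order of (h1, h2), x determines y modulo t, so the
  cardinality is the number of representations of (s1, s2) as a difference of two group
  elements.\<close>

definition diff_set :: "int \<Rightarrow> int \<Rightarrow> int \<Rightarrow> int \<Rightarrow> nat \<Rightarrow> nat set" where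
  "diff_set h1 h2 s1 s2 t = {x. x < t \<and> (\<exists>y. [h1 ^ x - h1 ^ y = s1] (mod p) \<and> [h2 ^ x - h2 ^ y = s2] (mod p))}"

lemma finite_diff_set [simp]: "finite (diff_set h1 h2 s1 s2 t)"
  by (rule finite_subset[of _ "{..<t}"]) (auto simp: diff_set_def)

lemma card_diff_set_le_sum:
  assumes f: "f > 0"
  shows "card (diff_set h1 h2 s1 s2 t) \<le> (\<Sum>c<f. card {x \<in> diff_set h1 h2 s1 s2 t. x mod f = c})"
proof -
  have "diff_set h1 h2 s1 s2 t = (\<Union>c<f. {x \<in> diff_set h1 h2 s1 s2 t. x mod f = c})"
    using f by auto
  then have "card (diff_set h1 h2 s1 s2 t) = card (\<Union>c<f. {x \<in> diff_set h1 h2 s1 s2 t. x mod f = c})" by simp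
  also have "\<dots> \<le> (\<Sum>c<f. card {x \<in> diff_set h1 h2 s1 s2 t. x mod f = c})"
    by (rule card_UN_le) simp
  finally show ?thesis .
qed

lemma residue_image:
  assumes z: "\<And>m. [z ^ m = 1] (mod p) \<longleftrightarrow> s dvd m" "\<not> p dvd z" and f: "f > 0"
    and X: "X \<subseteq> {x. x < f * s \<and> x mod f = c}" and Z: "Z = (\<lambda>x. z ^ (x div f) mod p) ` X"
  shows "card Z = card X" "finite Z" "\<And>\<alpha> \<beta>. \<alpha> \<in> Z \<Longrightarrow> \<beta> \<in> Z \<Longrightarrow> p dvd \<alpha> - \<beta> \<Longrightarrow> \<alpha> = \<beta>"
    "\<And>w. w \<in> Z \<Longrightarrow> \<not> p dvd w" "\<And>w. w \<in> Z \<Longrightarrow> p dvd w ^ s - 1"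
proof -
  have "inj_on (\<lambda>x. z ^ (x div f) mod p) X"
  proof (rule inj_onI)
    fix x y assume xy: "x \<in> X" "y \<in> X" "z ^ (x div f) mod p = z ^ (y div f) mod p"
    have "x div f < s" "y div f < s" using xy X f by (auto simp: less_mult_imp_div_less mult.commute)
    then have "x div f = y div f"
      using cong_powers_imp_eq[OF z(1) z(2), where i="x div f" and j="y div f"] xy(3)
      by (simp add: cong_def)
    moreover have "x mod f = y mod f" using xy X by auto
    ultimately show "x = y" by (metis div_mult_mod_eq)
  qed
  then show "card Z = card X" unfolding Z by (rule card_image)
  have "finite X" by (rule finite_subset[OF X]) simp
  then show "finite Z" by (simp add: Z)
  show "\<alpha> = \<beta>" if "\<alpha> \<in> Z" "\<beta> \<in> Z" "p dvd \<alpha> - \<beta>" for \<alpha> \<beta>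
  proof -
    have "\<alpha> mod p = \<beta> mod p" using that(3) by (simp only: mod_eq_dvd_iff)
    then show ?thesis using that(1,2) by (auto simp: Z)
  qed
  show "\<not> p dvd w" if "w \<in> Z" for w
    using that not_dvd_power[OF z(2)] by (auto simp: Z dvd_mod_iff)
  show "p dvd w ^ s - 1" if "w \<in> Z" for w
  proof -
    obtain x where w: "w = z ^ (x div f) mod p" using \<open>w \<in> Z\<close> by (auto simp: Z)
    have "[w ^ s = (z ^ (x div f)) ^ s] (mod p)" unfolding w by (intro cong_pow) simp
    also have "(z ^ (x div f)) ^ s = z ^ (s * (x div f))" by (simp add: mult.commute flip: power_mult)
    also have "[z ^ (s * (x div f)) = 1] (mod p)" using z(1) by simp
    finally show ?thesis by (simp add: cong_iff_dvd_diff)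
  qed
qed

lemma root_power_cong:
  assumes "[z ^ a = g ^ f] (mod p)"
  shows "[(z ^ k mod p) ^ a = g ^ (f * k)] (mod p)"
proof -
  have "[(z ^ k mod p) ^ a = (z ^ k) ^ a] (mod p)" by (intro cong_pow) simp
  also have "(z ^ k) ^ a = (z ^ a) ^ k" by (simp add: mult.commute flip: power_mult)
  also have "[(z ^ a) ^ k = (g ^ f) ^ k] (mod p)" by (rule cong_pow[OF assms])
  finally show ?thesis by (simp add: power_mult)
qed

text \<open>Write x = c + f q with c = x mod f. Then g^x is g^c times the a-th power of z^q, so
  subtracting v from g^x amounts to subtracting \<sigma> = v / g^c from that power.\<close>

lemma coset_value_cong:
  assumes "[z ^ a = g ^ f] (mod p)" "[g ^ (x mod f) * \<sigma> = v] (mod p)" "[g ^ x - g ^ y = v] (mod p)"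
  shows "[g ^ (x mod f) * ((z ^ (x div f) mod p) ^ a - \<sigma>) = g ^ y] (mod p)"
proof -
  let ?c = "g ^ (x mod f)" and ?w = "(z ^ (x div f) mod p) ^ a"
  have "[?c * ?w - ?c * \<sigma> = ?c * g ^ (f * (x div f)) - v] (mod p)"
    by (intro cong_diff cong_mult cong_refl root_power_cong assms)
  also have "?c * g ^ (f * (x div f)) = g ^ x" by (simp flip: power_add)
  also have "[g ^ x - v = g ^ x - (g ^ x - g ^ y)] (mod p)"
    by (intro cong_diff cong_refl) (rule cong_sym[OF assms(3)])
  finally show ?thesis by (simp add: right_diff_distrib)
qed

context
  fixes h1 h2 s1 s2 :: int and a b f s A B M J :: nat
  assumes h: "\<not> p dvd h1" "\<not> p dvd h2" and s12: "\<not> p dvd s1" "\<not> p dvd s2"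
    and ab: "a > 0" "b > 0" "coprime a b" and pa: "\<not> p dvd int a" and f: "f > 0" and s: "s > 0"
    and t: "\<And>m. [h1 ^ m = 1] (mod p) \<and> [h2 ^ m = 1] (mod p) \<longleftrightarrow> f * s dvd m"
    and params: "a * A \<le> s" "int (s * B) \<le> int a * p" "A * B \<le> f * b" "int M \<le> p" "M > 0"
      "M * (a * A + M * (a + b)) < J * (max 1 (a - 1) * (A * B))"
begin

abbreviation "class_bound \<equiv> (s * (B - 1) + a * A + 2 * (f * a * b) * J) div M"

text \<open>The second group element has the coordinates c1 (z^a - \<sigma>) and c2 (z^b - \<tau>).
  The relation between h1 and h2 holds for this element and for (c1, c2) alike, so the constants
  cancel and the curve equation appears with \<omega> = 1.\<close>

lemma card_diff_class_pos:
  assumes rel: "[h1 ^ (f * b) = h2 ^ (f * a)] (mod p)"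
    and c: "c < f" "a \<ge> 2 \<or> \<not> [s1 * h2 ^ c = s2 * h1 ^ c] (mod p)" "b \<le> a"
  shows "card {x \<in> diff_set h1 h2 s1 s2 (f * s). x mod f = c} \<le> class_bound"
proof -
  let ?X = "{x \<in> diff_set h1 h2 s1 s2 (f * s). x mod f = c}"
  have hf: "\<not> p dvd h1 ^ f" "\<not> p dvd h2 ^ f" using h not_dvd_power by auto
  have "[(h1 ^ f) ^ b = (h2 ^ f) ^ a] (mod p)" using rel by (simp add: power_mult)
  from common_root_mod[OF ab(3,1) hf this] obtain z
    where z: "[z ^ a = h1 ^ f] (mod p)" "[z ^ b = h2 ^ f] (mod p)" by blast
  have pz: "\<not> p dvd z" using z(1) hf(1) ab(1) by (metis cong_not_dvd dvd_power dvd_trans)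
  have zo: "[z ^ m = 1] (mod p) \<longleftrightarrow> s dvd m" for m
    by (rule common_root_order[OF ab(3) z pz t f])
  let ?c1 = "h1 ^ c" and ?c2 = "h2 ^ c"
  have c12: "\<not> p dvd ?c1" "\<not> p dvd ?c2" using h not_dvd_power by auto
  obtain d1 d2 where d: "[?c1 * d1 = 1] (mod p)" "[?c2 * d2 = 1] (mod p)"
    using inverse_mod c12 by metis
  define \<sigma> \<tau> where "\<sigma> = d1 * s1" and "\<tau> = d2 * s2"
  have \<sigma>: "[?c1 * \<sigma> = s1] (mod p)" using cong_mult[OF d(1) cong_refl[of s1]] by (simp add: \<sigma>_def mult.assoc)
  have \<tau>: "[?c2 * \<tau> = s2] (mod p)" using cong_mult[OF d(2) cong_refl[of s2]] by (simp add: \<tau>_def mult.assoc)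
  have p\<sigma>: "\<not> p dvd \<sigma>" "\<not> p dvd \<tau>"
    using \<sigma> \<tau> s12 cong_not_dvd by (metis dvd_mult)+
  have val: "\<not> p dvd z' ^ a - \<sigma> \<and> \<not> p dvd z' ^ b - \<tau> \<and> p dvd (z' ^ a - \<sigma>) ^ (f * b) - 1 * (z' ^ b - \<tau>) ^ (f * a)"
    if x: "x \<in> ?X" and z': "z' = z ^ (x div f) mod p" for x z'
  proof -
    obtain y where y: "[h1 ^ x - h1 ^ y = s1] (mod p)" "[h2 ^ x - h2 ^ y = s2] (mod p)"
      using x by (auto simp: diff_set_def)
    have xc: "x mod f = c" using x by simp
    have e1: "[?c1 * (z' ^ a - \<sigma>) = h1 ^ y] (mod p)"
      using coset_value_cong[OF z(1) _ y(1)] \<sigma> unfolding z' xc by blast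
    have e2: "[?c2 * (z' ^ b - \<tau>) = h2 ^ y] (mod p)"
      using coset_value_cong[OF z(2) _ y(2)] \<tau> unfolding z' xc by blast
    have n1: "\<not> p dvd z' ^ a - \<sigma>" using cong_not_dvd[OF e1] not_dvd_power[OF h(1)] dvd_mult by blast
    have n2: "\<not> p dvd z' ^ b - \<tau>" using cong_not_dvd[OF e2] not_dvd_power[OF h(2)] dvd_mult by blast
    have relp: "[(h1 ^ k) ^ (f * b) = (h2 ^ k) ^ (f * a)] (mod p)" for k
      using cong_pow[OF rel, of k] by (simp add: mult.commute flip: power_mult)
    have "[(?c1 * (z' ^ a - \<sigma>)) ^ (f * b) = (h1 ^ y) ^ (f * b)] (mod p)" by (rule cong_pow[OF e1])
    also have "[(h1 ^ y) ^ (f * b) = (h2 ^ y) ^ (f * a)] (mod p)" by (rule relp)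
    also have "[(h2 ^ y) ^ (f * a) = (?c2 * (z' ^ b - \<tau>)) ^ (f * a)] (mod p)"
      by (rule cong_pow[OF cong_sym[OF e2]])
    also have "(?c2 * (z' ^ b - \<tau>)) ^ (f * a) = ?c2 ^ (f * a) * (z' ^ b - \<tau>) ^ (f * a)"
      by (rule power_mult_distrib)
    also have "[?c2 ^ (f * a) * (z' ^ b - \<tau>) ^ (f * a) = ?c1 ^ (f * b) * (z' ^ b - \<tau>) ^ (f * a)] (mod p)"
      by (intro cong_mult cong_refl cong_sym[OF relp])
    finally have "[?c1 ^ (f * b) * (z' ^ a - \<sigma>) ^ (f * b) = ?c1 ^ (f * b) * (z' ^ b - \<tau>) ^ (f * a)] (mod p)"
      by (simp only: power_mult_distrib)
    then have "[(z' ^ a - \<sigma>) ^ (f * b) = (z' ^ b - \<tau>) ^ (f * a)] (mod p)"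
      using cong_cancel[OF not_dvd_power[OF c12(1)]] by blast
    then show ?thesis using n1 n2 by (simp add: cong_iff_dvd_diff)
  qed
  define Z where "Z = (\<lambda>x. z ^ (x div f) mod p) ` ?X"
  have "?X \<subseteq> {x. x < f * s \<and> x mod f = c}" by (auto simp: diff_set_def)
  note Zp = residue_image[OF zo pz f this Z_def]
  have "card Z * M \<le> s * (B - 1) + a * A + 2 * (f * a * b) * J"
  proof (rule stepanov_pos[OF ab pa p\<sigma> _ f s params(1-4) params(6) Zp(2-5)])
    show "\<not> p dvd 1" using p_gt_1 by simp
    show "a \<ge> 2 \<or> \<not> p dvd \<sigma> ^ b - \<tau> ^ a"
    proof (cases "a \<ge> 2")
      case False
      then have ab1: "a = 1" "b = 1" using ab c(3) by auto
      have "\<not> [\<sigma> = \<tau>] (mod p)"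
      proof
        assume "[\<sigma> = \<tau>] (mod p)"
        then have "[?c2 * (?c1 * \<sigma>) = ?c1 * (?c2 * \<tau>)] (mod p)"
          by (metis cong_mult cong_refl mult.left_commute)
        moreover have "[?c2 * (?c1 * \<sigma>) = s1 * ?c2] (mod p)" using cong_mult[OF cong_refl \<sigma>] by (metis mult.commute)
        moreover have "[?c1 * (?c2 * \<tau>) = s2 * ?c1] (mod p)" using cong_mult[OF cong_refl \<tau>] by (metis mult.commute)
        ultimately have "[s1 * ?c2 = s2 * ?c1] (mod p)" by (meson cong_sym cong_trans)
        then show False using c(2) False by blast
      qed
      then show ?thesis using ab1 by (simp add: cong_iff_dvd_diff)
    qed simp
  qed (use val in \<open>auto simp: Z_def\<close>)
  then show ?thesis unfolding Zp(1) using params(5) by (simp add: less_eq_div_iff_mult_less_eq)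
qed

text \<open>With k2 the inverse of h2, the coset is parametrised by (z^a, z^(-b)). Multiplying c2
  z^(-b) - s2 by z^b gives -s2 (z^b - \<tau>) with \<tau> = c2 / s2; this produces the power of -s2
  in \<omega> and the monomial in the curve equation.\<close>

lemma card_diff_class_neg:
  assumes rel: "[h1 ^ (f * b) * h2 ^ (f * a) = 1] (mod p)" and c: "c < f"
  shows "card {x \<in> diff_set h1 h2 s1 s2 (f * s). x mod f = c} \<le> class_bound"
proof -
  let ?X = "{x \<in> diff_set h1 h2 s1 s2 (f * s). x mod f = c}"
  have hf: "\<not> p dvd h1 ^ f" "\<not> p dvd h2 ^ f" using h not_dvd_power by auto
  obtain k2 where k2: "[h2 * k2 = 1] (mod p)" using inverse_mod h(2) by blast
  have pk: "\<not> p dvd k2"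
  proof
    assume "p dvd k2"
    then have "p dvd h2 * k2" by simp
    then show False using cong_not_dvd[OF k2] p_gt_1 by simp
  qed
  have k2p: "[h2 ^ n * k2 ^ n = 1] (mod p)" for n
    using cong_pow[OF k2, of n] by (simp add: power_mult_distrib)
  have k2o: "[k2 ^ m = 1] (mod p) \<longleftrightarrow> [h2 ^ m = 1] (mod p)" for m
  proof
    assume "[k2 ^ m = 1] (mod p)"
    from cong_mult[OF cong_refl this, of "h2 ^ m"] k2p[of m] show "[h2 ^ m = 1] (mod p)"
      by (simp add: cong_def)
  next
    assume "[h2 ^ m = 1] (mod p)"
    from cong_mult[OF this cong_refl, of "k2 ^ m"] k2p[of m] show "[k2 ^ m = 1] (mod p)"
      by (simp add: cong_def)
  qed
  have "[h1 ^ (f * b) * h2 ^ (f * a) * k2 ^ (f * a) = k2 ^ (f * a)] (mod p)"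
    using cong_mult[OF rel cong_refl, of "k2 ^ (f * a)"] by simp
  moreover have "[h1 ^ (f * b) * h2 ^ (f * a) * k2 ^ (f * a) = h1 ^ (f * b)] (mod p)"
    using cong_mult[OF cong_refl k2p, of "h1 ^ (f * b)" "f * a"] by (simp add: mult.assoc)
  ultimately have "[h1 ^ (f * b) = k2 ^ (f * a)] (mod p)" by (simp add: cong_def)
  then have "[(h1 ^ f) ^ b = (k2 ^ f) ^ a] (mod p)" by (simp add: power_mult)
  from common_root_mod[OF ab(3,1) hf(1) not_dvd_power[OF pk] this] obtain z
    where z: "[z ^ a = h1 ^ f] (mod p)" "[z ^ b = k2 ^ f] (mod p)" by blast
  have pz: "\<not> p dvd z" using z(1) hf(1) ab(1) by (metis cong_not_dvd dvd_power dvd_trans)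
  have zo: "[z ^ m = 1] (mod p) \<longleftrightarrow> s dvd m" for m
    by (rule common_root_order[OF ab(3) z pz _ f]) (use t k2o in blast)
  let ?c1 = "h1 ^ c" and ?c2 = "h2 ^ c"
  have c12: "\<not> p dvd ?c1" "\<not> p dvd ?c2" using h not_dvd_power by auto
  obtain d1 d2 where d: "[?c1 * d1 = 1] (mod p)" "[s2 * d2 = 1] (mod p)"
    using inverse_mod c12 s12 by metis
  define \<sigma> \<tau> where "\<sigma> = d1 * s1" and "\<tau> = d2 * ?c2"
  have \<sigma>: "[?c1 * \<sigma> = s1] (mod p)" using cong_mult[OF d(1) cong_refl[of s1]] by (simp add: \<sigma>_def mult.assoc)
  have \<tau>: "[s2 * \<tau> = ?c2] (mod p)" using cong_mult[OF d(2) cong_refl[of ?c2]] by (simp add: \<tau>_def mult.assoc)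
  have p\<sigma>: "\<not> p dvd \<sigma>"
    using \<sigma> s12 cong_not_dvd by (metis dvd_mult)
  define \<omega> where "\<omega> = ?c1 ^ (f * b) * (- s2) ^ (f * a)"
  have p\<omega>: "\<not> p dvd \<omega>"
    unfolding \<omega>_def by (intro not_dvd_mult not_dvd_power) (use c12 s12 h in \<open>auto dest: not_dvd_power\<close>)
  have val: "\<not> p dvd z' ^ a - \<sigma> \<and> \<not> p dvd z' ^ b - \<tau> \<and>
      p dvd \<omega> * (z' ^ a - \<sigma>) ^ (f * b) * (z' ^ b - \<tau>) ^ (f * a) - z' ^ (f * a * b)"
    if x: "x \<in> ?X" and z': "z' = z ^ (x div f) mod p" for x z'
  proof -
    let ?q = "x div f"
    obtain y where y: "[h1 ^ x - h1 ^ y = s1] (mod p)" "[h2 ^ x - h2 ^ y = s2] (mod p)"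
      using x by (auto simp: diff_set_def)
    have xc: "x = c + f * ?q" "x mod f = c" using x mod_mult_div_eq[of x f] by simp_all
    have pz': "\<not> p dvd z'" using not_dvd_power[OF pz] by (simp add: z' dvd_mod_iff)
    have z2: "[z' ^ b = k2 ^ (f * ?q)] (mod p)" unfolding z' by (rule root_power_cong[OF z(2)])
    have e1: "[?c1 * (z' ^ a - \<sigma>) = h1 ^ y] (mod p)"
      using coset_value_cong[OF z(1) _ y(1)] \<sigma> unfolding z' xc(2) by blast
    have e2: "[(- s2) * (z' ^ b - \<tau>) = h2 ^ y * z' ^ b] (mod p)"
    proof -
      have "[h2 ^ x * z' ^ b = h2 ^ x * k2 ^ (f * ?q)] (mod p)" by (intro cong_mult cong_refl z2)
      also have "h2 ^ x * k2 ^ (f * ?q) = ?c2 * (h2 ^ (f * ?q) * k2 ^ (f * ?q))"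
        by (subst xc(1)) (simp add: power_add mult.assoc)
      also have "[?c2 * (h2 ^ (f * ?q) * k2 ^ (f * ?q)) = ?c2 * 1] (mod p)"
        by (intro cong_mult cong_refl k2p)
      finally have hx: "[h2 ^ x * z' ^ b = ?c2] (mod p)" by simp
      have "(- s2) * (z' ^ b - \<tau>) = s2 * \<tau> - s2 * z' ^ b" by (simp add: algebra_simps)
      also have "[s2 * \<tau> - s2 * z' ^ b = h2 ^ x * z' ^ b - (h2 ^ x - h2 ^ y) * z' ^ b] (mod p)"
        by (intro cong_diff cong_mult cong_refl cong_sym[OF y(2)] cong_trans[OF \<tau> cong_sym[OF hx]])
      also have "h2 ^ x * z' ^ b - (h2 ^ x - h2 ^ y) * z' ^ b = h2 ^ y * z' ^ b" by (simp add: algebra_simps)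
      finally show ?thesis .
    qed
    have n1: "\<not> p dvd z' ^ a - \<sigma>" using cong_not_dvd[OF e1] not_dvd_power[OF h(1)] dvd_mult by blast
    have n2: "\<not> p dvd z' ^ b - \<tau>"
      using cong_not_dvd[OF e2] not_dvd_mult[OF not_dvd_power[OF h(2)] not_dvd_power[OF pz']] dvd_mult by blast
    have relp: "[(h1 ^ y) ^ (f * b) * (h2 ^ y) ^ (f * a) = 1] (mod p)"
      using cong_pow[OF rel, of y] by (simp add: power_mult_distrib mult.commute flip: power_mult)
    have "\<omega> * (z' ^ a - \<sigma>) ^ (f * b) * (z' ^ b - \<tau>) ^ (f * a)
        = (?c1 * (z' ^ a - \<sigma>)) ^ (f * b) * ((- s2) * (z' ^ b - \<tau>)) ^ (f * a)"
      unfolding \<omega>_def power_mult_distrib by (simp only: mult_ac)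
    also have "[\<dots> = (h1 ^ y) ^ (f * b) * (h2 ^ y * z' ^ b) ^ (f * a)] (mod p)"
      by (intro cong_mult cong_pow e1 e2)
    also have "(h1 ^ y) ^ (f * b) * (h2 ^ y * z' ^ b) ^ (f * a)
        = ((h1 ^ y) ^ (f * b) * (h2 ^ y) ^ (f * a)) * z' ^ (f * a * b)"
      by (simp add: power_mult_distrib mult_ac flip: power_mult)
    also have "[((h1 ^ y) ^ (f * b) * (h2 ^ y) ^ (f * a)) * z' ^ (f * a * b) = 1 * z' ^ (f * a * b)] (mod p)"
      by (intro cong_mult cong_refl relp)
    finally show ?thesis using n1 n2 by (simp add: cong_iff_dvd_diff)
  qed
  define Z where "Z = (\<lambda>x. z ^ (x div f) mod p) ` ?X"
  have "?X \<subseteq> {x. x < f * s \<and> x mod f = c}" by (auto simp: diff_set_def)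
  note Zp = residue_image[OF zo pz f this Z_def]
  have "card Z * M \<le> s * (B - 1) + a * A + 2 * (f * a * b) * J"
  proof (rule stepanov_neg[OF ab(1,2) pa p\<sigma> p\<omega> f s params(1-4) params(6) Zp(2-5)])
    show "\<not> p dvd w ^ a - \<sigma>" "\<not> p dvd w ^ b - \<tau>"
      "p dvd \<omega> * (w ^ a - \<sigma>) ^ (f * b) * (w ^ b - \<tau>) ^ (f * a) - w ^ (f * a * b)" if "w \<in> Z" for w
      using that val by (auto simp: Z_def)
  qed
  then show ?thesis unfolding Zp(1) using params(5) by (simp add: less_eq_div_iff_mult_less_eq)
qed

text \<open>For a = b = 1 a class c is degenerate if (s1, s2) is proportional to (h1^c, h2^c). Two
  degenerate classes c and c' would give \<omega>^(c' - c) = 1, so there is at most one, and it is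
  estimated by its full size \<open>s\<close>.\<close>

lemma card_diff_set_pos:
  assumes \<omega>: "[\<omega> * h2 ^ a = h1 ^ b] (mod p)" "\<And>m. [\<omega> ^ m = 1] (mod p) \<longleftrightarrow> f dvd m" and "b \<le> a"
  shows "card (diff_set h1 h2 s1 s2 (f * s)) \<le> f * class_bound + (if a = 1 then s else 0)"
proof -
  let ?X = "diff_set h1 h2 s1 s2 (f * s)"
  have \<omega>p: "[\<omega> ^ m * h2 ^ (m * a) = h1 ^ (m * b)] (mod p)" for m
    using cong_pow[OF \<omega>(1), of m] by (simp add: power_mult_distrib mult.commute flip: power_mult)
  have "[\<omega> ^ f = 1] (mod p)" using \<omega>(2) by simp
  from cong_mult[OF this cong_refl, of "h2 ^ (f * a)"] \<omega>p[of f]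
  have rel: "[h1 ^ (f * b) = h2 ^ (f * a)] (mod p)" by (simp add: cong_def)
  define bad where "bad = {c. c < f \<and> a = 1 \<and> [s1 * h2 ^ c = s2 * h1 ^ c] (mod p)}"
  have good: "card {x \<in> ?X. x mod f = c} \<le> class_bound" if "c < f" "c \<notin> bad" for c
    using card_diff_class_pos[OF rel that(1) _ assms(3)] that ab(1) by (auto simp: bad_def)
  have fin: "finite bad" by (rule finite_subset[of _ "{..<f}"]) (auto simp: bad_def)
  have bads: "card {x \<in> ?X. x mod f = c} \<le> s" for c
  proof -
    have "{x \<in> ?X. x mod f = c} \<subseteq> (\<lambda>y. f * y + c) ` {..<s}"
    proof
      fix x assume "x \<in> {x \<in> ?X. x mod f = c}"
      then have "x < f * s" "x mod f = c" by (auto simp: diff_set_def)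
      then have "x div f < s" "x = f * (x div f) + c" by (auto simp: less_mult_imp_div_less mult.commute)
      then show "x \<in> (\<lambda>y. f * y + c) ` {..<s}" by blast
    qed
    then have "card {x \<in> ?X. x mod f = c} \<le> card ((\<lambda>y. f * y + c) ` {..<s})"
      by (intro card_mono) auto
    also have "\<dots> \<le> s" using card_image_le[of "{..<s}" "\<lambda>y. f * y + c"] by simp
    finally show ?thesis .
  qed
  have uniq: "card bad \<le> (if a = 1 then 1 else 0)"
  proof -
    have imp: "c = c'" if "c \<in> bad" "c' \<in> bad" "c \<le> c'" for c c'
    proof -
      have a1: "a = 1" "b = 1" using that ab(2) assms(3) by (auto simp: bad_def)
      have e: "[s1 * h2 ^ c = s2 * h1 ^ c] (mod p)" "[s1 * h2 ^ c' = s2 * h1 ^ c'] (mod p)"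
        using that by (auto simp: bad_def)
      define k where "k = c' - c"
      have c': "c' = c + k" using that(3) by (simp add: k_def)
      have "[(s1 * h2 ^ c) * h2 ^ k = (s2 * h1 ^ c) * h1 ^ k] (mod p)" using e(2) by (simp add: c' power_add mult.assoc)
      moreover have "[(s1 * h2 ^ c) * h2 ^ k = (s2 * h1 ^ c) * h2 ^ k] (mod p)" by (intro cong_mult e(1) cong_refl)
      ultimately have "[(s2 * h1 ^ c) * h2 ^ k = (s2 * h1 ^ c) * h1 ^ k] (mod p)" by (simp add: cong_def)
      then have "[h2 ^ k = h1 ^ k] (mod p)"
        using cong_cancel not_dvd_mult[OF s12(2) not_dvd_power[OF h(1)]] by blast
      then have "[h2 ^ k * \<omega> ^ k = h2 ^ k * 1] (mod p)" using \<omega>p[of k] a1 by (simp add: cong_def mult.commute)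
      then have "[\<omega> ^ k = 1] (mod p)" using cong_cancel not_dvd_power[OF h(2)] by blast
      then have "f dvd k" using \<omega>(2) by blast
      moreover have "k < f" using that by (auto simp: k_def bad_def)
      ultimately show ?thesis using c' by (auto dest: dvd_imp_le)
    qed
    have "c = c'" if "c \<in> bad" "c' \<in> bad" for c c'
      using imp[of c c'] imp[of c' c] that by (cases "c \<le> c'") auto
    then have "card bad \<le> 1" using fin by (auto simp: card_le_Suc0_iff_eq)
    then show ?thesis by (cases "a = 1") (auto simp: bad_def)
  qed
  have "card ?X \<le> (\<Sum>c<f. card {x \<in> ?X. x mod f = c})" by (rule card_diff_set_le_sum[OF f])
  also have "\<dots> \<le> (\<Sum>c<f. class_bound + (if c \<in> bad then s else 0))"
  proof (rule sum_mono)
    fix c assume "c \<in> {..<f}"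
    then show "card {x \<in> ?X. x mod f = c} \<le> class_bound + (if c \<in> bad then s else 0)"
      using good[of c] bads[of c] by (cases "c \<in> bad") auto
  qed
  also have "\<dots> = f * class_bound + (\<Sum>c\<in>{..<f} \<inter> bad. s)"
    by (simp add: sum.distrib flip: sum.inter_restrict)
  also have "{..<f} \<inter> bad = bad" by (auto simp: bad_def)
  also have "(\<Sum>c\<in>bad. s) = card bad * s" by simp
  also have "\<dots> \<le> (if a = 1 then s else 0)" using uniq by (cases "a = 1") auto
  finally show ?thesis by simp
qed

lemma card_diff_set_neg:
  assumes "[h1 ^ (f * b) * h2 ^ (f * a) = 1] (mod p)"
  shows "card (diff_set h1 h2 s1 s2 (f * s)) \<le> f * class_bound"
proof -
  have "card (diff_set h1 h2 s1 s2 (f * s)) \<le> (\<Sum>c<f. card {x \<in> diff_set h1 h2 s1 s2 (f * s). x mod f = c})"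
    by (rule card_diff_set_le_sum[OF f])
  also have "\<dots> \<le> (\<Sum>c<f. class_bound)"
    by (rule sum_mono) (use card_diff_class_neg[OF assms] in auto)
  finally show ?thesis by simp
qed

end

end

text \<open>Stepanov's parameters are M = B1 B, A = 2 M and J = 8 B, with B1 blocks of exponents.
  There are at most 4 a M^2 conditions on 16 max(1, a - 1) M^2 unknowns, and a \<le> 2 max(1, a -
  1).\<close>

lemma params_large:
  fixes a b f s B B1 :: nat
  assumes "0 < b" "b \<le> a" "0 < f" "0 < B" "0 < B1" "2 * B1\<^sup>2 * B \<le> f * b" "f * a * b \<le> s"
  shows "a * (2 * (B1 * B)) \<le> s" "s * B1 \<le> a * (f * s)" "2 * (B1 * B) * B1 \<le> f * b" "B1 * B \<le> f * s"
    "B1 * B * (a * (2 * (B1 * B)) + B1 * B * (a + b)) < 8 * B * (max 1 (a - 1) * (2 * (B1 * B) * B1))"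
proof -
  show 3: "2 * (B1 * B) * B1 \<le> f * b" using assms(6) by (simp add: power2_eq_square mult_ac)
  have 4: "2 * (B1 * B) \<le> f * b"
    using 3 assms(5) mult_le_mono2[of 1 B1 "2 * (B1 * B)"] by linarith
  have "a * (2 * (B1 * B)) \<le> a * (f * b)" using 4 by (rule mult_le_mono2)
  also have "\<dots> \<le> s" using assms(7) by (simp add: mult_ac)
  finally show "a * (2 * (B1 * B)) \<le> s" .
  have "B1 \<le> 2 * (B1 * B) * B1" using assms by (simp add: mult_ac)
  then have "B1 \<le> f * b" using 3 by linarith
  also have "f * b \<le> f * a" using assms by simp
  finally show "s * B1 \<le> a * (f * s)" by (simp add: mult_ac)
  have "f * b \<le> f * s"
  proof -
    have "b \<le> f * a * b" using assms by simp
    then have "b \<le> s" using assms(7) by linarith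
    then show ?thesis by simp
  qed
  then show "B1 * B \<le> f * s" using 4 by linarith
  define m where "m = B1 * B"
  have m: "m > 0" using assms by (simp add: m_def)
  have "m * (a * (2 * m) + m * (a + b)) \<le> 4 * a * (m * m)"
    using assms(2) by (simp add: algebra_simps)
  also have "\<dots> < 8 * a * (m * m)" using m assms by simp
  also have "\<dots> \<le> 16 * max 1 (a - 1) * (m * m)"
    by (intro mult_right_mono) (use assms in \<open>auto simp: max_def\<close>)
  also have "\<dots> = 8 * B * (max 1 (a - 1) * (2 * m * B1))" by (simp add: m_def)
  finally show "B1 * B * (a * (2 * (B1 * B)) + B1 * B * (a + b)) < 8 * B * (max 1 (a - 1) * (2 * (B1 * B) * B1))"
    by (simp only: m_def)
qed

text \<open>Division by M = B1 B turns the degree terms into s/B, 2 a and 16 f a b / B1. As f b and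
  B1^2 B agree up to constant factors, f b / B1 is O(B1 B), and (B1 B)^2 \<le> s0 B.\<close>

lemma large_bound_arith:
  fixes a b f s B B1 s0 :: nat
  assumes "0 < B" "0 < B1" "2 * B1\<^sup>2 * B \<le> f * b" "f * b < 2 * (B1 + 1)\<^sup>2 * B" "f * a \<le> s0" "f * b \<le> s0"
  shows "real (f * ((s * (B1 - 1) + a * (2 * (B1 * B)) + 2 * (f * a * b) * (8 * B)) div (B1 * B)))
    \<le> real (f * s) / real B + 2 * real s0 + 128 * real s0 * sqrt (real s0 * real B)"
proof -
  have "real ((s * (B1 - 1) + a * (2 * (B1 * B)) + 2 * (f * a * b) * (8 * B)) div (B1 * B))
      \<le> real (s * (B1 - 1) + a * (2 * (B1 * B)) + 2 * (f * a * b) * (8 * B)) / real (B1 * B)"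
    by (rule of_nat_div_le_of_nat)
  also have "\<dots> \<le> (real s * real B1 + real a * (2 * (real B1 * real B)) + 2 * real (f * a * b) * (8 * real B)) / (real B1 * real B)"
  proof -
    have "real (s * (B1 - 1)) \<le> real s * real B1" by (simp add: mult_left_mono)
    then have "real (s * (B1 - 1) + a * (2 * (B1 * B)) + 2 * (f * a * b) * (8 * B))
        \<le> real s * real B1 + real a * (2 * (real B1 * real B)) + 2 * real (f * a * b) * (8 * real B)" by simp
    from divide_right_mono[OF this, of "real (B1 * B)"] show ?thesis by simp
  qed
  also have "\<dots> = real s / real B + 2 * real a + 16 * real (f * a * b) / real B1"
    using assms(1,2) by (simp add: field_simps)
  finally have 1: "real ((s * (B1 - 1) + a * (2 * (B1 * B)) + 2 * (f * a * b) * (8 * B)) div (B1 * B))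
      \<le> real s / real B + 2 * real a + 16 * real (f * a * b) / real B1" .
  have "real f * real ((s * (B1 - 1) + a * (2 * (B1 * B)) + 2 * (f * a * b) * (8 * B)) div (B1 * B))
      \<le> real f * (real s / real B + 2 * real a + 16 * real (f * a * b) / real B1)"
    using 1 by (rule mult_left_mono) simp
  also have "\<dots> = real (f * s) / real B + 2 * real (f * a) + 16 * real (f * a) * (real (f * b) / real B1)"
    by (simp add: field_simps)
  also have "\<dots> \<le> real (f * s) / real B + 2 * real s0 + 16 * real s0 * (8 * sqrt (real s0 * real B))"
  proof -
    have "real (f * b) / real B1 \<le> 8 * sqrt (real s0 * real B)"
    proof -
      have "f * b \<le> 8 * (B1\<^sup>2 * B)"
      proof -
        have "(B1 + 1)\<^sup>2 \<le> (2 * B1)\<^sup>2" using assms(2) by (intro power_mono) auto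
        then have "2 * (B1 + 1)\<^sup>2 * B \<le> 2 * (2 * B1)\<^sup>2 * B" by (intro mult_le_mono1 mult_le_mono2)
        also have "\<dots> = 8 * (B1\<^sup>2 * B)" by (simp add: power_mult_distrib)
        finally show ?thesis using assms(4) by linarith
      qed
      then have "real (f * b) \<le> real (8 * (B1\<^sup>2 * B))" by (simp only: of_nat_le_iff)
      then have "real (f * b) \<le> 8 * (real B1)\<^sup>2 * real B" by simp
      then have "real (f * b) / real B1 \<le> 8 * (real B1 * real B)"
        using assms(2) by (simp add: field_simps power2_eq_square)
      also have "real B1 * real B \<le> sqrt (real s0 * real B)"
      proof (rule real_le_rsqrt)
        have "B1\<^sup>2 * B \<le> s0" using assms(3,6) by linarith
        then have "real (B1\<^sup>2 * B) * real B \<le> real s0 * real B"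
          by (intro mult_right_mono) (simp_all only: of_nat_le_iff of_nat_0_le_iff)
        then show "(real B1 * real B)\<^sup>2 \<le> real s0 * real B" by (simp add: power2_eq_square mult_ac)
      qed
      finally show ?thesis by simp
    qed
    then show ?thesis using assms(5)
      by (intro add_mono mult_mono order_refl) (simp_all only: of_nat_le_iff, auto)
  qed
  finally show ?thesis by simp
qed

section \<open>Representations of a difference in the whole group\<close>

context prime_modulus
begin

lemma card_power_cong_le: "t > 0 \<Longrightarrow> card {y \<in> {0..<p}. [y ^ t = c] (mod p)} \<le> t"
proof -
  assume t: "t > 0"
  have "card {y \<in> {0..<p}. p dvd poly (binom t c) y} \<le> degree (binom t c)"
    by (rule card_roots_le_degree) (rule binom_not_mzero[OF t])
  then show ?thesis by (simp add: degree_binom[OF t] poly_monom cong_iff_dvd_diff)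
qed

lemma exists_order:
  assumes "\<not> p dvd w"
  shows "\<exists>f>0. \<forall>m. [w ^ m = 1] (mod p) \<longleftrightarrow> f dvd m"
proof -
  define y where "y = nat (w mod p)"
  have pn: "int (nat p) = p" using p_gt_1 by simp
  have y: "int y = w mod p" using p_gt_1 by (simp add: y_def)
  have "[w ^ m = 1] (mod p) \<longleftrightarrow> [y ^ m = 1] (mod nat p)" for m
  proof -
    have "[y ^ m = 1] (mod nat p) \<longleftrightarrow> [int (y ^ m) = int 1] (mod int (nat p))" by (simp only: cong_int_iff)
    also have "\<dots> \<longleftrightarrow> [(w mod p) ^ m = 1] (mod p)" unfolding pn by (simp add: y)
    also have "\<dots> \<longleftrightarrow> [w ^ m = 1] (mod p)" by (simp add: cong_def power_mod)
    finally show ?thesis by simp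
  qed
  then have *: "[w ^ m = 1] (mod p) \<longleftrightarrow> ord (nat p) y dvd m" for m
    using ord_divides[of y m "nat p"] by blast
  have "ord (nat p) y dvd nat p - 1" using fermat[OF assms] * by blast
  then have "ord (nat p) y > 0" using p_gt_1 by (intro Nat.gr0I) auto
  with * show ?thesis by blast
qed

text \<open>All (s0 + 1)^2 products h1^i h2^j are t-th roots of unity, of which there are at most t.
  In a coincidence the order conditions make both exponents differ, and the signs of the two
  differences decide between the alternatives.\<close>

lemma dirichlet_relation:
  assumes h: "\<not> p dvd h1" "\<not> p dvd h2" and t: "[h1 ^ t = 1] (mod p)" "[h2 ^ t = 1] (mod p)" "t > 0"
    and s0: "t < (s0 + 1)\<^sup>2"
    and ord: "\<And>m. 0 < m \<Longrightarrow> m \<le> s0 \<Longrightarrow> \<not> [h1 ^ m = 1] (mod p)" "\<And>m. 0 < m \<Longrightarrow> m \<le> s0 \<Longrightarrow> \<not> [h2 ^ m = 1] (mod p)"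
  shows "\<exists>k l. 0 < k \<and> k \<le> s0 \<and> 0 < l \<and> l \<le> s0 \<and> ([h1 ^ l = h2 ^ k] (mod p) \<or> [h1 ^ l * h2 ^ k = 1] (mod p))"
proof -
  define g where "g = (\<lambda>(i, j). (h1 ^ i * h2 ^ j) mod p)"
  let ?D = "{..s0} \<times> {..s0}" and ?R = "{y \<in> {0..<p}. [y ^ t = 1] (mod p)}"
  have "g ` ?D \<subseteq> ?R"
  proof
    fix y assume "y \<in> g ` ?D"
    then obtain i j where y: "y = (h1 ^ i * h2 ^ j) mod p" by (auto simp: g_def)
    have "[(h1 ^ i * h2 ^ j mod p) ^ t = (h1 ^ i * h2 ^ j) ^ t] (mod p)" by (intro cong_pow) simp
    also have "(h1 ^ i * h2 ^ j) ^ t = (h1 ^ t) ^ i * (h2 ^ t) ^ j"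
      by (simp add: power_mult_distrib mult.commute flip: power_mult)
    also have "[(h1 ^ t) ^ i * (h2 ^ t) ^ j = 1 ^ i * 1 ^ j] (mod p)" by (intro cong_mult cong_pow t)
    finally show "y \<in> ?R" using p_gt_1 by (simp add: y)
  qed
  moreover have "finite ?R" by (rule finite_subset[of _ "{0..<p}"]) auto
  moreover have "card ?R < card ?D"
    using card_power_cong_le[OF t(3), of 1] s0 by (simp add: card_cartesian_product power2_eq_square)
  ultimately have "\<not> inj_on g ?D" by (meson card_inj_on_le leD)
  then obtain i j i' j' where ij: "i \<le> s0" "j \<le> s0" "i' \<le> s0" "j' \<le> s0" "(i, j) \<noteq> (i', j')"
    "[h1 ^ i * h2 ^ j = h1 ^ i' * h2 ^ j'] (mod p)"
    by (auto simp: inj_on_def g_def cong_def)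
  have canc: "[x ^ (n - m) = 1] (mod p)" if "m \<le> n" "[x ^ m = x ^ n] (mod p)" "\<not> p dvd x" for x m n
  proof -
    have "x ^ n = x ^ m * x ^ (n - m)" using that(1) by (simp flip: power_add)
    then have "[x ^ m * x ^ (n - m) = x ^ m * 1] (mod p)" using that(2) by (simp add: cong_sym)
    then show ?thesis using cong_cancel[OF not_dvd_power[OF that(3)]] by blast
  qed
  have main: ?thesis if ij: "i \<le> s0" "j \<le> s0" "i' \<le> s0" "j' \<le> s0" "(i, j) \<noteq> (i', j')"
    "[h1 ^ i * h2 ^ j = h1 ^ i' * h2 ^ j'] (mod p)" "i \<le> i'" for i j i' j'
  proof -
    have e: "h1 ^ i' = h1 ^ i * h1 ^ (i' - i)" using ij(7) by (simp flip: power_add)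
    have "[h1 ^ i * h2 ^ j = h1 ^ i * (h1 ^ (i' - i) * h2 ^ j')] (mod p)"
      using ij(6) unfolding e by (simp only: mult.assoc)
    then have E: "[h2 ^ j = h1 ^ (i' - i) * h2 ^ j'] (mod p)"
      using cong_cancel[OF not_dvd_power[OF h(1)]] by blast
    have ne1: "i \<noteq> i'"
    proof
      assume "i = i'"
      then have "j \<noteq> j'" "[h2 ^ j = h2 ^ j'] (mod p)" using ij(5) E by auto
      then show False
        using canc[of j j' h2] canc[of j' j h2] ord(2)[of "j' - j"] ord(2)[of "j - j'"] ij(2,4) h(2)
        by (cases "j \<le> j'") (auto simp: cong_sym)
    qed
    show ?thesis
    proof (cases "j \<le> j'")
      case True
      have e2: "h2 ^ j' = h2 ^ j * h2 ^ (j' - j)" using True by (simp flip: power_add)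
      have "[h2 ^ j * (h1 ^ (i' - i) * h2 ^ (j' - j)) = h2 ^ j * 1] (mod p)"
        using E unfolding e2 by (simp add: cong_sym mult_ac)
      then have R: "[h1 ^ (i' - i) * h2 ^ (j' - j) = 1] (mod p)"
        using cong_cancel[OF not_dvd_power[OF h(2)]] by blast
      moreover have "j \<noteq> j'"
      proof
        assume "j = j'"
        then have "[h1 ^ (i' - i) = 1] (mod p)" using R by simp
        then show False using ord(1)[of "i' - i"] ne1 ij by auto
      qed
      ultimately show ?thesis using ij ne1 True by (intro exI[of _ "j' - j"] exI[of _ "i' - i"]) auto
    next
      case False
      have e2: "h2 ^ j = h2 ^ j' * h2 ^ (j - j')" using False by (simp flip: power_add)
      have "[h2 ^ j' * h1 ^ (i' - i) = h2 ^ j' * h2 ^ (j - j')] (mod p)"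
        using E unfolding e2 by (simp add: cong_sym mult_ac)
      then have R: "[h1 ^ (i' - i) = h2 ^ (j - j')] (mod p)"
        using cong_cancel[OF not_dvd_power[OF h(2)]] by blast
      then show ?thesis using ij ne1 False by (intro exI[of _ "j - j'"] exI[of _ "i' - i"]) auto
    qed
  qed
  show ?thesis
  proof (cases "i \<le> i'")
    case True
    then show ?thesis using main[of i j i' j'] ij by blast
  next
    case False
    then show ?thesis using main[of i' j' i j] ij by (simp add: cong_sym_eq)
  qed
qed

text \<open>Dividing k and l by their gcd g leaves w = h1^b h2^(-a) or w = h1^b h2^a, a g-th root of
  unity. Its order f, a divisor of g that may be smaller, is the number of cosets, so f a and f b
  are still at most s0.\<close>

lemma card_diff_set_relation:
  fixes B F0 :: nat
  assumes h: "\<not> p dvd h1" "\<not> p dvd h2" and s12: "\<not> p dvd s1" "\<not> p dvd s2"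
    and t: "\<And>m. [h1 ^ m = 1] (mod p) \<and> [h2 ^ m = 1] (mod p) \<longleftrightarrow> t dvd m" "t > 0" "int t < p"
    and s0: "s0\<^sup>2 \<le> t" and B: "B > 0"
    and kl: "0 < l" "l \<le> k" "k \<le> s0" "[h1 ^ l = h2 ^ k] (mod p) \<or> [h1 ^ l * h2 ^ k = 1] (mod p)"
    and F0: "\<And>f. f dvd t \<Longrightarrow> [h1 ^ f = h2 ^ f] (mod p) \<Longrightarrow> F0 \<le> f" "F0 > 0"
  shows "real (card (diff_set h1 h2 s1 s2 t)) \<le> real t / real B + 2 * real s0
    + 128 * real s0 * sqrt (real s0 * real B) + 32 * real s0 * real B + real t / real F0"
proof -
  define g where "g = gcd k l"
  define a b where "a = k div g" and "b = l div g"
  have g: "g > 0" "k = g * a" "l = g * b" using kl by (simp_all add: g_def a_def b_def)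
  have ab: "a > 0" "b > 0" "coprime a b" "b \<le> a"
  proof -
    show "a > 0" "b > 0" using g kl by (auto intro: Nat.gr0I)
    show "coprime a b" unfolding a_def b_def g_def using kl by (intro div_gcd_coprime) auto
    show "b \<le> a" using g kl by simp
  qed
  obtain k2 where k2: "[h2 * k2 = 1] (mod p)" using inverse_mod h(2) by blast
  have k2p: "[h2 ^ n * k2 ^ n = 1] (mod p)" for n
    using cong_pow[OF k2, of n] by (simp add: power_mult_distrib)
  define pos where "pos = ([h1 ^ l = h2 ^ k] (mod p))"
  define w where "w = (if pos then h1 ^ b * k2 ^ a else h1 ^ b * h2 ^ a)"
  have pk2: "\<not> p dvd k2"
  proof
    assume "p dvd k2"
    then have "p dvd h2 * k2" by simp
    then show False using cong_not_dvd[OF k2] p_gt_1 by simp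
  qed
  have pw: "\<not> p dvd w" unfolding w_def
    using not_dvd_mult not_dvd_power h pk2 by (cases pos) simp_all
  obtain f where f: "f > 0" "\<And>m. [w ^ m = 1] (mod p) \<longleftrightarrow> f dvd m" using exists_order[OF pw] by blast
  have wpos: "[w * h2 ^ a = h1 ^ b] (mod p)" if pos
  proof -
    have "[h1 ^ b * (h2 ^ a * k2 ^ a) = h1 ^ b * 1] (mod p)" by (intro cong_mult cong_refl k2p)
    then show ?thesis using that by (simp add: w_def mult_ac)
  qed
  have "f dvd g"
  proof -
    have "[w ^ g = 1] (mod p)"
    proof (cases pos)
      case True
      have "w ^ g = h1 ^ l * k2 ^ k" using True g by (simp add: w_def power_mult_distrib mult.commute flip: power_mult)
      also have "[h1 ^ l * k2 ^ k = h2 ^ k * k2 ^ k] (mod p)" using True by (intro cong_mult cong_refl) (simp add: pos_def)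
      also have "[h2 ^ k * k2 ^ k = 1] (mod p)" by (rule k2p)
      finally show ?thesis .
    next
      case False
      have "w ^ g = h1 ^ l * h2 ^ k" using False g by (simp add: w_def power_mult_distrib mult.commute flip: power_mult)
      then show ?thesis using False kl by (simp add: pos_def)
    qed
    then show ?thesis using f by blast
  qed
  then have fg: "f \<le> g" using g by (simp add: dvd_imp_le)
  have fa: "f * a \<le> s0" "f * b \<le> s0"
    using fg g kl mult_le_mono1[OF fg, of a] mult_le_mono1[OF fg, of b] by linarith+
  have ht: "[h1 ^ t = 1] (mod p)" "[h2 ^ t = 1] (mod p)" using t(1)[of t] by auto
  have k2t: "[k2 ^ t = 1] (mod p)"
    using cong_mult[OF ht(2) cong_refl, of "k2 ^ t"] k2p[of t] by (simp add: cong_def)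
  have "f dvd t"
  proof -
    have "w ^ t = (h1 ^ t) ^ b * ((if pos then k2 else h2) ^ t) ^ a"
      by (simp add: w_def power_mult_distrib mult.commute flip: power_mult)
    also have "[\<dots> = 1 ^ b * 1 ^ a] (mod p)" by (intro cong_mult cong_pow) (use ht k2t in auto)
    finally show ?thesis using f by simp
  qed
  then obtain s where s: "t = f * s" by blast
  have s0': "s > 0" using s t by (cases s) auto
  have fab: "f * a * b \<le> s"
  proof -
    have "f * (f * a * b) = (f * a) * (f * b)" by simp
    also have "\<dots> \<le> s0 * s0" by (intro mult_le_mono fa)
    also have "\<dots> \<le> f * s" using s0 s by (simp add: power2_eq_square)
    finally show ?thesis using f(1) by simp
  qed
  have tt: "\<And>m. [h1 ^ m = 1] (mod p) \<and> [h2 ^ m = 1] (mod p) \<longleftrightarrow> f * s dvd m" using t(1) s by simp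
  have alt: "a \<le> t"
  proof -
    have "a \<le> f * a * b" using f(1) ab by simp
    then have "a \<le> s" using fab by linarith
    moreover have "s \<le> t" using s f(1) by simp
    ultimately show "a \<le> t" by linarith
  qed
  have pa: "\<not> p dvd int a"
  proof
    assume "p dvd int a"
    then have "p \<le> int a" using ab(1) by (simp add: zdvd_imp_le)
    then show False using alt t(3) by linarith
  qed
  have main: "real (card (diff_set h1 h2 s1 s2 t)) \<le> real (f * ((s * (Bx - 1) + a * A + 2 * (f * a * b) * J) div M)) + real t / real F0"
    if params: "a * A \<le> s" "int (s * Bx) \<le> int a * p" "A * Bx \<le> f * b" "int M \<le> p" "M > 0"
      "M * (a * A + M * (a + b)) < J * (max 1 (a - 1) * (A * Bx))" for A Bx M J
  proof (cases pos)
    case True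
    have le: "card (diff_set h1 h2 s1 s2 (f * s)) \<le> f * ((s * (Bx - 1) + a * A + 2 * (f * a * b) * J) div M) + (if a = 1 then s else 0)"
      by (rule card_diff_set_pos[OF h s12 ab(1-3) pa f(1) s0' tt params wpos[OF True] f(2) ab(4)])
    have "real (if a = 1 then s else 0) \<le> real t / real F0"
    proof (cases "a = 1")
      case a1: True
      then have b1: "b = 1" using ab by simp
      have "[w ^ f = 1] (mod p)" using f by simp
      from cong_mult[OF this cong_refl, of "h2 ^ f"] cong_pow[OF wpos[OF True], of f]
      have "[h1 ^ f = h2 ^ f] (mod p)" using a1 b1 by (simp add: power_mult_distrib cong_def)
      then have "F0 \<le> f" using F0(1) \<open>f dvd t\<close> by blast
      then have "real s * real F0 \<le> real s * real f" by (intro mult_left_mono) auto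
      then show ?thesis using a1 F0(2) s by (simp add: field_simps)
    qed simp
    moreover have "real (card (diff_set h1 h2 s1 s2 t)) \<le> real (f * ((s * (Bx - 1) + a * A + 2 * (f * a * b) * J) div M))
        + real (if a = 1 then s else 0)"
      using le unfolding s of_nat_add[symmetric] of_nat_le_iff .
    ultimately show ?thesis by linarith
  next
    case False
    have "w ^ f = h1 ^ (f * b) * h2 ^ (f * a)"
      using False by (simp add: w_def power_mult_distrib mult.commute flip: power_mult)
    then have "[h1 ^ (f * b) * h2 ^ (f * a) = 1] (mod p)" using f(2)[of f] by simp
    from card_diff_set_neg[OF h s12 ab(1-3) pa f(1) s0' tt params this]
    have "real (card (diff_set h1 h2 s1 s2 t)) \<le> real (f * ((s * (Bx - 1) + a * A + 2 * (f * a * b) * J) div M))"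
      using s by (simp only: of_nat_le_iff)
    moreover have "real t / real F0 \<ge> 0" by simp
    ultimately show ?thesis by linarith
  qed
  have nonneg: "0 \<le> 128 * real s0 * sqrt (real s0 * real B)" "0 \<le> 32 * real s0 * real B" "0 \<le> real t / real B"
    by simp_all
  show ?thesis
  proof (cases "2 * B \<le> f * b")
    case True
    \<comment> \<open>The largest integer with 2 B1^2 B \<le> f b, which is the sparsity constraint
      for A = 2 B1 B; it is positive because 2 B \<le> f b.\<close>
    define B1 where "B1 = floor_sqrt (f * b div (2 * B))"
    have B1: "B1\<^sup>2 \<le> f * b div (2 * B)" "f * b div (2 * B) < (Suc B1)\<^sup>2"
      unfolding B1_def by (rule floor_sqrt_power2_le, rule Suc_floor_sqrt_power2_gt)
    have "f * b div (2 * B) \<ge> 1" using True B by (simp add: Suc_le_eq div_greater_zero_iff)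
    then have B1p: "B1 > 0" using B1(2) by (intro Nat.gr0I) auto
    have le: "2 * B1\<^sup>2 * B \<le> f * b"
    proof -
      have "2 * B1\<^sup>2 * B \<le> 2 * B * (f * b div (2 * B))" using mult_le_mono2[OF B1(1), of "2 * B"] by (simp only: mult_ac)
      also have "\<dots> \<le> f * b" by (rule times_div_less_eq_dividend)
      finally show ?thesis .
    qed
    have gt: "f * b < 2 * (B1 + 1)\<^sup>2 * B"
      using B1(2) B by (simp add: div_less_iff_less_mult mult_ac)
    note P = params_large[OF ab(2,4) f(1) B B1p le fab]
    have "int (s * B1) \<le> int a * p"
    proof -
      have "int (s * B1) \<le> int (a * (f * s))" using P(2) by (simp only: of_nat_le_iff)
      also have "\<dots> = int a * int t" using s by simp
      also have "\<dots> \<le> int a * p" using t(3) by (intro mult_left_mono) auto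
      finally show ?thesis .
    qed
    moreover have "int (B1 * B) \<le> p"
    proof -
      have "int (B1 * B) \<le> int t" using P(4) unfolding s by (simp only: of_nat_le_iff)
      then show ?thesis using t(3) by linarith
    qed
    moreover have "B1 * B > 0" using B1p B by simp
    ultimately have "real (card (diff_set h1 h2 s1 s2 t)) \<le> real (f * ((s * (B1 - 1) + a * (2 * (B1 * B)) + 2 * (f * a * b) * (8 * B)) div (B1 * B))) + real t / real F0"
      using main[OF P(1) _ P(3) _ _ P(5)] by blast
    also have "\<dots> \<le> real (f * s) / real B + 2 * real s0 + 128 * real s0 * sqrt (real s0 * real B) + real t / real F0"
      using large_bound_arith[OF B B1p le gt fa] by (rule add_right_mono)
    finally show ?thesis unfolding s[symmetric] using nonneg(2) by linarith
  next
    case False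
    \<comment> \<open>For f b < 2 B the minimal parameters suffice, with \<open>A\<close>,
      \<open>Bx\<close> and \<open>M\<close> equal to 1 and \<open>J\<close> equal to 8: the
      resulting f a + 16 (f a)(f b) is at most s0 + 32 s0 B.\<close>
    have "3 * a < 8 * max 1 (a - 1)" by (auto simp: max_def)
    then have c6: "1 * (a * 1 + 1 * (a + b)) < 8 * (max 1 (a - 1) * (1 * 1))" using ab(4) by simp
    have "a \<le> f * a * b" using f(1) ab by simp
    then have c1: "a * 1 \<le> s" using fab by linarith
    have c2: "int (s * 1) \<le> int a * p"
    proof -
      have "s \<le> t" using s f(1) by simp
      then have "int s \<le> 1 * p" using t(3) by simp
      also have "\<dots> \<le> int a * p" using ab(1) p_gt_1 by (intro mult_right_mono) auto
      finally show ?thesis by simp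
    qed
    have "real (card (diff_set h1 h2 s1 s2 t)) \<le> real (f * ((s * (1 - 1) + a * 1 + 2 * (f * a * b) * 8) div 1)) + real t / real F0"
      by (rule main[OF c1 c2 _ _ _ c6]) (use f(1) ab p_gt_1 in \<open>simp_all add: Suc_le_eq\<close>)
    also have "real (f * ((s * (1 - 1) + a * 1 + 2 * (f * a * b) * 8) div 1)) = real (f * a) + 16 * (real (f * a) * real (f * b))"
      by (simp add: algebra_simps)
    also have "\<dots> \<le> real s0 + 16 * (real s0 * (2 * real B))"
    proof -
      have "real (f * a) \<le> real s0" "real (f * b) \<le> real (2 * B)"
        using fa(1) False by (simp_all only: of_nat_le_iff)
      then show ?thesis by (intro add_mono mult_mono) simp_all
    qed
    finally have "real (card (diff_set h1 h2 s1 s2 t)) \<le> real s0 + 16 * (real s0 * (2 * real B)) + real t / real F0" by simp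
    moreover have "16 * (real s0 * (2 * real B)) = 32 * real s0 * real B" by simp
    moreover have "real s0 \<ge> 0" by simp
    ultimately show ?thesis using nonneg(1,3) by linarith
  qed
qed


lemma diff_set_commute: "diff_set h1 h2 s1 s2 t = diff_set h2 h1 s2 s1 t"
  by (auto simp: diff_set_def)

lemma card_diff_set_units:
  fixes B F0 :: nat
  assumes h: "\<not> p dvd h1" "\<not> p dvd h2" and s12: "\<not> p dvd s1" "\<not> p dvd s2"
    and t: "\<And>m. [h1 ^ m = 1] (mod p) \<and> [h2 ^ m = 1] (mod p) \<longleftrightarrow> t dvd m" "t > 0" "int t < p"
    and s0: "s0\<^sup>2 \<le> t" "t < (s0 + 1)\<^sup>2" and B: "B > 0"
    and ord: "\<And>m. 0 < m \<Longrightarrow> m \<le> s0 \<Longrightarrow> \<not> [h1 ^ m = 1] (mod p)" "\<And>m. 0 < m \<Longrightarrow> m \<le> s0 \<Longrightarrow> \<not> [h2 ^ m = 1] (mod p)"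
    and F0: "\<And>f. f dvd t \<Longrightarrow> [h1 ^ f = h2 ^ f] (mod p) \<Longrightarrow> F0 \<le> f" "F0 > 0"
  shows "real (card (diff_set h1 h2 s1 s2 t)) \<le> real t / real B + 2 * real s0
    + 128 * real s0 * sqrt (real s0 * real B) + 32 * real s0 * real B + real t / real F0"
proof -
  have ht: "[h1 ^ t = 1] (mod p)" "[h2 ^ t = 1] (mod p)" using t(1)[of t] by auto
  obtain k l where kl: "0 < k" "k \<le> s0" "0 < l" "l \<le> s0"
    "[h1 ^ l = h2 ^ k] (mod p) \<or> [h1 ^ l * h2 ^ k = 1] (mod p)"
    using dirichlet_relation[OF h ht t(2) s0(2) ord] by blast
  show ?thesis
  proof (cases "l \<le> k")
    case True
    show ?thesis by (rule card_diff_set_relation[OF h s12 t s0(1) B kl(3) True kl(2) kl(5) F0])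
  next
    case False
    have t': "\<And>m. [h2 ^ m = 1] (mod p) \<and> [h1 ^ m = 1] (mod p) \<longleftrightarrow> t dvd m" using t(1) by blast
    have kl': "[h2 ^ k = h1 ^ l] (mod p) \<or> [h2 ^ k * h1 ^ l = 1] (mod p)"
      using kl(5) by (auto simp: cong_sym_eq mult.commute)
    have F0': "\<And>f. f dvd t \<Longrightarrow> [h2 ^ f = h1 ^ f] (mod p) \<Longrightarrow> F0 \<le> f" using F0(1) cong_sym by blast
    have kl2: "k \<le> l" using False by simp
    show ?thesis unfolding diff_set_commute[of h1 h2]
      by (rule card_diff_set_relation[OF h(2,1) s12(2,1) t' t(2,3) s0(1) B kl(1) kl2 kl(4) kl' F0' F0(2)])
  qed
qed

text \<open>The first coordinates agree, so y = x + o1 j modulo t for one of u1 values of j. For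
  fixed j the second coordinate determines h2^x, hence x modulo o2, which leaves u2 values of x
  below t.\<close>

lemma card_diff_set_zero:
  assumes h: "\<not> p dvd h1" "\<not> p dvd h2" and s12: "[s1 = 0] (mod p)" "\<not> p dvd s2"
    and o: "\<And>m. [h1 ^ m = 1] (mod p) \<longleftrightarrow> o1 dvd m" "\<And>m. [h2 ^ m = 1] (mod p) \<longleftrightarrow> o2 dvd m"
    and t: "t > 0" "o1 * u1 = t" "o2 * u2 = t"
  shows "card (diff_set h1 h2 s1 s2 t) \<le> u1 * u2"
proof -
  let ?D = "diff_set h1 h2 s1 s2 t"
  have o12: "o1 > 0" "o2 > 0" "u1 > 0" using t by (auto intro: Nat.gr0I)
  have od: "o1 dvd t" "o2 dvd t" by (simp_all add: t(2)[symmetric], simp add: t(2) t(3)[symmetric])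
  have ex: "\<exists>j<u1. [h2 ^ x * (1 - h2 ^ (o1 * j)) = s2] (mod p)" if x: "x \<in> ?D" for x
  proof -
    obtain y where y: "[h1 ^ x - h1 ^ y = s1] (mod p)" "[h2 ^ x - h2 ^ y = s2] (mod p)"
      using x by (auto simp: diff_set_def)
    \<comment> \<open>A multiple of the period t is added to bring the second exponent above
      x.\<close>
    define z where "z = y + t * x"
    have zx: "z \<ge> x" using t(1) by (simp add: z_def trans_le_add2)
    have ht: "[h1 ^ (t * x) = 1] (mod p)" "[h2 ^ (t * x) = 1] (mod p)"
      using od by (simp_all add: o)
    have hz: "[h1 ^ z = h1 ^ y] (mod p)" "[h2 ^ z = h2 ^ y] (mod p)"
      using cong_mult[OF cong_refl ht(1), of "h1 ^ y"] cong_mult[OF cong_refl ht(2), of "h2 ^ y"]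
      by (simp_all add: z_def power_add)
    have "[h1 ^ x - h1 ^ y = 0] (mod p)" using y(1) s12(1) cong_trans by blast
    then have "[h1 ^ x = h1 ^ y] (mod p)" by (simp add: cong_diff_iff_cong_0)
    then have "[h1 ^ x * h1 ^ (z - x) = h1 ^ x * 1] (mod p)"
      using hz(1) zx by (simp add: cong_def flip: power_add)
    then have "[h1 ^ (z - x) = 1] (mod p)" using cong_cancel[OF not_dvd_power[OF h(1)]] by blast
    then obtain m where m: "z - x = o1 * m" using o(1) by blast
    define j where "j = m mod u1"
    have "o1 * m = o1 * j + t * (m div u1)"
      unfolding j_def t(2)[symmetric] mult.assoc distrib_left[symmetric] by simp
    moreover have "[h2 ^ (t * (m div u1)) = 1] (mod p)" using od by (simp add: o)
    ultimately have "[h2 ^ (o1 * m) = h2 ^ (o1 * j)] (mod p)"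
      using cong_mult[OF cong_refl, of "h2 ^ (t * (m div u1))" 1 p "h2 ^ (o1 * j)"] by (simp add: power_add)
    moreover have "h2 ^ z = h2 ^ x * h2 ^ (o1 * m)"
      unfolding m[symmetric] power_add[symmetric] using zx by simp
    ultimately have "[h2 ^ z = h2 ^ x * h2 ^ (o1 * j)] (mod p)"
      by (simp only:) (intro cong_mult cong_refl)
    then have "[h2 ^ x * h2 ^ (o1 * j) = h2 ^ y] (mod p)" using hz(2) by (simp add: cong_def)
    from cong_diff[OF cong_refl this, of "h2 ^ x"] y(2)
    have "[h2 ^ x * (1 - h2 ^ (o1 * j)) = s2] (mod p)" by (simp add: cong_def right_diff_distrib)
    moreover have "j < u1" using o12 by (simp add: j_def)
    ultimately show ?thesis by blast
  qed
  then obtain J where J: "\<And>x. x \<in> ?D \<Longrightarrow> J x < u1 \<and> [h2 ^ x * (1 - h2 ^ (o1 * J x)) = s2] (mod p)" by metis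
  have "inj_on (\<lambda>x. (J x, x div o2)) ?D"
  proof (rule inj_onI)
    fix x x' assume xx: "x \<in> ?D" "x' \<in> ?D" "(J x, x div o2) = (J x', x' div o2)"
    define v where "v = 1 - h2 ^ (o1 * J x)"
    have e: "[v * h2 ^ x = s2] (mod p)" "[v * h2 ^ x' = s2] (mod p)"
      using J[OF xx(1)] J[OF xx(2)] xx(3) by (simp_all add: v_def mult.commute)
    have "\<not> p dvd v" using cong_not_dvd[OF e(1) s12(2)] by (auto dest: dvd_mult2)
    moreover have "[v * h2 ^ x = v * h2 ^ x'] (mod p)" using e by (simp add: cong_def)
    ultimately have hx: "[h2 ^ x = h2 ^ x'] (mod p)" using cong_cancel by blast
    have red: "[h2 ^ n = h2 ^ (n mod o2)] (mod p)" for n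
    proof -
      have "h2 ^ n = h2 ^ (o2 * (n div o2)) * h2 ^ (n mod o2)" by (simp flip: power_add)
      moreover have "[h2 ^ (o2 * (n div o2)) = 1] (mod p)" using o(2) by simp
      ultimately show ?thesis using cong_mult[OF _ cong_refl, of "h2 ^ (o2 * (n div o2))" 1 p "h2 ^ (n mod o2)"] by simp
    qed
    have "[h2 ^ (x mod o2) = h2 ^ (x' mod o2)] (mod p)"
      using red[of x] red[of x'] hx by (simp add: cong_def)
    then have "x mod o2 = x' mod o2"
      using cong_powers_imp_eq[OF o(2) h(2), where i="x mod o2" and j="x' mod o2"] o12 by simp
    moreover have "x div o2 = x' div o2" using xx(3) by simp
    ultimately show "x = x'" by (metis div_mult_mod_eq)
  qed
  moreover have "(\<lambda>x. (J x, x div o2)) ` ?D \<subseteq> {..<u1} \<times> {..<u2}"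
  proof clarify
    fix x assume x: "x \<in> ?D"
    then have "x < u2 * o2" using t(3) by (simp add: diff_set_def mult.commute)
    then show "J x \<in> {..<u1} \<and> x div o2 \<in> {..<u2}" using J[OF x] by (simp add: less_mult_imp_div_less)
  qed
  ultimately have "card ?D \<le> card ({..<u1} \<times> {..<u2})" by (intro card_inj_on_le) auto
  then show ?thesis by (simp add: card_cartesian_product)
qed

section \<open>Multiplicities over the full range of exponents\<close>

definition rep_count :: "int \<Rightarrow> int \<Rightarrow> int \<Rightarrow> int \<Rightarrow> nat" where
  "rep_count h1 h2 s1 s2 = card {(x, y) \<in> {1..nat p - 1} \<times> {1..nat p - 1}.
      [h1 ^ x - h1 ^ y = s1] (mod p) \<and> [h2 ^ x - h2 ^ y = s2] (mod p)}"

lemma card_residue_class_le: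
  fixes d t c :: nat
  assumes "t > 0"
  shows "card {x \<in> {1..d * t}. x mod t = c} \<le> d"
proof -
  have "inj_on (\<lambda>x. (x - 1) div t) {x \<in> {1..d * t}. x mod t = c}"
  proof (rule inj_onI)
    fix x y assume *: "x \<in> {x \<in> {1..d * t}. x mod t = c}" "y \<in> {x \<in> {1..d * t}. x mod t = c}"
      "(x - 1) div t = (y - 1) div t"
    have "[x = y] (mod t)" using * by (simp add: cong_def)
    then have "[(x - 1) + 1 = (y - 1) + 1] (mod t)" using * by simp
    then have "[x - 1 = y - 1] (mod t)" by (simp only: cong_add_rcancel_nat)
    then have "x - 1 = y - 1" using *(3) by (metis cong_def div_mult_mod_eq)
    then show "x = y" using * by auto
  qed
  moreover have "(\<lambda>x. (x - 1) div t) ` {x \<in> {1..d * t}. x mod t = c} \<subseteq> {..<d}"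
    using assms by (auto simp: less_mult_imp_div_less)
  ultimately have "card {x \<in> {1..d * t}. x mod t = c} \<le> card {..<d}" by (intro card_inj_on_le) auto
  then show ?thesis by simp
qed

context
  fixes h1 h2 :: int and t d :: nat
  assumes h: "\<not> p dvd h1" "\<not> p dvd h2"
    and t: "\<And>m. [h1 ^ m = 1] (mod p) \<and> [h2 ^ m = 1] (mod p) \<longleftrightarrow> t dvd m" "d * t = nat p - 1"
begin

lemma t_pos: "t > 0"
  using t(2) p_gt_1 by (intro Nat.gr0I) auto

lemma cong_pow_mod_order: "[h1 ^ n = h1 ^ (n mod t)] (mod p) \<and> [h2 ^ n = h2 ^ (n mod t)] (mod p)"
proof -
  have "[h1 ^ (t * (n div t)) = 1] (mod p)" "[h2 ^ (t * (n div t)) = 1] (mod p)"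
    using t(1)[of "t * (n div t)"] by auto
  from cong_mult[OF this(1) cong_refl, of "h1 ^ (n mod t)"] cong_mult[OF this(2) cong_refl, of "h2 ^ (n mod t)"]
  show ?thesis by (simp flip: power_add)
qed

lemma cong_pow_order_imp_eq:
  assumes "[h1 ^ x = h1 ^ y] (mod p)" "[h2 ^ x = h2 ^ y] (mod p)"
  shows "x mod t = y mod t"
proof -
  have *: "x mod t = y mod t" if "x \<le> y" "[h1 ^ x = h1 ^ y] (mod p)" "[h2 ^ x = h2 ^ y] (mod p)" for x y
  proof -
    have canc: "[h ^ (y - x) = 1] (mod p)" if "\<not> p dvd h" "[h ^ x = h ^ y] (mod p)" for h
    proof -
      have "h ^ y = h ^ x * h ^ (y - x)" using \<open>x \<le> y\<close> by (simp flip: power_add)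
      then have "[h ^ x * h ^ (y - x) = h ^ x * 1] (mod p)" using that(2) by (simp add: cong_sym)
      then show ?thesis using cong_cancel[OF not_dvd_power[OF that(1)]] by blast
    qed
    have "[h1 ^ (y - x) = 1] (mod p)" "[h2 ^ (y - x) = 1] (mod p)"
      using canc[OF h(1) that(2)] canc[OF h(2) that(3)] by auto
    then have "t dvd y - x" using t(1)[of "y - x"] by simp
    then show ?thesis using that(1) by (metis mod_eq_dvd_iff_nat)
  qed
  show ?thesis
  proof (cases "x \<le> y")
    case True
    then show ?thesis using assms by (rule *)
  next
    case False
    then have "y \<le> x" by simp
    then show ?thesis using *[of y x] cong_sym[OF assms(1)] cong_sym[OF assms(2)] by simp
  qed
qed

text \<open>Every group element is reached by d exponents in {1..p - 1}; this factor occurs once for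
  x and once for y.\<close>

lemma rep_count_le: "rep_count h1 h2 s1 s2 \<le> d\<^sup>2 * card (diff_set h1 h2 s1 s2 t)"
proof -
  let ?X = "{1..nat p - 1}" and ?D = "diff_set h1 h2 s1 s2 t"
  let ?P = "\<lambda>x y. [h1 ^ x - h1 ^ y = s1] (mod p) \<and> [h2 ^ x - h2 ^ y = s2] (mod p)"
  have sub: "{(x, y) \<in> ?X \<times> ?X. ?P x y} \<subseteq> Sigma (\<Union>c\<in>?D. {x \<in> ?X. x mod t = c}) (\<lambda>x. {y \<in> ?X. ?P x y})"
  proof clarify
    fix x y assume xy: "x \<in> ?X" "y \<in> ?X" "[h1 ^ x - h1 ^ y = s1] (mod p)" "[h2 ^ x - h2 ^ y = s2] (mod p)"
    have "[h1 ^ (x mod t) - h1 ^ y = s1] (mod p)" "[h2 ^ (x mod t) - h2 ^ y = s2] (mod p)"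
      using cong_diff[OF cong_pow_mod_order[THEN conjunct1, of x] cong_refl, of "h1 ^ y"]
        cong_diff[OF cong_pow_mod_order[THEN conjunct2, of x] cong_refl, of "h2 ^ y"] xy(3,4)
      by (simp_all add: cong_def)
    then have "x mod t \<in> ?D" using t_pos by (auto simp: diff_set_def)
    then show "x \<in> (\<Union>c\<in>?D. {x \<in> ?X. x mod t = c}) \<and> y \<in> {y \<in> ?X. ?P x y}" using xy by auto
  qed
  have yc: "card {y \<in> ?X. ?P x y} \<le> d" for x
  proof (cases "{y \<in> ?X. ?P x y} = {}")
    case False
    then obtain y0 where y0: "y0 \<in> ?X" "?P x y0" by auto
    have "{y \<in> ?X. ?P x y} \<subseteq> {y \<in> {1..d * t}. y mod t = y0 mod t}"
    proof
      fix y assume y: "y \<in> {y \<in> ?X. ?P x y}"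
      have "[h1 ^ x - h1 ^ y = h1 ^ x - h1 ^ y0] (mod p)" "[h2 ^ x - h2 ^ y = h2 ^ x - h2 ^ y0] (mod p)"
        using y y0 by (simp_all add: cong_def)
      from cong_diff[OF cong_refl this(1), of "h1 ^ x"] cong_diff[OF cong_refl this(2), of "h2 ^ x"]
      have "y mod t = y0 mod t" by (intro cong_pow_order_imp_eq) simp_all
      then show "y \<in> {y \<in> {1..d * t}. y mod t = y0 mod t}" using y t(2) by simp
    qed
    then have "card {y \<in> ?X. ?P x y} \<le> card {y \<in> {1..d * t}. y mod t = y0 mod t}" by (intro card_mono) auto
    also have "\<dots> \<le> d" by (rule card_residue_class_le[OF t_pos])
    finally show ?thesis .
  qed (simp only: card.empty le0)
  have "rep_count h1 h2 s1 s2 \<le> card (Sigma (\<Union>c\<in>?D. {x \<in> ?X. x mod t = c}) (\<lambda>x. {y \<in> ?X. ?P x y}))"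
    unfolding rep_count_def by (rule card_mono[OF _ sub]) auto
  also have "\<dots> = (\<Sum>x\<in>(\<Union>c\<in>?D. {x \<in> ?X. x mod t = c}). card {y \<in> ?X. ?P x y})"
    by (rule card_SigmaI) auto
  also have "\<dots> \<le> (\<Sum>x\<in>(\<Union>c\<in>?D. {x \<in> ?X. x mod t = c}). d)" by (rule sum_mono) (rule yc)
  also have "\<dots> = card (\<Union>c\<in>?D. {x \<in> ?X. x mod t = c}) * d" by simp
  also have "\<dots> \<le> (\<Sum>c\<in>?D. card {x \<in> ?X. x mod t = c}) * d"
    by (intro mult_le_mono1 card_UN_le) simp
  also have "\<dots> \<le> (\<Sum>c\<in>?D. d) * d"
    by (intro mult_le_mono1 sum_mono) (use card_residue_class_le[OF t_pos, of d] t(2) in simp)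
  finally show ?thesis by (simp add: power2_eq_square mult_ac)
qed

lemma rep_count_zero_le: "rep_count h1 h2 0 0 \<le> (nat p - 1) * d"
proof -
  let ?X = "{1..nat p - 1}"
  have "{(x, y) \<in> ?X \<times> ?X. [h1 ^ x - h1 ^ y = 0] (mod p) \<and> [h2 ^ x - h2 ^ y = 0] (mod p)}
      \<subseteq> Sigma ?X (\<lambda>x. {y \<in> {1..d * t}. y mod t = x mod t})"
  proof
    fix z assume "z \<in> {(x, y) \<in> ?X \<times> ?X. [h1 ^ x - h1 ^ y = 0] (mod p) \<and> [h2 ^ x - h2 ^ y = 0] (mod p)}"
    then obtain x y where z: "z = (x, y)" and xy: "x \<in> ?X" "y \<in> ?X"
      "[h1 ^ x - h1 ^ y = 0] (mod p)" "[h2 ^ x - h2 ^ y = 0] (mod p)" by blast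
    then have "x mod t = y mod t" by (intro cong_pow_order_imp_eq) (simp_all only: cong_diff_iff_cong_0)
    then show "z \<in> Sigma ?X (\<lambda>x. {y \<in> {1..d * t}. y mod t = x mod t})" using z xy t(2) by simp
  qed
  then have "rep_count h1 h2 0 0 \<le> card (Sigma ?X (\<lambda>x. {y \<in> {1..d * t}. y mod t = x mod t}))"
    unfolding rep_count_def by (intro card_mono) auto
  also have "\<dots> = (\<Sum>x\<in>?X. card {y \<in> {1..d * t}. y mod t = x mod t})" by (rule card_SigmaI) auto
  also have "\<dots> \<le> (\<Sum>x\<in>?X. d)" by (intro sum_mono card_residue_class_le t_pos)
  finally show ?thesis by simp
qed

end

end

section \<open>Exponential sums over a cyclic group of pairs\<close>

lemma sum_square_le_card: 
  fixes x :: "'a \<Rightarrow> real"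
  shows "(\<Sum>i\<in>I. x i)\<^sup>2 \<le> real (card I) * (\<Sum>i\<in>I. (x i)\<^sup>2)"
proof -
  have "(\<Sum>i\<in>I. x i)\<^sup>2 = (\<Sum>i\<in>I. \<Sum>j\<in>I. x i * x j)" by (simp add: power2_eq_square sum_product)
  also have "\<dots> \<le> (\<Sum>i\<in>I. \<Sum>j\<in>I. ((x i)\<^sup>2 + (x j)\<^sup>2) / 2)"
  proof (intro sum_mono)
    fix i j
    have "0 \<le> (x i - x j)\<^sup>2" by simp
    then show "x i * x j \<le> ((x i)\<^sup>2 + (x j)\<^sup>2) / 2" by (simp add: power2_diff)
  qed
  also have "\<dots> = (\<Sum>i\<in>I. (real (card I) * (x i)\<^sup>2 + (\<Sum>j\<in>I. (x j)\<^sup>2)) / 2)"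
    by (simp add: sum.distrib flip: sum_divide_distrib)
  also have "\<dots> = real (card I) * (\<Sum>i\<in>I. (x i)\<^sup>2)"
    by (simp add: sum.distrib flip: sum_divide_distrib sum_distrib_left)
  finally show ?thesis .
qed

lemma sum_power4_le_card:
  fixes x :: "'a \<Rightarrow> real"
  shows "(\<Sum>i\<in>I. x i) ^ 4 \<le> real (card I) ^ 3 * (\<Sum>i\<in>I. x i ^ 4)"
proof -
  have "(\<Sum>i\<in>I. x i) ^ 4 = ((\<Sum>i\<in>I. x i)\<^sup>2)\<^sup>2" by simp
  also have "\<dots> \<le> (real (card I) * (\<Sum>i\<in>I. (x i)\<^sup>2))\<^sup>2"
    by (intro power_mono sum_square_le_card) simp
  also have "\<dots> = (real (card I))\<^sup>2 * (\<Sum>i\<in>I. (x i)\<^sup>2)\<^sup>2" by (rule power_mult_distrib)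
  also have "\<dots> \<le> (real (card I))\<^sup>2 * (real (card I) * (\<Sum>i\<in>I. ((x i)\<^sup>2)\<^sup>2))"
    by (intro mult_left_mono sum_square_le_card) simp
  also have "\<dots> = real (card I) ^ 3 * (\<Sum>i\<in>I. x i ^ 4)"
    by (simp add: power2_eq_square power3_eq_cube power4_eq_xxxx mult_ac)
  finally show ?thesis .
qed

context prime_modulus
begin

definition ex :: "int \<Rightarrow> complex" where
  "ex z = cis (2 * pi * of_int z / of_int p)"

lemma ex_add: "ex (x + y) = ex x * ex y"
  by (simp add: ex_def cis_mult add_divide_distrib distrib_left)

lemma ex_0 [simp]: "ex 0 = 1"
  by (simp add: ex_def)

lemma norm_ex [simp]: "norm (ex z) = 1"
  by (simp add: ex_def)

lemma cnj_ex: "cnj (ex z) = ex (- z)"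
  by (simp add: ex_def cis_cnj)

lemma ex_multiple [simp]: "ex (p * k) = 1"
  using p_gt_1 cis_multiple_2pi[of "real_of_int k"] by (simp add: ex_def mult_ac)

lemma ex_cong: "[x = y] (mod p) \<Longrightarrow> ex x = ex y"
proof -
  assume "[x = y] (mod p)"
  then obtain k where "x = y + p * k" by (metis cong_iff_lin mult.commute cong_sym)
  then show ?thesis by (simp add: ex_add)
qed

lemma ex_eq_1_iff: "ex z = 1 \<longleftrightarrow> p dvd z"
proof
  assume "ex z = 1"
  then have "cos (2 * pi * of_int z / of_int p) = 1" by (simp add: ex_def cis.ctr complex_eq_iff)
  then obtain k :: int where "2 * pi * of_int z / of_int p = of_int k * (2 * pi)"
    by (auto simp: cos_one_2pi_int)
  then have "of_int z = (of_int (k * p) :: real)" using p_gt_1 by (simp add: field_simps)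
  then have "z = k * p" by (simp only: of_int_eq_iff)
  then show "p dvd z" by simp
qed (auto elim!: dvdE)

lemma sum_ex: "(\<Sum>s\<in>{0..<p}. ex (c * s)) = (if p dvd c then of_int p else 0)"
proof (cases "p dvd c")
  case True
  then have "ex (c * s) = 1" for s by (simp add: ex_eq_1_iff)
  then show ?thesis using True p_gt_1 by simp
next
  case False
  have pw: "ex (c * int n) = ex c ^ n" for n
    by (induction n) (simp_all add: distrib_left ex_add)
  have "{0..<p} = int ` {..<nat p}" using p_gt_1 by (auto simp: image_int_atLeastLessThan lessThan_atLeast0)
  then have "(\<Sum>s\<in>{0..<p}. ex (c * s)) = (\<Sum>n<nat p. ex c ^ n)"
    by (simp add: sum.reindex pw)
  also have "\<dots> = (1 - ex c ^ nat p) / (1 - ex c)"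
    using False ex_eq_1_iff by (subst sum_gp_strict) auto
  also have "ex c ^ nat p = 1" using p_gt_1 ex_multiple[of c] by (simp add: mult.commute flip: pw)
  finally show ?thesis using False by simp
qed

context
  fixes h1 h2 :: int
  assumes h: "\<not> p dvd h1" "\<not> p dvd h2"
begin

definition Fs :: "int \<Rightarrow> int \<Rightarrow> complex" where
  "Fs u v = (\<Sum>x = 1..nat p - 1. ex (u * h1 ^ x + v * h2 ^ x))"

lemma Fs_cong: "[u = u'] (mod p) \<Longrightarrow> [v = v'] (mod p) \<Longrightarrow> Fs u v = Fs u' v'"
  unfolding Fs_def by (intro sum.cong refl ex_cong cong_add cong_mult) simp_all

lemma Fs_shift: "Fs (u * h1 ^ y) (v * h2 ^ y) = Fs u v"
proof -
  define N where "N = nat p - 1"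
  define f where "f = (\<lambda>x. ex (u * h1 ^ x + v * h2 ^ x))"
  have per: "f (x + N) = f x" for x
  proof -
    have "[h1 ^ (x + N) = h1 ^ x * 1] (mod p)" "[h2 ^ (x + N) = h2 ^ x * 1] (mod p)"
      unfolding power_add N_def by (intro cong_mult cong_refl fermat h)+
    then show ?thesis unfolding f_def by (intro ex_cong cong_add cong_mult cong_refl) simp_all
  qed
  have "(\<Sum>x = 1..N. f (x + y)) = (\<Sum>x = 1..N. f x)"
  proof (induction y)
    case (Suc y)
    have "(\<Sum>x = 1..N. f (x + Suc y)) = (\<Sum>x = 1..N. f (Suc x + y))" by simp
    also have "\<dots> = (\<Sum>x = Suc 1..Suc N. f (x + y))" by (subst sum.shift_bounds_cl_Suc_ivl) simp
    also have "\<dots> = (\<Sum>x = 1..N. f (x + y))"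
    proof -
      have "(\<Sum>x = 1..Suc N. f (x + y)) = f (1 + y) + (\<Sum>x = Suc 1..Suc N. f (x + y))"
        by (rule sum.atLeast_Suc_atMost) simp
      moreover have "(\<Sum>x = 1..Suc N. f (x + y)) = (\<Sum>x = 1..N. f (x + y)) + f (Suc N + y)" by simp
      moreover have "f (Suc N + y) = f (1 + y)" using per[of "1 + y"] by (simp add: add.commute)
      ultimately show ?thesis by simp
    qed
    finally show ?case using Suc by simp
  qed simp
  then show ?thesis by (simp add: Fs_def f_def N_def power_add mult_ac)
qed

abbreviation "Xs \<equiv> {1..nat p - 1}"
abbreviation "d1 \<pi> \<equiv> h1 ^ fst \<pi> - h1 ^ snd \<pi>"
abbreviation "d2 \<pi> \<equiv> h2 ^ fst \<pi> - h2 ^ snd \<pi>"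

lemma norm_Fs_square: "complex_of_real ((norm (Fs u v))\<^sup>2) = (\<Sum>\<pi>\<in>Xs \<times> Xs. ex (u * d1 \<pi> + v * d2 \<pi>))"
proof -
  have "complex_of_real ((norm (Fs u v))\<^sup>2) = Fs u v * cnj (Fs u v)"
    by (rule complex_norm_square)
  also have "\<dots> = (\<Sum>x\<in>Xs. \<Sum>y\<in>Xs. ex (u * h1 ^ x + v * h2 ^ x) * ex (- (u * h1 ^ y + v * h2 ^ y)))"
    by (simp add: Fs_def sum_product cnj_ex)
  also have "\<dots> = (\<Sum>x\<in>Xs. \<Sum>y\<in>Xs. ex (u * d1 (x, y) + v * d2 (x, y)))"
    by (intro sum.cong refl) (simp add: algebra_simps flip: ex_add)
  also have "\<dots> = (\<Sum>\<pi>\<in>Xs \<times> Xs. ex (u * d1 \<pi> + v * d2 \<pi>))"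
    by (simp add: sum.cartesian_product case_prod_beta)
  finally show ?thesis .
qed

text \<open>The left side is the sum of the squared modulus over the p - 1 shifts that leave the sum
  invariant. Expanding the square makes the sum over the shifts a sum of the same kind, with
  coefficients multiplied by differences of group elements.\<close>

lemma norm_Fs_le_average:
  "real (nat p - 1) * (norm (Fs u v))\<^sup>2 \<le> (\<Sum>\<pi>\<in>Xs \<times> Xs. norm (Fs (u * d1 \<pi>) (v * d2 \<pi>)))"
proof -
  have "complex_of_real (real (nat p - 1) * (norm (Fs u v))\<^sup>2)
      = (\<Sum>y\<in>Xs. complex_of_real ((norm (Fs (u * h1 ^ y) (v * h2 ^ y)))\<^sup>2))"
    by (simp add: Fs_shift)
  also have "\<dots> = (\<Sum>y\<in>Xs. \<Sum>\<pi>\<in>Xs \<times> Xs. ex ((u * d1 \<pi>) * h1 ^ y + (v * d2 \<pi>) * h2 ^ y))"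
    unfolding norm_Fs_square by (simp add: mult_ac)
  also have "\<dots> = (\<Sum>\<pi>\<in>Xs \<times> Xs. Fs (u * d1 \<pi>) (v * d2 \<pi>))"
    unfolding Fs_def by (rule sum.swap)
  finally have "real (nat p - 1) * (norm (Fs u v))\<^sup>2 = norm (\<Sum>\<pi>\<in>Xs \<times> Xs. Fs (u * d1 \<pi>) (v * d2 \<pi>))"
    by (metis norm_of_real abs_of_nonneg mult_nonneg_nonneg of_nat_0_le_iff zero_le_power2)
  also have "\<dots> \<le> (\<Sum>\<pi>\<in>Xs \<times> Xs. norm (Fs (u * d1 \<pi>) (v * d2 \<pi>)))" by (rule norm_sum)
  finally show ?thesis .
qed

lemma norm_Fs_le: "norm (Fs u v) \<le> real (nat p - 1)"
  unfolding Fs_def by (rule order.trans[OF norm_sum]) simp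

lemma rep_count_eq: "rep_count h1 h2 s1 s2 = card {\<pi> \<in> Xs \<times> Xs. [d1 \<pi> = s1] (mod p) \<and> [d2 \<pi> = s2] (mod p)}"
  unfolding rep_count_def by (rule arg_cong[where f = card]) auto

text \<open>Expansion and orthogonality: since a1 and a2 are units, s runs through all additive
  characters. The sum on the right is the additive energy, counted over exponents.\<close>

lemma sum_norm_Fs_power4:
  assumes a: "\<not> p dvd a1" "\<not> p dvd a2"
  shows "(\<Sum>s\<in>{0..<p} \<times> {0..<p}. norm (Fs (a1 * fst s) (a2 * snd s)) ^ 4)
    = (real_of_int p)\<^sup>2 * (\<Sum>\<pi>\<in>Xs \<times> Xs. real (rep_count h1 h2 (d1 \<pi>) (d2 \<pi>)))"
proof -
  let ?X2 = "Xs \<times> Xs"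
  have 4: "complex_of_real (norm (Fs u v) ^ 4)
      = (\<Sum>\<pi>\<in>?X2. \<Sum>\<rho>\<in>?X2. ex (u * (d1 \<rho> - d1 \<pi>) + v * (d2 \<rho> - d2 \<pi>)))" for u v
  proof -
    have "complex_of_real (norm (Fs u v) ^ 4) = complex_of_real ((norm (Fs u v))\<^sup>2) * cnj (complex_of_real ((norm (Fs u v))\<^sup>2))"
      by (simp add: power2_eq_square power4_eq_xxxx)
    also have "\<dots> = (\<Sum>\<rho>\<in>?X2. ex (u * d1 \<rho> + v * d2 \<rho>)) * (\<Sum>\<pi>\<in>?X2. ex (- (u * d1 \<pi> + v * d2 \<pi>)))"
      unfolding norm_Fs_square by (simp only: cnj_sum cnj_ex)
    also have "\<dots> = (\<Sum>\<pi>\<in>?X2. \<Sum>\<rho>\<in>?X2. ex (u * d1 \<rho> + v * d2 \<rho>) * ex (- (u * d1 \<pi> + v * d2 \<pi>)))"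
      unfolding sum_product by (rule sum.swap)
    also have "\<dots> = (\<Sum>\<pi>\<in>?X2. \<Sum>\<rho>\<in>?X2. ex (u * (d1 \<rho> - d1 \<pi>) + v * (d2 \<rho> - d2 \<pi>)))"
      by (intro sum.cong refl) (simp add: algebra_simps flip: ex_add)
    finally show ?thesis .
  qed
  have orth: "(\<Sum>s\<in>{0..<p} \<times> {0..<p}. ex (a1 * fst s * D1 + a2 * snd s * D2))
      = (if p dvd D1 \<and> p dvd D2 then (of_int p)\<^sup>2 else 0)" for D1 D2
  proof -
    have "(\<Sum>s\<in>{0..<p} \<times> {0..<p}. ex (a1 * fst s * D1 + a2 * snd s * D2))
        = (\<Sum>s\<in>{0..<p}. ex ((a1 * D1) * s)) * (\<Sum>s\<in>{0..<p}. ex ((a2 * D2) * s))"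
      by (simp add: sum_product sum.cartesian_product case_prod_beta ex_add mult_ac)
    also have "\<dots> = (if p dvd a1 * D1 then of_int p else 0) * (if p dvd a2 * D2 then of_int p else 0)"
      by (simp only: sum_ex)
    also have "\<dots> = (if p dvd D1 \<and> p dvd D2 then (of_int p)\<^sup>2 else 0)"
      using a prime_p by (simp add: prime_dvd_mult_iff power2_eq_square)
    finally show ?thesis .
  qed
  have "complex_of_real (\<Sum>s\<in>{0..<p} \<times> {0..<p}. norm (Fs (a1 * fst s) (a2 * snd s)) ^ 4)
      = (\<Sum>s\<in>{0..<p} \<times> {0..<p}. \<Sum>\<pi>\<in>?X2. \<Sum>\<rho>\<in>?X2. ex (a1 * fst s * (d1 \<rho> - d1 \<pi>) + a2 * snd s * (d2 \<rho> - d2 \<pi>)))"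
    by (simp only: of_real_sum 4)
  also have "\<dots> = (\<Sum>\<pi>\<in>?X2. \<Sum>\<rho>\<in>?X2. \<Sum>s\<in>{0..<p} \<times> {0..<p}. ex (a1 * fst s * (d1 \<rho> - d1 \<pi>) + a2 * snd s * (d2 \<rho> - d2 \<pi>)))"
    by (subst sum.swap) (intro sum.cong refl sum.swap)
  also have "\<dots> = (\<Sum>\<pi>\<in>?X2. \<Sum>\<rho>\<in>?X2. if p dvd d1 \<rho> - d1 \<pi> \<and> p dvd d2 \<rho> - d2 \<pi> then (of_int p)\<^sup>2 else 0)"
    by (simp only: orth)
  also have "\<dots> = (\<Sum>\<pi>\<in>?X2. of_nat (rep_count h1 h2 (d1 \<pi>) (d2 \<pi>)) * (of_int p)\<^sup>2)"
  proof (intro sum.cong refl)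
    fix \<pi>
    have "(\<Sum>\<rho>\<in>?X2. if p dvd d1 \<rho> - d1 \<pi> \<and> p dvd d2 \<rho> - d2 \<pi> then (of_int p)\<^sup>2 else (0::complex))
        = (\<Sum>\<rho>\<in>{\<rho> \<in> ?X2. p dvd d1 \<rho> - d1 \<pi> \<and> p dvd d2 \<rho> - d2 \<pi>}. (of_int p)\<^sup>2)"
      by (rule sum.inter_filter[symmetric]) simp
    also have "\<dots> = of_nat (rep_count h1 h2 (d1 \<pi>) (d2 \<pi>)) * (of_int p)\<^sup>2"
      by (simp add: rep_count_eq cong_iff_dvd_diff)
    finally show "(\<Sum>\<rho>\<in>?X2. if p dvd d1 \<rho> - d1 \<pi> \<and> p dvd d2 \<rho> - d2 \<pi> then (of_int p)\<^sup>2 else (0::complex))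
        = of_nat (rep_count h1 h2 (d1 \<pi>) (d2 \<pi>)) * (of_int p)\<^sup>2" .
  qed
  also have "\<dots> = complex_of_real ((real_of_int p)\<^sup>2 * (\<Sum>\<pi>\<in>?X2. real (rep_count h1 h2 (d1 \<pi>) (d2 \<pi>))))"
    by (simp add: sum_distrib_left mult_ac)
  finally show ?thesis by (simp only: of_real_eq_iff)
qed

text \<open>Hoelder's inequality with exponent 4 is applied to the average over pairs of exponents,
  which are then grouped by their difference s. A nonzero s occurs at most \<rho> times, so the
  fourth moment over all s takes over; s = 0 is estimated trivially and gives r0 p^4. The energy
  inside the moment is at most p^2 \<rho> + r0^2.\<close>

lemma norm_Fs_power8:
  fixes r0 \<rho> :: real
  assumes a: "\<not> p dvd a1" "\<not> p dvd a2" and r0: "real (rep_count h1 h2 0 0) \<le> r0"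
    and \<rho>: "\<And>s1 s2. \<not> (p dvd s1 \<and> p dvd s2) \<Longrightarrow> real (rep_count h1 h2 s1 s2) \<le> \<rho>"
  shows "norm (Fs a1 a2) ^ 8 \<le> (real_of_int p)\<^sup>2 * (r0 * real_of_int p ^ 4
     + \<rho> * (real_of_int p)\<^sup>2 * ((real_of_int p)\<^sup>2 * \<rho> + r0\<^sup>2))"
proof -
  let ?X2 = "Xs \<times> Xs"
  define N where "N = real (nat p - 1)"
  have N: "N > 0" "N \<le> real_of_int p" using p_gt_1 by (auto simp: N_def of_nat_diff)
  \<comment> \<open>The difference (1, 1) witnesses that \<rho> is nonnegative.\<close>
  have "\<not> (p dvd 1 \<and> p dvd 1)" using p_gt_1 by simp
  from order.trans[OF of_nat_0_le_iff r0] order.trans[OF of_nat_0_le_iff \<rho>[OF this]]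
  have pos: "r0 \<ge> 0" "\<rho> \<ge> 0" .
  have rz: "rep_count h1 h2 s1 s2 = rep_count h1 h2 0 0" if "p dvd s1" "p dvd s2" for s1 s2
    using that unfolding rep_count_def by (simp add: cong_def)
  have cX: "real (card ?X2) = N\<^sup>2" by (simp add: N_def card_cartesian_product power2_eq_square)
  let ?\<Phi> = "\<lambda>s. norm (Fs (a1 * fst s) (a2 * snd s)) ^ 4"
  define Q where "Q = (\<Sum>\<pi>\<in>?X2. real (rep_count h1 h2 (d1 \<pi>) (d2 \<pi>)))"
  have Q: "Q \<le> N\<^sup>2 * \<rho> + r0\<^sup>2"
  proof -
    let ?Z = "{\<pi> \<in> ?X2. [d1 \<pi> = 0] (mod p) \<and> [d2 \<pi> = 0] (mod p)}"
    have "Q \<le> (\<Sum>\<pi>\<in>?X2. \<rho> + (if [d1 \<pi> = 0] (mod p) \<and> [d2 \<pi> = 0] (mod p) then r0 else 0))"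
      unfolding Q_def
    proof (rule sum_mono)
      fix \<pi>
      show "real (rep_count h1 h2 (d1 \<pi>) (d2 \<pi>)) \<le> \<rho> + (if [d1 \<pi> = 0] (mod p) \<and> [d2 \<pi> = 0] (mod p) then r0 else 0)"
      proof (cases "p dvd d1 \<pi> \<and> p dvd d2 \<pi>")
        case True
        then have "rep_count h1 h2 (d1 \<pi>) (d2 \<pi>) = rep_count h1 h2 0 0" using rz by blast
        then show ?thesis using True r0 pos by (simp add: cong_0_iff)
      next
        case False
        then show ?thesis using \<rho>[OF False] by (auto simp: cong_0_iff)
      qed
    qed
    also have "\<dots> = N\<^sup>2 * \<rho> + real (rep_count h1 h2 0 0) * r0"
    proof -
      have "(\<Sum>\<pi>\<in>?X2. if [d1 \<pi> = 0] (mod p) \<and> [d2 \<pi> = 0] (mod p) then r0 else 0) = (\<Sum>\<pi>\<in>?Z. r0)"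
        by (rule sum.inter_filter[symmetric]) simp
      then show ?thesis unfolding sum.distrib by (simp add: cX rep_count_eq) (simp add: N_def power2_eq_square)
    qed
    also have "\<dots> \<le> N\<^sup>2 * \<rho> + r0\<^sup>2"
      using mult_right_mono[OF r0 pos(1)] by (simp add: power2_eq_square)
    finally show ?thesis .
  qed
  have "(N * (norm (Fs a1 a2))\<^sup>2) ^ 4 \<le> (\<Sum>\<pi>\<in>?X2. norm (Fs (a1 * d1 \<pi>) (a2 * d2 \<pi>))) ^ 4"
    using norm_Fs_le_average[of a1 a2] N by (intro power_mono) (simp_all add: N_def)
  also have "\<dots> \<le> (N\<^sup>2) ^ 3 * (\<Sum>\<pi>\<in>?X2. norm (Fs (a1 * d1 \<pi>) (a2 * d2 \<pi>)) ^ 4)"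
    unfolding cX[symmetric] by (rule sum_power4_le_card)
  also have "(\<Sum>\<pi>\<in>?X2. norm (Fs (a1 * d1 \<pi>) (a2 * d2 \<pi>)) ^ 4) = (\<Sum>\<pi>\<in>?X2. ?\<Phi> (d1 \<pi> mod p, d2 \<pi> mod p))"
    by (intro sum.cong refl arg_cong[where f = "\<lambda>z. norm z ^ 4"] Fs_cong)
       (simp_all add: cong_def mod_mult_right_eq)
  also have "\<dots> = (\<Sum>s\<in>{0..<p} \<times> {0..<p}. \<Sum>\<pi>\<in>{\<pi> \<in> ?X2. (d1 \<pi> mod p, d2 \<pi> mod p) = s}. ?\<Phi> (d1 \<pi> mod p, d2 \<pi> mod p))"
    by (rule sum.group[symmetric]) (use p_gt_1 in auto)
  also have "\<dots> = (\<Sum>s\<in>{0..<p} \<times> {0..<p}. real (rep_count h1 h2 (fst s) (snd s)) * ?\<Phi> s)"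
  proof (rule sum.cong[OF refl])
    fix s assume s: "s \<in> {0..<p} \<times> {0..<p}"
    have seteq: "{\<pi> \<in> ?X2. (d1 \<pi> mod p, d2 \<pi> mod p) = s} = {\<pi> \<in> ?X2. [d1 \<pi> = fst s] (mod p) \<and> [d2 \<pi> = snd s] (mod p)}"
      using s by (auto simp: cong_def)
    have "(\<Sum>\<pi>\<in>{\<pi> \<in> ?X2. (d1 \<pi> mod p, d2 \<pi> mod p) = s}. ?\<Phi> (d1 \<pi> mod p, d2 \<pi> mod p))
        = (\<Sum>\<pi>\<in>{\<pi> \<in> ?X2. (d1 \<pi> mod p, d2 \<pi> mod p) = s}. ?\<Phi> s)" by (rule sum.cong) auto
    also have "\<dots> = real (card {\<pi> \<in> ?X2. (d1 \<pi> mod p, d2 \<pi> mod p) = s}) * ?\<Phi> s" by simp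
    also have "\<dots> = real (rep_count h1 h2 (fst s) (snd s)) * ?\<Phi> s"
      by (simp only: rep_count_eq seteq)
    finally show "(\<Sum>\<pi>\<in>{\<pi> \<in> ?X2. (d1 \<pi> mod p, d2 \<pi> mod p) = s}. ?\<Phi> (d1 \<pi> mod p, d2 \<pi> mod p))
        = real (rep_count h1 h2 (fst s) (snd s)) * ?\<Phi> s" .
  qed
  also have "\<dots> \<le> (\<Sum>s\<in>{0..<p} \<times> {0..<p}. \<rho> * ?\<Phi> s + (if s = (0, 0) then r0 * N ^ 4 else 0))"
  proof (rule sum_mono)
    fix s assume s: "s \<in> {0..<p} \<times> {0..<p}"
    show "real (rep_count h1 h2 (fst s) (snd s)) * ?\<Phi> s \<le> \<rho> * ?\<Phi> s + (if s = (0, 0) then r0 * N ^ 4 else 0)"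
    proof (cases "s = (0, 0)")
      case True
      have "real (rep_count h1 h2 0 0) * ?\<Phi> (0, 0) \<le> r0 * N ^ 4"
        using r0 pos norm_Fs_le by (intro mult_mono power_mono) (simp_all add: N_def)
      moreover have "\<rho> * ?\<Phi> (0, 0) \<ge> 0" using pos by simp
      ultimately show ?thesis unfolding True by simp
    next
      case False
      have "\<not> (p dvd fst s \<and> p dvd snd s)"
        using False s zdvd_not_zless[of "fst s" p] zdvd_not_zless[of "snd s" p]
        by (cases s) (auto simp: order.order_iff_strict)
      from mult_right_mono[OF \<rho>[OF this], of "?\<Phi> s"] show ?thesis using False by simp
    qed
  qed
  also have "\<dots> = \<rho> * (\<Sum>s\<in>{0..<p} \<times> {0..<p}. ?\<Phi> s) + r0 * N ^ 4"
    using p_gt_1 by (simp add: sum.distrib sum_distrib_left)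
  also have "(\<Sum>s\<in>{0..<p} \<times> {0..<p}. ?\<Phi> s) = (real_of_int p)\<^sup>2 * Q"
    unfolding Q_def by (rule sum_norm_Fs_power4[OF a])
  finally have "(N * (norm (Fs a1 a2))\<^sup>2) ^ 4 \<le> (N\<^sup>2) ^ 3 * (\<rho> * ((real_of_int p)\<^sup>2 * Q) + r0 * N ^ 4)"
    by (simp add: mult_left_mono)
  moreover have "(N * (norm (Fs a1 a2))\<^sup>2) ^ 4 = N ^ 4 * norm (Fs a1 a2) ^ 8"
    by (simp add: power_mult_distrib flip: power_mult)
  moreover have "(N\<^sup>2) ^ 3 = N ^ 4 * N\<^sup>2" by (simp flip: power_mult power_add)
  ultimately have "N ^ 4 * norm (Fs a1 a2) ^ 8 \<le> N ^ 4 * (N\<^sup>2 * (\<rho> * ((real_of_int p)\<^sup>2 * Q) + r0 * N ^ 4))"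
    by (simp only: mult.assoc)
  then have "norm (Fs a1 a2) ^ 8 \<le> N\<^sup>2 * (\<rho> * ((real_of_int p)\<^sup>2 * Q) + r0 * N ^ 4)"
    by (rule mult_left_le_imp_le) (use N in simp)
  also have "\<dots> \<le> (real_of_int p)\<^sup>2 * (\<rho> * ((real_of_int p)\<^sup>2 * ((real_of_int p)\<^sup>2 * \<rho> + r0\<^sup>2)) + r0 * real_of_int p ^ 4)"
  proof (intro mult_mono add_mono power_mono mult_left_mono)
    have "N\<^sup>2 * \<rho> \<le> (real_of_int p)\<^sup>2 * \<rho>" using N pos by (intro mult_right_mono power_mono) auto
    then show "Q \<le> (real_of_int p)\<^sup>2 * \<rho> + r0\<^sup>2" using Q by linarith
  qed (use N pos in \<open>auto simp: Q_def intro!: add_nonneg_nonneg mult_nonneg_nonneg sum_nonneg\<close>)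
  finally show ?thesis by (simp add: algebra_simps)
qed

end

end

section \<open>The bound for a single pair of bases\<close>

lemma stepanov_bound_arith:
  fixes t :: real
  assumes t: "t \<ge> 1" and s0: "0 \<le> s0" "s0\<^sup>2 \<le> t" and B: "t powr (3/23) \<le> B" "B \<le> 2 * t powr (3/23)"
    and F0: "t powr (3/23) \<le> F0"
  shows "t / B + 2 * s0 + 128 * s0 * sqrt (s0 * B) + 32 * s0 * B + t / F0 \<le> 250 * t powr (20/23)"
proof -
  have pos: "t powr (3/23) > 0" using t by simp
  have s0': "s0 \<le> t powr (1/2)" using s0 t by (simp add: powr_half_sqrt real_le_rsqrt)
  have mono: "t powr x \<le> t powr y" if "x \<le> y" for x y using that t by (intro powr_mono) auto
  \<comment> \<open>The lower bound t^(3/23) for B and F0 is what brings t/B and t/F0 down to the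
    target t^(20/23). The Stepanov term s0 (s0 B)^(1/2) is then O(t^(75/92)), below
    t^(80/92).\<close>
  have 1: "t / X \<le> t powr (20/23)" if "t powr (3/23) \<le> X" for X
  proof -
    have "t / X \<le> t / t powr (3/23)" using that pos t by (intro divide_left_mono mult_pos_pos) linarith+
    also have "\<dots> = t powr 1 / t powr (3/23)" using t by simp
    also have "\<dots> = t powr (20/23)" by (subst powr_diff[symmetric]) simp
    finally show ?thesis .
  qed
  have 2: "s0 \<le> t powr (20/23)" using s0' mono[of "1/2" "20/23"] by linarith
  have B0: "B \<ge> 0" using B(1) pos by linarith
  have 3: "s0 * B \<le> t powr (1/2) * (2 * t powr (3/23))"
    using s0 s0' B B0 by (intro mult_mono) auto
  have e3: "t powr (1/2) * (2 * t powr (3/23)) = 2 * t powr (29/46)" by (simp add: powr_add[symmetric])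
  have 4: "s0 * B \<le> 2 * t powr (20/23)" using 3 e3 mono[of "29/46" "20/23"] by linarith
  have "sqrt (s0 * B) \<le> sqrt (2 * t powr (29/46))" using 3 e3 by simp
  also have "\<dots> = sqrt 2 * t powr (29/92)"
    by (simp add: real_sqrt_mult powr_half_sqrt[symmetric] powr_powr)
  \<comment> \<open>This rational bound for the square root of 2 is sharp enough for the total 1 + 2
    + 128 * 71/50 + 64 + 1 = 249.76 to stay below 250.\<close>
  also have "\<dots> \<le> (71/50) * t powr (29/92)"
  proof (rule mult_right_mono)
    show "sqrt 2 \<le> (71/50 :: real)" by (rule real_le_lsqrt) (simp_all add: power2_eq_square)
  qed simp
  finally have "s0 * sqrt (s0 * B) \<le> t powr (1/2) * ((71/50) * t powr (29/92))"
    using s0 s0' B0 by (intro mult_mono) auto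
  also have "\<dots> = (71/50) * t powr (75/92)" by (simp add: powr_add[symmetric])
  also have "\<dots> \<le> (71/50) * t powr (20/23)" using mono[of "75/92" "20/23"] by simp
  finally have 5: "s0 * sqrt (s0 * B) \<le> (71/50) * t powr (20/23)" .
  show ?thesis using 1[OF B(1)] 1[OF F0] 2 4 5 powr_ge_zero[of t "20/23"]
    unfolding mult.assoc by linarith
qed

text \<open>The main term is q^6 r^2 = 250^2 T with T = q^(178/23) \<delta>^(52/23), whose eighth
  root carries the exponents 89/92 and 13/46. The other terms add at most T and 250 T, and 250^2 +
  250 + 1 < 4^8 yields the constant 4.\<close>

lemma moment_bound_arith:
  fixes q t \<delta> r :: real
  assumes q: "q \<ge> 1" and t: "t \<ge> 1" and \<delta>: "\<delta> = q / t" "\<delta> \<ge> 1" and r: "r = 250 * \<delta>\<^sup>2 * t powr (20/23)"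
  shows "q\<^sup>2 * ((q * \<delta>) * q ^ 4 + r * q\<^sup>2 * (q\<^sup>2 * r + (q * \<delta>)\<^sup>2)) \<le> (4 * (q powr (89/92) * \<delta> powr (13/46))) ^ 8"
proof -
  have pos: "q > 0" "\<delta> > 0" "t > 0" using q \<delta> t by auto
  define T where "T = q powr (178/23) * \<delta> powr (52/23)"
  have T: "(q powr (89/92) * \<delta> powr (13/46)) ^ 8 = T"
    using pos by (simp add: T_def power_mult_distrib powr_powr flip: powr_realpow)
  have t': "t = q / \<delta>" using \<delta> pos by simp
  have tp: "t powr (20/23) = q powr (20/23) * \<delta> powr (- (20/23))"
    unfolding t' using pos by (simp add: powr_divide powr_minus divide_simps)
  have sq: "(x powr c)\<^sup>2 = x powr (2 * c)" for x c :: real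
    by (simp add: power2_eq_square powr_add[symmetric])
  have pw: "q ^ n = q powr real n" "\<delta> ^ n = \<delta> powr real n" for n using pos by (simp_all add: powr_realpow)
  have r': "r = 250 * (q powr (20/23) * \<delta> powr (26/23))"
  proof -
    have "\<delta>\<^sup>2 * \<delta> powr (- (20/23)) = \<delta> powr (26/23)" by (simp add: pw powr_add[symmetric] del: powr_numeral)
    then show ?thesis unfolding r tp by (simp add: mult_ac)
  qed
  have A: "q\<^sup>2 * ((q * \<delta>) * q ^ 4) \<le> T"
  proof -
    have "q\<^sup>2 * ((q * \<delta>) * q ^ 4) = q ^ 7 * \<delta> ^ 1" by (simp add: power_numeral_reduce)
    also have "\<dots> = q powr 7 * \<delta> powr 1" by (simp only: pw) simp
    also have "\<dots> \<le> T" unfolding T_def using q \<delta> by (intro mult_mono powr_mono) auto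
    finally show ?thesis .
  qed
  have Bq: "q\<^sup>2 * (r * q\<^sup>2 * (q\<^sup>2 * r)) = 62500 * T"
  proof -
    have "q\<^sup>2 * (r * q\<^sup>2 * (q\<^sup>2 * r)) = q ^ 6 * r\<^sup>2" by (simp add: power_numeral_reduce)
    also have "r\<^sup>2 = 62500 * (q powr (40/23) * \<delta> powr (52/23))"
      unfolding r' by (simp add: power_mult_distrib sq)
    also have "q ^ 6 * (62500 * (q powr (40/23) * \<delta> powr (52/23))) = 62500 * ((q ^ 6 * q powr (40/23)) * \<delta> powr (52/23))" by simp
    also have "q ^ 6 * q powr (40/23) = q powr (178/23)" by (simp add: pw powr_add[symmetric] del: powr_numeral)
    finally show ?thesis by (simp add: T_def)
  qed
  have Cq: "q\<^sup>2 * (r * q\<^sup>2 * (q * \<delta>)\<^sup>2) \<le> 250 * T"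
  proof -
    have "q\<^sup>2 * (r * q\<^sup>2 * (q * \<delta>)\<^sup>2) = q ^ 6 * \<delta>\<^sup>2 * r" by (simp add: power_numeral_reduce power_mult_distrib)
    also have "\<dots> = 250 * ((q ^ 6 * q powr (20/23)) * (\<delta>\<^sup>2 * \<delta> powr (26/23)))" unfolding r' by simp
    also have "q ^ 6 * q powr (20/23) = q powr (158/23)" by (simp add: pw powr_add[symmetric] del: powr_numeral)
    also have "\<delta>\<^sup>2 * \<delta> powr (26/23) = \<delta> powr (72/23)" by (simp add: pw powr_add[symmetric] del: powr_numeral)
    also have "\<delta> powr (72/23) = \<delta> powr (52/23) * \<delta> powr (20/23)" by (simp add: powr_add[symmetric])
    also have "\<delta> powr (20/23) \<le> q powr (20/23)"
      using \<delta> t pos by (intro powr_mono2) (simp_all add: divide_le_eq mult_le_cancel_left1)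
    then have "250 * (q powr (158/23) * (\<delta> powr (52/23) * \<delta> powr (20/23))) \<le> 250 * (q powr (158/23) * (\<delta> powr (52/23) * q powr (20/23)))"
      by (intro mult_left_mono) auto
    also have "\<dots> = 250 * T"
      unfolding T_def by (simp add: mult_ac powr_add[symmetric])
    finally show ?thesis .
  qed
  have "q\<^sup>2 * ((q * \<delta>) * q ^ 4 + r * q\<^sup>2 * (q\<^sup>2 * r + (q * \<delta>)\<^sup>2))
      = q\<^sup>2 * ((q * \<delta>) * q ^ 4) + q\<^sup>2 * (r * q\<^sup>2 * (q\<^sup>2 * r)) + q\<^sup>2 * (r * q\<^sup>2 * (q * \<delta>)\<^sup>2)"
    by (simp only: distrib_left add.assoc)
  also have "\<dots> \<le> T + 62500 * T + 250 * T" using A Bq Cq by linarith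
  also have "\<dots> \<le> 65536 * T" by (simp add: T_def)
  also have "\<dots> = (4 * (q powr (89/92) * \<delta> powr (13/46))) ^ 8" unfolding power_mult_distrib[of 4] T by simp
  finally show ?thesis .
qed

lemma pointwise_bound:
  fixes q h1 h2 a1 a2 t :: nat
  assumes q: "prime q" and h: "h1 \<in> {1..q - 1}" "h2 \<in> {1..q - 1}" and a: "a1 \<in> {1..q - 1}" "a2 \<in> {1..q - 1}"
    and ord: "real (ord q h1) \<ge> real q powr (10/13)" "real (ord q h2) \<ge> real q powr (10/13)"
    and F: "\<And>f. f dvd q - 1 \<Longrightarrow> [h1 ^ f = h2 ^ f] (mod q) \<Longrightarrow> real f \<ge> real q powr (3/23)"
    and t: "t = lcm (ord q h1) (ord q h2)"
  shows "norm (S (a1, a2) (h1, h2) q) \<le> 4 * (real q powr (89/92) * (real q / real t) powr (13/46))"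
proof -
  interpret prime_modulus "int q" using q by unfold_locales simp
  have q1: "q > 1" using q prime_gt_1_nat by blast
  have unit: "\<not> int q dvd int x" if "x \<in> {1..q - 1}" for x
    using that by (auto simp del: of_nat_dvd_iff dest!: zdvd_imp_le simp: int_dvd_int_iff dest: dvd_imp_le)
  note hu = unit[OF h(1)] unit[OF h(2)] and au = unit[OF a(1)] unit[OF a(2)]
  define o1 o2 where "o1 = ord q h1" and "o2 = ord q h2"
  have o: "[int h1 ^ m = 1] (mod int q) \<longleftrightarrow> o1 dvd m" "[int h2 ^ m = 1] (mod int q) \<longleftrightarrow> o2 dvd m" for m
    using ord_divides[of h1 m q] ord_divides[of h2 m q] cong_int_iff[of "h1 ^ m" 1 q] cong_int_iff[of "h2 ^ m" 1 q]
    by (simp_all add: o1_def o2_def)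
  have tm: "[int h1 ^ m = 1] (mod int q) \<and> [int h2 ^ m = 1] (mod int q) \<longleftrightarrow> t dvd m" for m
    unfolding o t by (simp add: o1_def o2_def lcm_least_iff)
  have "t dvd q - 1" using fermat[OF hu(1)] fermat[OF hu(2)] tm[of "q - 1"] by simp
  then obtain d where d: "d * t = q - 1" by (metis dvdE mult.commute)
  have tpos: "t > 0" using d q1 by (intro Nat.gr0I) auto
  have tq: "t < q" using \<open>t dvd q - 1\<close> q1 by (auto dest!: dvd_imp_le)
  obtain u1 u2 where u: "o1 * u1 = t" "o2 * u2 = t" using t o1_def o2_def by (metis dvdE dvd_lcm1 dvd_lcm2)
  define s0 where "s0 = floor_sqrt t"
  have s0: "s0\<^sup>2 \<le> t" "t < (s0 + 1)\<^sup>2" unfolding s0_def using Suc_floor_sqrt_power2_gt[of t] by auto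
  define B where "B = nat \<lceil>real t powr (3/23)\<rceil>"
  define F0 where "F0 = nat \<lceil>real q powr (3/23)\<rceil>"
  have t1: "real t \<ge> 1" "real q \<ge> 1" using tpos q1 by auto
  have tp: "real t powr (3/23) \<ge> 1" using t1 by (simp add: ge_one_powr_ge_zero)
  have B: "real t powr (3/23) \<le> real B" "real B \<le> 2 * real t powr (3/23)" "B > 0"
  proof -
    show "real t powr (3/23) \<le> real B" unfolding B_def by (rule real_nat_ceiling_ge)
    then show "B > 0" using tp by (intro Nat.gr0I) auto
    have "real B \<le> real t powr (3/23) + 1" unfolding B_def using tp by linarith
    then show "real B \<le> 2 * real t powr (3/23)" using tp by linarith
  qed
  have F0: "real t powr (3/23) \<le> real F0" "F0 > 0"
  proof -
    have "real t powr (3/23) \<le> real q powr (3/23)" using tq by (intro powr_mono2) auto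
    also have "\<dots> \<le> real F0" unfolding F0_def by (rule real_nat_ceiling_ge)
    finally show "real t powr (3/23) \<le> real F0" .
    then show "F0 > 0" using tp by (intro Nat.gr0I) auto
  qed
  have F0': "F0 \<le> f" if "f dvd t" "[int h1 ^ f = int h2 ^ f] (mod int q)" for f
  proof -
    have "[h1 ^ f = h2 ^ f] (mod q)" using that(2) cong_int_iff[of "h1 ^ f" "h2 ^ f" q] by simp
    from F[OF dvd_trans[OF that(1) \<open>t dvd q - 1\<close>] this] show ?thesis unfolding F0_def by (simp add: nat_le_iff ceiling_le_iff)
  qed
  have small: "\<not> w dvd m" if "real w \<ge> real q powr (10/13)" "0 < m" "m \<le> s0" for w m
  proof
    assume "w dvd m"
    then have "w \<le> s0" using that by (auto dest!: dvd_imp_le)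
    then have "real q powr (10/13) \<le> real s0" using that(1) by linarith
    moreover have "real s0 \<le> sqrt (real t)" using s0(1) by (intro real_le_rsqrt) (metis of_nat_le_iff of_nat_power)
    moreover have "sqrt (real t) \<le> real q powr (1/2)" using tq t1 by (simp add: powr_half_sqrt)
    moreover have "real q powr (1/2) < real q powr (10/13)" using q1 by (intro powr_less_mono) auto
    ultimately show False by linarith
  qed
  have D: "real (card (diff_set (int h1) (int h2) s1 s2 t)) \<le> 250 * real t powr (20/23)"
    if "\<not> (int q dvd s1 \<and> int q dvd s2)" for s1 s2
  proof -
    \<comment> \<open>Each index is at most q / q^(10/13) = q^(3/13), and q^(6/13) =
      (q^(10/13))^(3/5) \<le> t^(3/5), which is within t^(20/23).\<close>
    have uu: "real (u1 * u2) \<le> 250 * real t powr (20/23)"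
    proof -
      have ub: "real u \<le> real q powr (3/13)" if "w * u = t" "real w \<ge> real q powr (10/13)" for w u
      proof -
        have "real q powr (10/13) * real u \<le> real w * real u" using that(2) by (intro mult_right_mono) auto
        also have "\<dots> = real t" using that(1) by (simp flip: of_nat_mult)
        also have "\<dots> \<le> real q powr 1" using tq by simp
        also have "\<dots> = real q powr (10/13) * real q powr (3/13)" by (simp add: powr_add[symmetric])
        finally show ?thesis using q1 by simp
      qed
      have "real (u1 * u2) \<le> real q powr (3/13) * real q powr (3/13)"
        unfolding of_nat_mult using ub[OF u(1)] ub[OF u(2)] ord by (intro mult_mono) (auto simp: o1_def o2_def)
      also have "\<dots> = (real q powr (10/13)) powr (3/5)" by (simp add: powr_add[symmetric] powr_powr)
      also have "\<dots> \<le> real t powr (3/5)"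
      proof (rule powr_mono2)
        have "o1 \<le> t" using u(1) tpos by (metis dvd_imp_le dvd_triv_left)
        then show "real q powr (10/13) \<le> real t" using ord(1) unfolding o1_def by linarith
      qed auto
      also have "\<dots> \<le> real t powr (20/23)" using t1 by (intro powr_mono) auto
      also have "\<dots> \<le> 250 * real t powr (20/23)" by simp
      finally show ?thesis .
    qed
    consider "\<not> int q dvd s1" "\<not> int q dvd s2" | "int q dvd s1" "\<not> int q dvd s2" | "\<not> int q dvd s1" "int q dvd s2"
      using \<open>\<not> (int q dvd s1 \<and> int q dvd s2)\<close> by blast
    then show ?thesis
    proof cases
      case 1
      have "real (card (diff_set (int h1) (int h2) s1 s2 t)) \<le> real t / real B + 2 * real s0
          + 128 * real s0 * sqrt (real s0 * real B) + 32 * real s0 * real B + real t / real F0"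
      proof (rule card_diff_set_units[OF hu 1 tm tpos _ s0 B(3) _ _ F0' F0(2)])
        show "int t < int q" using tq by simp
        show "\<not> [int h1 ^ m = 1] (mod int q)" if "0 < m" "m \<le> s0" for m
          unfolding o using small[OF _ that] ord by (simp add: o1_def)
        show "\<not> [int h2 ^ m = 1] (mod int q)" if "0 < m" "m \<le> s0" for m
          unfolding o using small[OF _ that] ord by (simp add: o2_def)
      qed
      also have "\<dots> \<le> 250 * real t powr (20/23)"
      proof (rule stepanov_bound_arith[OF t1(1) _ _ B(1,2) F0(1)])
        show "(real s0)\<^sup>2 \<le> real t" using s0(1) by (metis of_nat_le_iff of_nat_power)
      qed simp
      finally show ?thesis .
    next
      case 2
      have "card (diff_set (int h1) (int h2) s1 s2 t) \<le> u1 * u2"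
        by (rule card_diff_set_zero[OF hu _ 2(2) o tpos u]) (use 2 in \<open>simp add: cong_0_iff\<close>)
      then show ?thesis using uu by linarith
    next
      case 3
      have "card (diff_set (int h2) (int h1) s2 s1 t) \<le> u2 * u1"
        by (rule card_diff_set_zero[OF hu(2,1) _ 3(1) o(2,1) tpos u(2,1)]) (use 3 in \<open>simp add: cong_0_iff\<close>)
      then have "real (card (diff_set (int h2) (int h1) s2 s1 t)) \<le> real (u1 * u2)"
        by (simp only: of_nat_le_iff mult.commute)
      then show ?thesis using uu unfolding diff_set_commute[of "int h1"] by linarith
    qed
  qed
  define \<delta> where "\<delta> = real q / real t"
  have d\<delta>: "real d \<le> \<delta>"
  proof -
    have "real d * real t = real (q - 1)" using d by (metis of_nat_mult)
    also have "\<dots> \<le> real q" by simp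
    finally show ?thesis using tpos by (simp add: \<delta>_def pos_le_divide_eq)
  qed
  have \<delta>1: "\<delta> \<ge> 1" using tq tpos by (simp add: \<delta>_def)
  define r where "r = 250 * \<delta>\<^sup>2 * real t powr (20/23)"
  have d': "d * t = nat (int q) - 1" using d by simp
  have r0: "real (rep_count (int h1) (int h2) 0 0) \<le> real q * \<delta>"
  proof -
    have "rep_count (int h1) (int h2) 0 0 \<le> (nat (int q) - 1) * d" by (rule rep_count_zero_le[OF hu tm d'])
    then have "real (rep_count (int h1) (int h2) 0 0) \<le> real ((q - 1) * d)" by (simp del: of_nat_mult)
    also have "\<dots> \<le> real q * \<delta>" unfolding of_nat_mult using d\<delta> by (intro mult_mono) auto
    finally show ?thesis .
  qed
  have rr: "real (rep_count (int h1) (int h2) s1 s2) \<le> r" if "\<not> (int q dvd s1 \<and> int q dvd s2)" for s1 s2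
  proof -
    have "rep_count (int h1) (int h2) s1 s2 \<le> d\<^sup>2 * card (diff_set (int h1) (int h2) s1 s2 t)"
      by (rule rep_count_le[OF hu tm d'])
    then have "real (rep_count (int h1) (int h2) s1 s2) \<le> (real d)\<^sup>2 * real (card (diff_set (int h1) (int h2) s1 s2 t))"
      by (metis of_nat_le_iff of_nat_mult of_nat_power)
    also have "\<dots> \<le> \<delta>\<^sup>2 * (250 * real t powr (20/23))"
      using d\<delta> D[OF that] by (intro mult_mono power_mono) auto
    finally show ?thesis by (simp add: r_def)
  qed
  have "norm (Fs (int h1) (int h2) (int a1) (int a2)) ^ 8
      \<le> (real q)\<^sup>2 * ((real q * \<delta>) * real q ^ 4 + r * (real q)\<^sup>2 * ((real q)\<^sup>2 * r + (real q * \<delta>)\<^sup>2))"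
    using norm_Fs_power8[OF hu au r0 rr] by simp
  also have "\<dots> \<le> (4 * (real q powr (89/92) * \<delta> powr (13/46))) ^ 8"
    by (rule moment_bound_arith[OF t1(2,1) \<delta>_def \<delta>1 r_def])
  finally have "norm (Fs (int h1) (int h2) (int a1) (int a2)) \<le> 4 * (real q powr (89/92) * \<delta> powr (13/46))"
    by (rule power_le_imp_le_base[where n = 7, simplified]) simp
  moreover have "S (a1, a2) (h1, h2) q = Fs (int h1) (int h2) (int a1) (int a2)"
  proof -
    have "e_p q z = ex (int z)" for z
      by (simp add: e_p_def ex_def cis_conv_exp mult_ac)
    then show ?thesis unfolding S_def Fs_def[OF hu] by simp
  qed
  ultimately show ?thesis by (simp add: \<delta>_def)
qed

section \<open>Small subgroups meet intervals rarely\<close>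

lemma card_divisors_prime_power_mult:
  fixes r m :: nat
  assumes "prime r" "m > 0"
  shows "card {d. d dvd r ^ a * m} \<le> (a + 1) * card {d. d dvd m}"
proof -
  have "{d. d dvd r ^ a * m} \<subseteq> (\<lambda>(i, d). r ^ i * d) ` ({..a} \<times> {d. d dvd m})"
  proof
    fix d assume "d \<in> {d. d dvd r ^ a * m}"
    then obtain b c where bc: "d = b * c" "b dvd r ^ a" "c dvd m" using division_decomp by blast
    from bc(2) obtain i where "i \<le> a" "b = r ^ i" using divides_primepow_nat[OF assms(1)] by blast
    then show "d \<in> (\<lambda>(i, d). r ^ i * d) ` ({..a} \<times> {d. d dvd m})" using bc by force
  qed
  then have "card {d. d dvd r ^ a * m} \<le> card ((\<lambda>(i, d). r ^ i * d) ` ({..a} \<times> {d. d dvd m}))"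
    using assms(2) by (intro card_mono) simp_all
  also have "\<dots> \<le> card ({..a} \<times> {d. d dvd m})" using assms(2) by (intro card_image_le) simp
  finally show ?thesis by (simp add: card_cartesian_product)
qed

text \<open>A prime power r^a exactly dividing m contributes a factor a + 1 to the number of
  divisors. If r^\<epsilon> \<ge> 2, then a + 1 \<le> 2^a \<le> r^(\<epsilon> a) costs nothing; each
  of the at most Q smaller primes costs one factor K.\<close>

lemma divisor_bound:
  fixes \<epsilon> :: real
  assumes \<epsilon>: "\<epsilon> > 0"
  shows "\<exists>C\<ge>1. \<forall>m::nat. m > 0 \<longrightarrow> real (card {d. d dvd m}) \<le> C * real m powr \<epsilon>"
proof -
  define Q where "Q = nat \<lceil>2 powr (1 / \<epsilon>)\<rceil>"
  \<comment> \<open>Chosen so that 1 + a \<le> K (1 + \<epsilon> a ln 2) for all a, while 1 +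
    \<epsilon> a ln 2 \<le> 2^(\<epsilon> a).\<close>
  define K where "K = 1 + 1 / (\<epsilon> * ln 2)"
  have K: "K \<ge> 1" using \<epsilon> by (simp add: K_def)
  let ?P = "\<lambda>m. {r. prime r \<and> r < Q \<and> r dvd m}"
  have small: "real (a + 1) \<le> K * real r powr (\<epsilon> * real a)" if "prime r" for r a :: nat
  proof -
    have "real (a + 1) \<le> K * (1 + \<epsilon> * real a * ln 2)"
      using \<epsilon> by (simp add: K_def field_simps)
    also have "1 + \<epsilon> * real a * ln 2 \<le> exp (\<epsilon> * real a * ln 2)" by (rule exp_ge_add_one_self)
    also have "\<dots> = 2 powr (\<epsilon> * real a)" by (simp add: powr_def)
    also have "2 powr (\<epsilon> * real a) \<le> real r powr (\<epsilon> * real a)"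
      using prime_ge_2_nat[OF that] \<epsilon> by (intro powr_mono2) auto
    finally show ?thesis using K by (simp add: mult_left_mono)
  qed
  have large: "real (a + 1) \<le> real r powr (\<epsilon> * real a)" if "r \<ge> Q" for r a :: nat
  proof -
    have "2 powr (1 / \<epsilon>) \<le> real Q" unfolding Q_def by (rule real_nat_ceiling_ge)
    then have r: "2 powr (1 / \<epsilon>) \<le> real r" using that by linarith
    have "real (a + 1) \<le> 2 ^ a" by (induction a) auto
    also have "\<dots> = (2 powr (1 / \<epsilon>)) powr (\<epsilon> * real a)" using \<epsilon> by (simp add: powr_powr powr_realpow)
    also have "\<dots> \<le> real r powr (\<epsilon> * real a)" using r \<epsilon> by (intro powr_mono2) auto
    finally show ?thesis .
  qed
  have main: "real (card {d. d dvd m}) \<le> K ^ card (?P m) * real m powr \<epsilon>" if "m > 0" for m :: nat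
    using that
  proof (induction m rule: less_induct)
    case (less m)
    show ?case
    proof (cases "m = 1")
      case True
      then show ?thesis using K by simp
    next
      case False
      then obtain r where r: "prime r" "r dvd m" using prime_factor_nat by blast
      define a where "a = multiplicity r m"
      obtain m' where m': "m = r ^ a * m'" "\<not> r dvd m'"
        using multiplicity_decompose'[of m r] less.prems r(1) unfolding a_def by (metis not_prime_unit neq0_conv)
      have a: "a > 0" using r less.prems by (simp add: a_def prime_multiplicity_gt_zero_iff)
      have m'0: "m' > 0" using m' less.prems by (intro Nat.gr0I) auto
      have "r ^ a > 1" using prime_gt_1_nat[OF r(1)] a by (rule one_less_power)
      then have lt: "m' < m" using m'(1) m'0 by simp
      note IH = less.IH[OF lt m'0]
      have fin: "finite (?P x)" for x by (rule finite_subset[of _ "{..<Q}"]) auto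
      have "real (card {d. d dvd m}) \<le> real (a + 1) * real (card {d. d dvd m'})"
        using card_divisors_prime_power_mult[OF r(1) m'0, of a] unfolding m'(1)
        by (metis of_nat_le_iff of_nat_mult)
      also have "\<dots> \<le> real (a + 1) * (K ^ card (?P m') * real m' powr \<epsilon>)" using IH by (intro mult_left_mono) auto
      also have "\<dots> \<le> (K ^ card (?P m) * real r powr (\<epsilon> * real a)) * real m' powr \<epsilon>"
      proof (cases "r < Q")
        case True
        have "insert r (?P m') \<subseteq> ?P m" using True r m'(1) by auto
        then have "card (insert r (?P m')) \<le> card (?P m)" by (intro card_mono fin)
        then have c: "Suc (card (?P m')) \<le> card (?P m)" using m'(2) fin by simp
        have "K ^ Suc (card (?P m')) \<le> K ^ card (?P m)" using c K by (rule power_increasing)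
        then have le: "K ^ Suc (card (?P m')) * real r powr (\<epsilon> * real a) \<le> K ^ card (?P m) * real r powr (\<epsilon> * real a)"
          by (rule mult_right_mono) simp
        have "real (a + 1) * K ^ card (?P m') \<le> (K * real r powr (\<epsilon> * real a)) * K ^ card (?P m')"
          using small[OF r(1), of a] K by (intro mult_right_mono) auto
        also have "\<dots> = K ^ Suc (card (?P m')) * real r powr (\<epsilon> * real a)" by simp
        also note le
        finally have "real (a + 1) * K ^ card (?P m') \<le> K ^ card (?P m) * real r powr (\<epsilon> * real a)" .
        from mult_right_mono[OF this, of "real m' powr \<epsilon>"] show ?thesis by (simp add: mult_ac)
      next
        case False
        have "card (?P m') \<le> card (?P m)" using m'(1) by (intro card_mono fin) auto
        then have "K ^ card (?P m') \<le> K ^ card (?P m)" using K by (rule power_increasing)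
        then have "real (a + 1) * K ^ card (?P m') \<le> real r powr (\<epsilon> * real a) * K ^ card (?P m)"
          using large[of r a] False K by (intro mult_mono) auto
        from mult_right_mono[OF this, of "real m' powr \<epsilon>"] show ?thesis by (simp add: mult_ac)
      qed
      also have "\<dots> = K ^ card (?P m) * real m powr \<epsilon>"
      proof -
        have "real m powr \<epsilon> = (real r ^ a) powr \<epsilon> * real m' powr \<epsilon>" unfolding m'(1) by (simp add: powr_mult)
        also have "(real r ^ a) powr \<epsilon> = real r powr (\<epsilon> * real a)"
          using prime_gt_0_nat[OF r(1)] by (simp add: powr_powr mult.commute flip: powr_realpow)
        finally show ?thesis by simp
      qed
      finally show ?thesis .
    qed
  qed
  have "real (card {d. d dvd m}) \<le> K ^ Q * real m powr \<epsilon>" if "m > 0" for m :: nat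
  proof -
    have "card (?P m) \<le> card {..<Q}" by (intro card_mono) auto
    then have "K ^ card (?P m) \<le> K ^ Q" using K by (intro power_increasing) auto
    from mult_right_mono[OF this, of "real m powr \<epsilon>"] main[OF that] show ?thesis by simp
  qed
  moreover have "K ^ Q \<ge> 1" using K by simp
  ultimately show ?thesis by blast
qed

lemma card_cong_interval_le:
  fixes q e c X :: nat
  assumes q: "prime q" and e: "e > 0"
  shows "card {N \<in> {1..X}. [N ^ e = c] (mod q)} \<le> e * (X div q + 1)"
proof -
  interpret prime_modulus "int q" using q by unfold_locales simp
  have q0: "q > 0" using q prime_gt_0_nat by blast
  define R where "R = {y \<in> {0..<q}. [y ^ e = c] (mod q)}"
  have "card R \<le> card {y \<in> {0..<int q}. [y ^ e = int c] (mod int q)}"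
  proof (rule card_inj_on_le[of int])
    show "int ` R \<subseteq> {y \<in> {0..<int q}. [y ^ e = int c] (mod int q)}"
      unfolding R_def using cong_int_iff[of _ c q] by (auto simp flip: of_nat_power)
    show "finite {y \<in> {0..<int q}. [y ^ e = int c] (mod int q)}" by (rule finite_subset[of _ "{0..<int q}"]) auto
  qed simp
  also have "\<dots> \<le> e" by (rule card_power_cong_le[OF e])
  finally have R: "card R \<le> e" .
  have "{N \<in> {1..X}. [N ^ e = c] (mod q)} \<subseteq> (\<Union>y\<in>R. {N \<in> {1..(X div q + 1) * q}. N mod q = y})"
  proof
    fix N assume N: "N \<in> {N \<in> {1..X}. [N ^ e = c] (mod q)}"
    have "N mod q \<in> R" using N q0 by (auto simp: R_def cong_def power_mod)
    moreover have "X \<le> (X div q + 1) * q"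
      using div_mult_mod_eq[of X q] mod_less_divisor[OF q0, of X] by (simp only: distrib_right)
    ultimately show "N \<in> (\<Union>y\<in>R. {N \<in> {1..(X div q + 1) * q}. N mod q = y})" using N by auto
  qed
  then have "card {N \<in> {1..X}. [N ^ e = c] (mod q)} \<le> card (\<Union>y\<in>R. {N \<in> {1..(X div q + 1) * q}. N mod q = y})"
    by (intro card_mono) (auto simp: R_def)
  also have "\<dots> \<le> (\<Sum>y\<in>R. card {N \<in> {1..(X div q + 1) * q}. N mod q = y})"
    by (rule card_UN_le) (simp add: R_def)
  also have "\<dots> \<le> (\<Sum>y\<in>R. X div q + 1)" by (intro sum_mono card_residue_class_le q0)
  also have "\<dots> = card R * (X div q + 1)" by simp
  also have "\<dots> \<le> e * (X div q + 1)" using R by (rule mult_le_mono1)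
  finally show ?thesis .
qed

text \<open>A coset of a subgroup of order \<open>e\<close> contains few elements of \<open>[1, H]\<close>: the \<open>n\<close>-fold products of
  such elements lie in another coset, are at most \<open>H\<^sup>n\<close>, and each has few factorisations.\<close>

lemma card_coset_interval:
  fixes n :: nat and \<eta> :: real
  assumes n: "n \<ge> 1" and \<eta>: "\<eta> > 0"
  shows "\<exists>C>0. \<forall>q e c H :: nat. prime q \<longrightarrow> e > 0 \<longrightarrow> 1 \<le> H \<longrightarrow> H \<le> q \<longrightarrow> real q powr (1 / real n) \<le> 2 * real H \<longrightarrow>
    real (card {h \<in> {1..H}. [h ^ e = c] (mod q)}) \<le> C * real q powr \<eta> * real H * (real e / real q) powr (1 / real n)"
proof -
  \<comment> \<open>The products are at most q^n, so the divisor bound with exponent \<eta>/n allows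
    C q^\<eta> choices for each entry of a list.\<close>
  define \<epsilon> where "\<epsilon> = \<eta> / real n"
  have \<epsilon>: "\<epsilon> > 0" using n \<eta> by (simp add: \<epsilon>_def)
  obtain C where C: "C \<ge> 1" "\<And>m::nat. m > 0 \<Longrightarrow> real (card {d. d dvd m}) \<le> C * real m powr \<epsilon>"
    using divisor_bound[OF \<epsilon>] by blast
  have "real (card {h \<in> {1..H}. [h ^ e = c] (mod q)}) \<le> (4 * C) * real q powr \<eta> * real H * (real e / real q) powr (1 / real n)"
    if q: "prime q" and e: "e > 0" and H: "1 \<le> H" "H \<le> q" "real q powr (1 / real n) \<le> 2 * real H" for q e c H :: nat
  proof -
    have q0: "q > 0" using q prime_gt_0_nat by blast
    define A where "A = {h \<in> {1..H}. [h ^ e = c] (mod q)}"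
    define L where "L = {xs. set xs \<subseteq> A \<and> length xs = n}"
    define T where "T = {N \<in> {1..H ^ n}. [N ^ e = c ^ n] (mod q)}"
    have finA: "finite A" by (simp add: A_def)
    have cL: "card L = card A ^ n" unfolding L_def by (rule card_lists_length_eq[OF finA])
    have finL: "finite L" unfolding L_def by (rule finite_lists_length_eq[OF finA])
    have LT: "prod_list xs \<in> T" if "xs \<in> L" for xs
    proof -
      have "prod_list xs \<in> {1..H ^ length xs} \<and> [prod_list xs ^ e = c ^ length xs] (mod q)" if "set xs \<subseteq> A" for xs
        using that
      proof (induction xs)
        case (Cons x xs)
        then have x: "1 \<le> x" "x \<le> H" "[x ^ e = c] (mod q)"
          and IH: "1 \<le> prod_list xs" "prod_list xs \<le> H ^ length xs" "[prod_list xs ^ e = c ^ length xs] (mod q)"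
          by (auto simp: A_def)
        have "1 \<le> x * prod_list xs" using x IH by simp
        moreover have "x * prod_list xs \<le> H * H ^ length xs" using x IH by (intro mult_le_mono)
        moreover have "[x ^ e * prod_list xs ^ e = c * c ^ length xs] (mod q)" using x IH by (intro cong_mult)
        ultimately show ?case by (simp add: power_mult_distrib)
      qed simp
      from this[of xs] that show ?thesis by (simp add: L_def T_def)
    qed
    have fiber: "real (card {xs \<in> L. prod_list xs = N}) \<le> (C * real q powr \<eta>) ^ n" if N: "N \<in> T" for N
    proof -
      have N0: "N > 0" "N \<le> H ^ n" using N by (auto simp: T_def)
      have "{xs \<in> L. prod_list xs = N} \<subseteq> {xs. set xs \<subseteq> {d. d dvd N} \<and> length xs = n}"
        by (auto simp: L_def intro: prod_list_dvd)
      then have "card {xs \<in> L. prod_list xs = N} \<le> card {xs. set xs \<subseteq> {d. d dvd N} \<and> length xs = n}"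
        using N0 by (intro card_mono finite_lists_length_eq) auto
      also have "\<dots> = card {d. d dvd N} ^ n" using N0 by (intro card_lists_length_eq) simp
      finally have "real (card {xs \<in> L. prod_list xs = N}) \<le> real (card {d. d dvd N}) ^ n"
        by (metis of_nat_le_iff of_nat_power)
      also have "\<dots> \<le> (C * real q powr \<eta>) ^ n"
      proof (rule power_mono)
        have "real N \<le> real q ^ n"
        proof -
          have "N \<le> q ^ n" using N0(2) power_mono[OF H(2), of n] by simp
          then show ?thesis by (metis of_nat_le_iff of_nat_power)
        qed
        then have "real N powr \<epsilon> \<le> (real q ^ n) powr \<epsilon>" using \<epsilon> by (intro powr_mono2) auto
        also have "(real q ^ n) powr \<epsilon> = real q powr \<eta>"
          using q0 n by (simp add: \<epsilon>_def powr_powr flip: powr_realpow)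
        finally have "C * real N powr \<epsilon> \<le> C * real q powr \<eta>" using C(1) by simp
        then show "real (card {d. d dvd N}) \<le> C * real q powr \<eta>" using C(2)[OF N0(1)] by linarith
      qed simp
      finally show ?thesis .
    qed
    have "real (card L) = (\<Sum>N\<in>T. real (card {xs \<in> L. prod_list xs = N}))"
    proof -
      have "card L = (\<Sum>N\<in>T. card {xs \<in> L. prod_list xs = N})"
        using sum.group[OF finL, of T prod_list "\<lambda>_. 1::nat"] LT by (simp add: T_def image_subset_iff)
      then show ?thesis by simp
    qed
    also have "\<dots> \<le> (\<Sum>N\<in>T. (C * real q powr \<eta>) ^ n)" by (rule sum_mono) (rule fiber)
    also have "\<dots> = real (card T) * (C * real q powr \<eta>) ^ n" by simp
    also have "\<dots> \<le> (real e / real q * (4 * real H) ^ n) * (C * real q powr \<eta>) ^ n"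
    proof (rule mult_right_mono)
      have "real (card T) \<le> real (e * (H ^ n div q + 1))"
        unfolding T_def using card_cong_interval_le[OF q e] by (simp only: of_nat_le_iff)
      also have "\<dots> = real e * (real (H ^ n div q) + 1)" by (simp add: algebra_simps)
      \<comment> \<open>The hypothesis q^(1/n) \<le> 2 H means 1 \<le> (2 H)^n / q, which absorbs
        the incomplete period.\<close>
      also have "\<dots> \<le> real e * (real H ^ n / real q + (2 * real H) ^ n / real q)"
      proof (intro mult_left_mono add_mono)
        show "real (H ^ n div q) \<le> real H ^ n / real q" using of_nat_div_le_of_nat[of "H ^ n" q] by simp
        have "real q = (real q powr (1 / real n)) ^ n" using q0 n by (simp add: powr_powr flip: powr_realpow)
        also have "\<dots> \<le> (2 * real H) ^ n" using H(3) by (intro power_mono) auto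
        finally show "1 \<le> (2 * real H) ^ n / real q" using q0 by simp
      qed simp
      also have "\<dots> = real e / real q * ((1 + 2 ^ n) * real H ^ n)" by (simp add: power_mult_distrib algebra_simps add_divide_distrib)
      also have "\<dots> \<le> real e / real q * (4 ^ n * real H ^ n)"
      proof (intro mult_left_mono mult_right_mono)
        have "(1::real) \<le> 2 ^ n" by simp
        moreover have "(2::real) \<le> 2 ^ n" using n power_increasing[of 1 n "2::real"] by simp
        moreover have "(4::real) ^ n = 2 ^ n * 2 ^ n" by (simp flip: power_mult_distrib)
        ultimately show "(1::real) + 2 ^ n \<le> 4 ^ n" using mult_right_mono[of 2 "2 ^ n" "(2::real) ^ n"] by linarith
      qed auto
      finally show "real (card T) \<le> real e / real q * (4 * real H) ^ n" by (simp add: power_mult_distrib)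
    qed (use C in simp)
    also have "\<dots> = ((4 * C) * real q powr \<eta> * real H * (real e / real q) powr (1 / real n)) ^ n"
    proof -
      have "real e / real q = ((real e / real q) powr (1 / real n)) ^ n"
        using q0 e n by (simp add: powr_powr flip: powr_realpow)
      then have "(real e / real q * (4 * real H) ^ n) * (C * real q powr \<eta>) ^ n
          = ((real e / real q) powr (1 / real n)) ^ n * (4 * real H) ^ n * (C * real q powr \<eta>) ^ n" by simp
      also have "\<dots> = ((real e / real q) powr (1 / real n) * (4 * real H) * (C * real q powr \<eta>)) ^ n"
        by (simp only: power_mult_distrib)
      finally show ?thesis by (simp only: mult_ac)
    qed
    finally have "real (card A) ^ n \<le> ((4 * C) * real q powr \<eta> * real H * (real e / real q) powr (1 / real n)) ^ n"
      by (simp add: cL)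
    then have "real (card A) \<le> (4 * C) * real q powr \<eta> * real H * (real e / real q) powr (1 / real n)"
      by (rule power_le_imp_le_base[where n = "n - 1", unfolded Suc_diff_1[OF order.strict_trans2[OF zero_less_one n]]])
         (use C in simp)
    then show ?thesis by (simp add: A_def)
  qed
  moreover have "4 * C > 0" using C by simp
  ultimately show ?thesis by blast
qed

section \<open>Averaging over the bases\<close>

text \<open>For \<delta> = q/t the threshold q^(3/26) is where q^(89/92) \<delta>^(13/46) reaches q,
  as 89/92 + 3/92 = 1. Above it the trivial bound is used with the weight \<delta>^(-2/n) \<le>
  q^(-3/(13n)). Below it \<delta>^(13/46 - 2/n) is monotone, so an endpoint decides: \<delta> = 1
  gives q^(89/92), \<delta> = q^(3/26) gives q^(1 - 3/(13n)).\<close>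

lemma weighted_pointwise_arith:
  fixes q t n :: real
  assumes q: "q \<ge> 1" and t: "0 < t" "t \<le> q" and n: "n \<ge> 1"
  shows "(t / q) powr (2 / n) * min q (4 * (q powr (89/92) * (q / t) powr (13/46)))
    \<le> 4 * (q powr (89/92) + q powr (1 - 3 / (13 * n)))"
proof -
  define \<delta> where "\<delta> = q / t"
  have \<delta>: "\<delta> \<ge> 1" using t by (simp add: \<delta>_def)
  have td: "(t / q) powr (2 / n) = \<delta> powr (- (2 / n))"
    using t q by (simp add: \<delta>_def powr_minus powr_divide)
  have nn: "q powr (89/92) \<ge> 0" "q powr (1 - 3 / (13 * n)) \<ge> 0" by simp_all
  have ar1: "y \<le> 4 * (x + y)" if "0 \<le> x" "0 \<le> y" for x y :: real
    using that mult_right_mono[of 1 4 y] by (simp add: distrib_left add_increasing)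
  have ar2: "4 * z \<le> 4 * (x + y)" if "z \<le> x \<or> z \<le> y" "0 \<le> x" "0 \<le> y" for x y z :: real
    using that by (intro mult_left_mono) auto
  show ?thesis
  proof (cases "\<delta> \<ge> q powr (3/26)")
    case True
    have "\<delta> powr (- (2 / n)) \<le> (q powr (3/26)) powr (- (2 / n))"
      using True q n by (intro powr_mono2') auto
    also have "\<dots> = q powr (- 3 / (13 * n))" by (simp add: powr_powr)
    finally have "(t / q) powr (2 / n) * min q (4 * (q powr (89/92) * (q / t) powr (13/46)))
        \<le> q powr (- 3 / (13 * n)) * q"
      unfolding td using q by (intro mult_mono) auto
    also have "\<dots> = q powr (- 3 / (13 * n)) * q powr 1" using q by simp
    also have "\<dots> = q powr (1 - 3 / (13 * n))" by (subst powr_add[symmetric]) (simp add: algebra_simps)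
    also have "\<dots> \<le> 4 * (q powr (89/92) + q powr (1 - 3 / (13 * n)))" using nn by (rule ar1)
    finally show ?thesis .
  next
    case False
    have "(t / q) powr (2 / n) * min q (4 * (q powr (89/92) * (q / t) powr (13/46)))
        \<le> \<delta> powr (- (2 / n)) * (4 * (q powr (89/92) * \<delta> powr (13/46)))"
      unfolding td \<delta>_def by (intro mult_left_mono) auto
    also have "\<dots> = 4 * (q powr (89/92) * \<delta> powr (13/46 - 2 / n))"
    proof -
      have "\<delta> powr (- (2 / n)) * \<delta> powr (13/46) = \<delta> powr (13/46 - 2 / n)"
        by (subst powr_add[symmetric]) (simp add: algebra_simps)
      then show ?thesis by (simp only: mult.left_commute[of "\<delta> powr (- (2 / n))"])
    qed
    also have "\<dots> \<le> 4 * (q powr (89/92) + q powr (1 - 3 / (13 * n)))"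
    proof (cases "13/46 \<le> 2 / n")
      case True
      have "\<delta> powr (13/46 - 2 / n) \<le> \<delta> powr 0" using True \<delta> by (intro powr_mono) auto
      then have "\<delta> powr (13/46 - 2 / n) \<le> 1" using \<delta> by simp
      from mult_left_mono[OF this nn(1)] show ?thesis using nn by (intro ar2) simp_all
    next
      case f2: False
      have "\<delta> powr (13/46 - 2 / n) \<le> (q powr (3/26)) powr (13/46 - 2 / n)"
        using False f2 \<delta> by (intro powr_mono2) auto
      also have "\<dots> = q powr (3/92 - 3 / (13 * n))" by (simp add: powr_powr algebra_simps)
      finally have "q powr (89/92) * \<delta> powr (13/46 - 2 / n) \<le> q powr (89/92) * q powr (3/92 - 3 / (13 * n))"
        by (intro mult_left_mono) auto
      also have "\<dots> = q powr (1 - 3 / (13 * n))" by (subst powr_add[symmetric]) simp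
      finally show ?thesis using nn by (intro ar2) simp_all
    qed
    finally show ?thesis .
  qed
qed

lemma norm_S_le: "norm (S a h q) \<le> real q"
proof -
  have "norm (e_p q z) = 1" for z
    by (simp add: e_p_def norm_exp_eq_Re)
  then have "norm (S a h q) \<le> real (q - 1)"
    unfolding S_def by (intro order.trans[OF norm_sum]) simp
  then show ?thesis by linarith
qed

lemma card_Collect_UN_le:
  assumes "finite A" "finite D" "\<And>x. x \<in> A \<Longrightarrow> P x \<Longrightarrow> \<exists>d\<in>D. R d x"
    and "\<And>d. d \<in> D \<Longrightarrow> real (card {x \<in> A. R d x}) \<le> K"
  shows "real (card {x \<in> A. P x}) \<le> real (card D) * K"
proof -
  have "card {x \<in> A. P x} \<le> card (\<Union>d\<in>D. {x \<in> A. R d x})"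
    using assms(1,2,3) by (intro card_mono) auto
  also have "\<dots> \<le> (\<Sum>d\<in>D. card {x \<in> A. R d x})" by (rule card_UN_le[OF assms(2)])
  finally have "real (card {x \<in> A. P x}) \<le> (\<Sum>d\<in>D. real (card {x \<in> A. R d x}))"
    unfolding of_nat_sum[symmetric] of_nat_le_iff .
  also have "\<dots> \<le> (\<Sum>d\<in>D. K)" by (rule sum_mono) (rule assms(4))
  finally show ?thesis by simp
qed

text \<open>The exact order of a pair is replaced by all divisors t of q - 1 with h1^t = h2^t = 1.
  The condition then separates, so the number of pairs for t is the square of the number of elements
  of [1, H] in one subgroup; the extra sum over t costs only the number of divisors of q -
  1.\<close>

lemma V_bound:
  fixes n :: nat and \<eta> :: real
  assumes n: "n \<ge> 1" and \<eta>: "\<eta> > 0"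
  shows "\<exists>C>0. \<forall>q H a1 a2 :: nat. prime q \<longrightarrow> 1 \<le> H \<longrightarrow> H \<le> q - 1 \<longrightarrow> a1 \<in> {1..q - 1} \<longrightarrow> a2 \<in> {1..q - 1} \<longrightarrow>
    real q powr (1 / real n) \<le> 2 * real H \<longrightarrow>
    V (a1, a2) q H \<le> C * real q powr \<eta> * ((real H)\<^sup>2 * (real q powr (89/92) + real q powr (1 - 3 / (13 * real n))))"
proof -
  \<comment> \<open>One third is spent on the number of divisors of q - 1 and two thirds on the
    squared subgroup count.\<close>
  define \<eta>' where "\<eta>' = \<eta> / 3"
  have \<eta>': "\<eta>' > 0" using \<eta> by (simp add: \<eta>'_def)
  obtain C1 where C1: "C1 > 0" "\<And>q e c H :: nat. prime q \<Longrightarrow> e > 0 \<Longrightarrow> 1 \<le> H \<Longrightarrow> H \<le> q \<Longrightarrow> real q powr (1 / real n) \<le> 2 * real H \<Longrightarrow>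
    real (card {h \<in> {1..H}. [h ^ e = c] (mod q)}) \<le> C1 * real q powr \<eta>' * real H * (real e / real q) powr (1 / real n)"
    using card_coset_interval[OF n \<eta>'] by blast
  obtain C2 where C2: "C2 \<ge> 1" "\<And>m::nat. m > 0 \<Longrightarrow> real (card {d. d dvd m}) \<le> C2 * real m powr \<eta>'"
    using divisor_bound[OF \<eta>'] by blast
  define C where "C = C2 * (3 * C1 + 4 * C1\<^sup>2)"
  have "V (a1, a2) q H \<le> C * real q powr \<eta> * ((real H)\<^sup>2 * (real q powr (89/92) + real q powr (1 - 3 / (13 * real n))))"
    if q: "prime q" and H: "1 \<le> H" "H \<le> q - 1" "real q powr (1 / real n) \<le> 2 * real H"
      and a: "a1 \<in> {1..q - 1}" "a2 \<in> {1..q - 1}" for q H a1 a2 :: nat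
  proof -
    have q1: "q > 1" using q prime_gt_1_nat by blast
    then have qr: "real q \<ge> 1" by simp
    define D where "D = {d. d dvd q - 1}"
    have finD: "finite D" using q1 by (simp add: D_def)
    have Dpos: "0 < d" "d \<le> q" if "d \<in> D" for d
      using that q1 by (auto simp: D_def intro: Nat.gr0I dest: dvd_imp_le)
    define Eq where "Eq = real q powr (- (3 / (13 * real n)))"
    define K where "K = C1 * real q powr \<eta>' * real H * Eq"
    have K0: "K \<ge> 0" using C1(1) by (simp add: K_def Eq_def)
    have Hq: "H \<le> q" using H by simp
    have N: "real (card {h \<in> {1..H}. [h ^ e = c] (mod q)}) \<le> C1 * real q powr \<eta>' * real H * (real e / real q) powr (1 / real n)"
      if "e > 0" for e c
      using C1(2)[OF q that H(1) Hq H(3)] .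
    have NE: "real (card {h \<in> {1..H}. [h ^ e = c] (mod q)}) \<le> K"
      if "e > 0" "real e \<le> real q powr (10/13)" for e c
    proof -
      have "real e / real q \<le> real q powr (10/13) / real q powr 1" using that q1 by (simp add: divide_right_mono)
      also have "\<dots> = real q powr (- 3/13)" by (subst powr_diff[symmetric]) simp
      finally have "(real e / real q) powr (1 / real n) \<le> (real q powr (- 3/13)) powr (1 / real n)"
        by (intro powr_mono2) auto
      also have "\<dots> = Eq" by (simp add: Eq_def powr_powr)
      finally have "C1 * real q powr \<eta>' * real H * (real e / real q) powr (1 / real n) \<le> K"
        unfolding K_def using C1(1) by (intro mult_left_mono) auto
      then show ?thesis using N[OF that(1), of c] by linarith
    qed
    \<comment> \<open>For each order below q^(10/13) the density in [1, H] is at most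
      (q^(-3/13))^(1/n) up to the \<eta> loss, which is exactly the saving q^(-3/(13n)) of the
      result.\<close>
    define bad where "bad = (\<lambda>h. real (ord q h) < real q powr (10/13))"
    define bad2 where "bad2 = (\<lambda>h1 h2. \<exists>f\<in>D. real f < real q powr (3/23) \<and> [h1 ^ f = h2 ^ f] (mod q))"
    define m where "m = (\<lambda>t. min (real q) (4 * (real q powr (89/92) * (real q / real t) powr (13/46))))"
    have m0: "m t \<ge> 0" for t by (simp add: m_def)
    have ordD: "ord q h \<in> D \<and> [h ^ ord q h = 1] (mod q)" if "h \<in> {1..H}" for h
    proof -
      have "\<not> q dvd h" using that H by (auto dest!: dvd_imp_le)
      then have "[h ^ (q - 1) = 1] (mod q)" using q by (rule fermat_theorem[rotated])
      then show ?thesis using ord_divides[of h "ord q h" q] ord_divides[of h "q - 1" q] by (simp add: D_def)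
    qed
    have cbad: "real (card {h \<in> {1..H}. bad h}) \<le> real (card D) * K"
    proof (rule card_Collect_UN_le[where R = "\<lambda>e h. real e < real q powr (10/13) \<and> [h ^ e = 1] (mod q)"])
      fix e assume e: "e \<in> D"
      show "real (card {h \<in> {1..H}. real e < real q powr (10/13) \<and> [h ^ e = 1] (mod q)}) \<le> K"
        using NE[OF Dpos(1)[OF e], of 1] K0 by (cases "real e < real q powr (10/13)") auto
    next
      fix h assume "h \<in> {1..H}" "bad h"
      then show "\<exists>e\<in>D. real e < real q powr (10/13) \<and> [h ^ e = 1] (mod q)"
        using ordD[of h] by (auto simp: bad_def)
    qed (use finD in auto)
    \<comment> \<open>For fixed h2 the exceptional h1 lie in cosets of small subgroups, which is why
      the interval estimate is stated for an arbitrary right side c.\<close>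
    have cbad2: "real (card {h1 \<in> {1..H}. bad2 h1 h2}) \<le> real (card D) * K" for h2
    proof (rule card_Collect_UN_le[where R = "\<lambda>f h1. real f < real q powr (3/23) \<and> [h1 ^ f = h2 ^ f] (mod q)"])
      fix f assume f: "f \<in> D"
      have "real q powr (3/23) \<le> real q powr (10/13)" using qr by (intro powr_mono) auto
      then show "real (card {h1 \<in> {1..H}. real f < real q powr (3/23) \<and> [h1 ^ f = h2 ^ f] (mod q)}) \<le> K"
        using NE[OF Dpos(1)[OF f], of "h2 ^ f"] K0 by (cases "real f < real q powr (3/23)") auto
    qed (use finD in \<open>auto simp: bad2_def\<close>)
    let ?one = "\<lambda>t h1 h2. [h1 ^ t = 1] (mod q) \<and> [h2 ^ t = 1] (mod q)"
    have pointwise: "norm (S (a1, a2) (h1, h2) q) \<le> real q * of_bool (bad h1) + real q * of_bool (bad h2)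
        + real q * of_bool (bad2 h1 h2) + (\<Sum>t\<in>D. m t * of_bool (?one t h1 h2))"
      if h: "h1 \<in> {1..H}" "h2 \<in> {1..H}" for h1 h2
    proof -
      have s0: "(\<Sum>t\<in>D. m t * of_bool (?one t h1 h2)) \<ge> 0" by (intro sum_nonneg) (simp add: m0)
      show ?thesis
      proof (cases "bad h1 \<or> bad h2 \<or> bad2 h1 h2")
        case True
        then have "real q \<le> real q * of_bool (bad h1) + real q * of_bool (bad h2) + real q * of_bool (bad2 h1 h2)"
          by auto
        then show ?thesis using norm_S_le[of "(a1, a2)" "(h1, h2)" q] s0 by linarith
      next
        case False
        define t where "t = lcm (ord q h1) (ord q h2)"
        have tD: "t \<in> D" using ordD[OF h(1)] ordD[OF h(2)] by (simp add: t_def D_def)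
        have one: "?one t h1 h2" 
          using ord_divides[of h1 t q] ord_divides[of h2 t q] by (simp add: t_def)
        have h': "h1 \<in> {1..q - 1}" "h2 \<in> {1..q - 1}" using h H by auto
        have "norm (S (a1, a2) (h1, h2) q) \<le> 4 * (real q powr (89/92) * (real q / real t) powr (13/46))"
        proof (rule pointwise_bound[OF q h' a _ _ _ t_def])
          show "real (ord q h1) \<ge> real q powr (10/13)" "real (ord q h2) \<ge> real q powr (10/13)"
            using False by (simp_all add: bad_def)
          show "real f \<ge> real q powr (3/23)" if "f dvd q - 1" "[h1 ^ f = h2 ^ f] (mod q)" for f
            using False that by (force simp: bad2_def D_def)
        qed
        then have "norm (S (a1, a2) (h1, h2) q) \<le> m t * of_bool (?one t h1 h2)"
          using one norm_S_le[of "(a1, a2)" "(h1, h2)" q] by (simp add: m_def)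
        also have "\<dots> \<le> (\<Sum>t\<in>D. m t * of_bool (?one t h1 h2))"
          by (rule member_le_sum[OF tD]) (simp_all add: m0 finD)
        finally show ?thesis using False by simp
      qed
    qed
    let ?I = "{1..H}"
    define G where "G = real q powr (89/92) + real q powr (1 - 3 / (13 * real n))"
    have sb: "(\<Sum>h\<in>?I. of_bool (P h)) = real (card {h \<in> ?I. P h})" for P :: "nat \<Rightarrow> bool"
      by (simp add: of_bool_def sum.If_cases Int_def)
    have gen1: "(\<Sum>h1\<in>?I. \<Sum>h2\<in>?I. real q * w h1) = real q * real H * (\<Sum>h\<in>?I. w h)" for w :: "nat \<Rightarrow> real"
      by (simp add: sum_distrib_left mult_ac)
    have gen2: "(\<Sum>h1\<in>?I. \<Sum>h2\<in>?I. real q * w h2) = real q * real H * (\<Sum>h\<in>?I. w h)" for w :: "nat \<Rightarrow> real"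
      by (simp add: sum_distrib_left mult_ac)
    have gen3: "(\<Sum>h1\<in>?I. \<Sum>h2\<in>?I. real q * w h1 h2) = (\<Sum>h2\<in>?I. real q * (\<Sum>h1\<in>?I. w h1 h2))" for w :: "nat \<Rightarrow> nat \<Rightarrow> real"
      by (subst sum.swap) (simp add: sum_distrib_left)
    have gen4: "(\<Sum>h1\<in>?I. \<Sum>h2\<in>?I. w h1 * w h2) = (\<Sum>h\<in>?I. w h)\<^sup>2" for w :: "nat \<Rightarrow> real"
      by (simp add: sum_product power2_eq_square)
    have "V (a1, a2) q H \<le> (\<Sum>h1\<in>?I. \<Sum>h2\<in>?I. real q * of_bool (bad h1) + real q * of_bool (bad h2)
        + real q * of_bool (bad2 h1 h2) + (\<Sum>t\<in>D. m t * of_bool (?one t h1 h2)))"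
      unfolding V_def by (intro sum_mono pointwise)
    also have "\<dots> = (\<Sum>h1\<in>?I. \<Sum>h2\<in>?I. real q * of_bool (bad h1)) + (\<Sum>h1\<in>?I. \<Sum>h2\<in>?I. real q * of_bool (bad h2))
        + (\<Sum>h1\<in>?I. \<Sum>h2\<in>?I. real q * of_bool (bad2 h1 h2)) + (\<Sum>h1\<in>?I. \<Sum>h2\<in>?I. \<Sum>t\<in>D. m t * of_bool (?one t h1 h2))"
      by (simp only: sum.distrib)
    also have "\<dots> \<le> real q * real H * (real (card D) * K) + real q * real H * (real (card D) * K)
        + real q * real H * (real (card D) * K) + real (card D) * (C1\<^sup>2 * real q powr (2 * \<eta>') * (real H)\<^sup>2 * (4 * G))"
    proof (intro add_mono)
      have "(\<Sum>h1\<in>?I. \<Sum>h2\<in>?I. real q * of_bool (bad h1)) = real q * real H * real (card {h \<in> ?I. bad h})"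
        unfolding gen1 sb ..
      then show "(\<Sum>h1\<in>?I. \<Sum>h2\<in>?I. real q * of_bool (bad h1)) \<le> real q * real H * (real (card D) * K)"
        using cbad by (simp only:) (intro mult_left_mono, auto)
      have "(\<Sum>h1\<in>?I. \<Sum>h2\<in>?I. real q * of_bool (bad h2)) = real q * real H * real (card {h \<in> ?I. bad h})"
        unfolding gen2 sb ..
      then show "(\<Sum>h1\<in>?I. \<Sum>h2\<in>?I. real q * of_bool (bad h2)) \<le> real q * real H * (real (card D) * K)"
        using cbad by (simp only:) (intro mult_left_mono, auto)
      have "(\<Sum>h1\<in>?I. \<Sum>h2\<in>?I. real q * of_bool (bad2 h1 h2)) = (\<Sum>h2\<in>?I. real q * real (card {h1 \<in> ?I. bad2 h1 h2}))"
        unfolding gen3 sb ..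
      also have "\<dots> \<le> (\<Sum>h2\<in>?I. real q * (real (card D) * K))"
        using cbad2 by (intro sum_mono mult_left_mono) auto
      finally show "(\<Sum>h1\<in>?I. \<Sum>h2\<in>?I. real q * of_bool (bad2 h1 h2)) \<le> real q * real H * (real (card D) * K)"
        by (simp add: mult_ac)
      have "(\<Sum>h1\<in>?I. \<Sum>h2\<in>?I. \<Sum>t\<in>D. m t * of_bool (?one t h1 h2))
          = (\<Sum>t\<in>D. m t * (\<Sum>h1\<in>?I. \<Sum>h2\<in>?I. of_bool ([h1 ^ t = 1] (mod q)) * of_bool ([h2 ^ t = 1] (mod q))))"
      proof -
        have "(\<Sum>h1\<in>?I. \<Sum>h2\<in>?I. \<Sum>t\<in>D. m t * of_bool (?one t h1 h2)) = (\<Sum>h1\<in>?I. \<Sum>t\<in>D. \<Sum>h2\<in>?I. m t * of_bool (?one t h1 h2))"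
          by (rule sum.cong[OF refl], rule sum.swap)
        also have "\<dots> = (\<Sum>t\<in>D. \<Sum>h1\<in>?I. \<Sum>h2\<in>?I. m t * of_bool (?one t h1 h2))" by (rule sum.swap)
        finally show ?thesis by (simp only: sum_distrib_left of_bool_conj)
      qed
      also have "\<dots> = (\<Sum>t\<in>D. m t * (real (card {h \<in> ?I. [h ^ t = 1] (mod q)}))\<^sup>2)"
        unfolding gen4 sb ..
      also have "\<dots> \<le> (\<Sum>t\<in>D. C1\<^sup>2 * real q powr (2 * \<eta>') * (real H)\<^sup>2 * (4 * G))"
      proof (rule sum_mono)
        fix t assume t: "t \<in> D"
        have "m t * (real (card {h \<in> ?I. [h ^ t = 1] (mod q)}))\<^sup>2
            \<le> m t * (C1 * real q powr \<eta>' * real H * (real t / real q) powr (1 / real n))\<^sup>2"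
          using N[OF Dpos(1)[OF t], of 1] by (intro mult_left_mono power_mono m0) auto
        also have "\<dots> = C1\<^sup>2 * real q powr (2 * \<eta>') * (real H)\<^sup>2 * ((real t / real q) powr (2 / real n) * m t)"
        proof -
          have sq: "(x powr y)\<^sup>2 = x powr (2 * y)" for x y :: real by (simp add: power2_eq_square powr_add[symmetric])
          show ?thesis by (simp add: power_mult_distrib sq mult_ac)
        qed
        also have "\<dots> \<le> C1\<^sup>2 * real q powr (2 * \<eta>') * (real H)\<^sup>2 * (4 * G)"
          unfolding m_def G_def using Dpos[OF t] qr n by (intro mult_left_mono weighted_pointwise_arith) auto
        finally show "m t * (real (card {h \<in> ?I. [h ^ t = 1] (mod q)}))\<^sup>2 \<le> C1\<^sup>2 * real q powr (2 * \<eta>') * (real H)\<^sup>2 * (4 * G)" .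
      qed
      finally show "(\<Sum>h1\<in>?I. \<Sum>h2\<in>?I. \<Sum>t\<in>D. m t * of_bool (?one t h1 h2))
          \<le> real (card D) * (C1\<^sup>2 * real q powr (2 * \<eta>') * (real H)\<^sup>2 * (4 * G))" by simp
    qed
    also have "\<dots> = real (card D) * (3 * (real q * real H * K) + C1\<^sup>2 * real q powr (2 * \<eta>') * (real H)\<^sup>2 * (4 * G))"
      by (simp add: algebra_simps)
    also have "\<dots> \<le> (C2 * real q powr \<eta>') * ((3 * C1 + 4 * C1\<^sup>2) * real q powr (2 * \<eta>') * ((real H)\<^sup>2 * G))"
    proof (rule mult_mono)
      have "real (card D) \<le> C2 * real (q - 1) powr \<eta>'" unfolding D_def using C2(2)[of "q - 1"] q1 by simp
      also have "\<dots> \<le> C2 * real q powr \<eta>'" using C2(1) \<eta>' by (intro mult_left_mono powr_mono2) auto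
      finally show "real (card D) \<le> C2 * real q powr \<eta>'" .
      have qE: "real q * Eq \<le> G"
      proof -
        have "real q * Eq = real q powr 1 * Eq" using q1 by simp
        also have "\<dots> = real q powr (1 - 3 / (13 * real n))" unfolding Eq_def by (subst powr_add[symmetric]) simp
        finally show ?thesis by (simp add: G_def)
      qed
      have "real q * real H * K = C1 * real q powr \<eta>' * (real H)\<^sup>2 * (real q * Eq)"
        by (simp add: K_def power2_eq_square mult_ac)
      also have "\<dots> \<le> C1 * real q powr (2 * \<eta>') * (real H)\<^sup>2 * G"
        using C1(1) qE qr \<eta>' by (intro mult_mono powr_mono) (auto simp: G_def Eq_def)
      finally have "3 * (real q * real H * K) \<le> 3 * (C1 * real q powr (2 * \<eta>') * (real H)\<^sup>2 * G)" by simp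
      then show "3 * (real q * real H * K) + C1\<^sup>2 * real q powr (2 * \<eta>') * (real H)\<^sup>2 * (4 * G)
          \<le> (3 * C1 + 4 * C1\<^sup>2) * real q powr (2 * \<eta>') * ((real H)\<^sup>2 * G)" by (simp add: algebra_simps)
    qed (use C1 C2 K0 in \<open>auto simp: G_def intro!: add_nonneg_nonneg mult_nonneg_nonneg\<close>)
    also have "\<dots> = C * (real q powr \<eta>' * real q powr (2 * \<eta>')) * ((real H)\<^sup>2 * G)" by (simp add: C_def mult_ac)
    also have "real q powr \<eta>' * real q powr (2 * \<eta>') = real q powr \<eta>" by (simp add: \<eta>'_def powr_add[symmetric])
    finally show ?thesis by (simp only: G_def)
  qed
  moreover have "C > 0" unfolding C_def using C1(1) C2(1) by (intro mult_pos_pos add_pos_pos) auto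
  ultimately show ?thesis by blast
qed

section \<open>From a bound for every \<eta> to one vanishing exponent\<close>

lemma V_mono: "H \<le> H' \<Longrightarrow> V a q H \<le> V a q H'"
  unfolding V_def
  by (intro order.trans[OF sum_mono[OF sum_mono2] sum_mono2]) (auto intro: sum_nonneg)

text \<open>Take as exponent at p the largest base-p logarithm of f/g on the finite set
  \<open>X p\<close>, so that the inequality holds by construction. A constant C is at most p^\<eta>
  once p \<ge> C^(1/\<eta>), hence the exponent is eventually at most 2 \<eta>. Inserting 0 keeps
  the maximum defined and nonnegative.\<close>

lemma vanishing_exponent:
  fixes f g :: "nat \<Rightarrow> 'a \<Rightarrow> real"
  assumes fin: "\<And>p. finite (X p)" and p2: "\<And>p. p \<in> P \<Longrightarrow> p \<ge> 2"
    and f: "\<And>p x. p \<in> P \<Longrightarrow> x \<in> X p \<Longrightarrow> f p x \<ge> 0" and g: "\<And>p x. p \<in> P \<Longrightarrow> x \<in> X p \<Longrightarrow> g p x > 0"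
    and bound: "\<And>\<eta>. \<eta> > 0 \<Longrightarrow> \<exists>C>0. \<forall>p\<in>P. \<forall>x\<in>X p. f p x \<le> C * real p powr \<eta> * g p x"
  shows "\<exists>\<epsilon>. \<epsilon> \<longlonglongrightarrow> 0 \<and> (\<forall>p\<in>P. \<forall>x\<in>X p. f p x \<le> g p x * real p powr \<epsilon> p)"
proof -
  define \<epsilon> where "\<epsilon> = (\<lambda>p. if p \<in> P then Max (insert 0 ((\<lambda>x. log (real p) (f p x / g p x)) ` X p)) else 0)"
  have fin': "finite (insert 0 ((\<lambda>x. log (real p) (f p x / g p x)) ` X p))" for p using fin by simp
  have "f p x \<le> g p x * real p powr \<epsilon> p" if p: "p \<in> P" and x: "x \<in> X p" for p x
  proof (cases "f p x = 0")
    case True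
    then show ?thesis using g[OF p x] by simp
  next
    case False
    then have pos: "f p x / g p x > 0" using f[OF p x] g[OF p x] by simp
    have "log (real p) (f p x / g p x) \<le> \<epsilon> p"
      unfolding \<epsilon>_def using p x fin' by (auto intro!: Max_ge)
    then have "real p powr (log (real p) (f p x / g p x)) \<le> real p powr \<epsilon> p"
      using p2[OF p] by (intro powr_mono) auto
    then have "f p x / g p x \<le> real p powr \<epsilon> p" using pos p2[OF p] by simp
    then show ?thesis using g[OF p x] by (simp add: pos_divide_le_eq mult.commute)
  qed
  moreover have "\<epsilon> \<longlonglongrightarrow> 0"
  proof (rule LIMSEQ_I)
    fix r :: real assume r: "r > 0"
    define \<eta> where "\<eta> = r / 4"
    have \<eta>: "\<eta> > 0" using r by (simp add: \<eta>_def)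
    obtain C where C: "C > 0" "\<And>p x. p \<in> P \<Longrightarrow> x \<in> X p \<Longrightarrow> f p x \<le> C * real p powr \<eta> * g p x" using bound[OF \<eta>] by blast
    define N where "N = nat \<lceil>C powr (1 / \<eta>)\<rceil>"
    have "norm (\<epsilon> p - 0) < r" if "p \<ge> N" for p
    proof (cases "p \<in> P")
      case True
      have "C powr (1 / \<eta>) \<le> real N" unfolding N_def by (rule real_nat_ceiling_ge)
      then have "C powr (1 / \<eta>) \<le> real p" using that by linarith
      then have "(C powr (1 / \<eta>)) powr \<eta> \<le> real p powr \<eta>" using \<eta> by (intro powr_mono2) auto
      then have Cp: "C \<le> real p powr \<eta>" using C(1) \<eta> by (simp add: powr_powr)
      have "log (real p) (f p x / g p x) \<le> 2 * \<eta>" if x: "x \<in> X p" for x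
      proof (cases "f p x = 0")
        case True
        \<comment> \<open>The logarithm of 0 is 0 by convention.\<close>
        then show ?thesis using \<eta> by (simp add: log_def)
      next
        case False
        then have pos: "f p x / g p x > 0" using f[OF True x] g[OF True x] by simp
        have "f p x / g p x \<le> C * real p powr \<eta>" using C(2)[OF True x] g[OF True x] by (simp add: pos_divide_le_eq)
        also have "\<dots> \<le> real p powr \<eta> * real p powr \<eta>" using Cp by (intro mult_right_mono) auto
        also have "\<dots> = real p powr (2 * \<eta>)" by (simp add: powr_add[symmetric])
        finally show ?thesis using pos p2[OF True] by (simp add: log_le_iff)
      qed
      then have "\<epsilon> p \<le> 2 * \<eta>" unfolding \<epsilon>_def using True fin' \<eta> by (auto simp: Max_le_iff fin)
      moreover have "\<epsilon> p \<ge> 0" unfolding \<epsilon>_def using fin' by (auto intro!: Max_ge)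
      ultimately show ?thesis using r by (simp add: \<eta>_def)
    next
      case False
      then show ?thesis using r by (simp add: \<epsilon>_def)
    qed
    then show "\<exists>N. \<forall>p\<ge>N. norm (\<epsilon> p - 0) < r" by blast
  qed
  ultimately show ?thesis by blast
qed

theorem theorem1p3:
  fixes n :: nat
  assumes "n \<ge> 1"
  shows "\<exists>\<epsilon> :: nat \<Rightarrow> real. \<epsilon> \<longlonglongrightarrow> 0 \<and>
    (\<forall>(p::nat) (H::nat) (a1::nat) (a2::nat).
       prime p \<longrightarrow> 1 \<le> H \<longrightarrow> H \<le> p - 1 \<longrightarrow> a1 \<in> {1..p - 1} \<longrightarrow> a2 \<in> {1..p - 1} \<longrightarrow>
       \<bar>V (a1, a2) p H\<bar> \<le>
         (if real H \<ge> real p powr (1 / real n)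
          then real H ^ 2 * real p powr (89 / 92)
               + real H ^ 2 * real p powr (1 - 3 / (13 * real n))
          else real p powr (89 / 92 + 2 / real n)
               + real p powr (1 + 23 / (13 * real n)))
         * real p powr \<epsilon> p)"
proof -
  define X :: "nat \<Rightarrow> (nat \<times> nat \<times> nat) set" where "X = (\<lambda>p. {1..p - 1} \<times> {1..p - 1} \<times> {1..p - 1})"
  define f :: "nat \<Rightarrow> nat \<times> nat \<times> nat \<Rightarrow> real" where "f = (\<lambda>p (H, a1, a2). \<bar>V (a1, a2) p H\<bar>)"
  define g :: "nat \<Rightarrow> nat \<times> nat \<times> nat \<Rightarrow> real" where "g = (\<lambda>p (H, a1, a2).
         (if real H \<ge> real p powr (1 / real n)
          then real H ^ 2 * real p powr (89 / 92)
               + real H ^ 2 * real p powr (1 - 3 / (13 * real n))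
          else real p powr (89 / 92 + 2 / real n)
               + real p powr (1 + 23 / (13 * real n))))"
  have V0: "V a p H \<ge> 0" for a p H unfolding V_def by (intro sum_nonneg) simp
  have "\<exists>\<epsilon>. \<epsilon> \<longlonglongrightarrow> 0 \<and> (\<forall>p\<in>{p. prime p}. \<forall>x\<in>X p. f p x \<le> g p x * real p powr \<epsilon> p)"
  proof (rule vanishing_exponent)
    show "g p x > 0" if "p \<in> {p. prime p}" "x \<in> X p" for p x
    proof -
      have "p > 0" using that prime_gt_0_nat by auto
      then show ?thesis using that by (cases x) (auto simp: g_def X_def intro!: add_pos_pos mult_pos_pos)
    qed
    fix \<eta> :: real assume "\<eta> > 0"
    from V_bound[OF assms this] obtain C where C: "C > 0"
      "\<And>q H a1 a2 :: nat. prime q \<Longrightarrow> 1 \<le> H \<Longrightarrow> H \<le> q - 1 \<Longrightarrow> a1 \<in> {1..q - 1} \<Longrightarrow> a2 \<in> {1..q - 1} \<Longrightarrow>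
        real q powr (1 / real n) \<le> 2 * real H \<Longrightarrow>
        V (a1, a2) q H \<le> C * real q powr \<eta> * ((real H)\<^sup>2 * (real q powr (89/92) + real q powr (1 - 3 / (13 * real n))))"
      by blast
    have "f p x \<le> C * real p powr \<eta> * g p x" if p: "prime p" and x: "x \<in> X p" for p x
    proof -
      obtain H a1 a2 where xe: "x = (H, a1, a2)" and H: "1 \<le> H" "H \<le> p - 1" and a: "a1 \<in> {1..p - 1}" "a2 \<in> {1..p - 1}"
        using x by (auto simp: X_def)
      have p2: "p \<ge> 2" using p by (rule prime_ge_2_nat)
      define y where "y = real p powr (1 / real n)"
      have y1: "y \<ge> 1" using p2 assms by (simp add: y_def ge_one_powr_ge_zero)
      have yp: "y \<le> real p" using powr_mono[of "1 / real n" 1 "real p"] p2 assms by (simp add: y_def)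
      show ?thesis
      proof (cases "real H \<ge> y")
        case True
        then have "y \<le> 2 * real H" using y1 by linarith
        from C(2)[OF p H a, folded y_def, OF this] True V0 show ?thesis
          by (simp add: f_def g_def xe y_def distrib_left)
      next
        case False
        \<comment> \<open>By monotonicity V at H < y = p^(1/n) is at most V at an integer H1 between
          y/2 and y. The lower limit y/2 leaves room for an integer that is also at most p - 1, even
          for n = 1 where y = p; this is the purpose of the factor 2 in
          \<open>V_bound\<close>.\<close>
        define H1 where "H1 = max H (nat \<lceil>y / 2\<rceil>)"
        have H1: "1 \<le> H1" "H1 \<le> p - 1" "y \<le> 2 * real H1" "real H1 \<le> y"
        proof -
          show "1 \<le> H1" using H by (simp add: H1_def)
          have "y / 2 \<le> real (nat \<lceil>y / 2\<rceil>)" by (rule real_nat_ceiling_ge)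
          then show "y \<le> 2 * real H1" unfolding H1_def by linarith
          have "y / 2 \<le> real (p - 1)" using yp p2 by (simp add: of_nat_diff)
          then have "nat \<lceil>y / 2\<rceil> \<le> p - 1" by (simp add: nat_le_iff ceiling_le_iff)
          then show "H1 \<le> p - 1" using H by (simp add: H1_def)
          have "real (nat \<lceil>y / 2\<rceil>) \<le> y"
          proof (cases "y \<le> 2")
            case True
            then have "\<lceil>y / 2\<rceil> \<le> 1" by (simp add: ceiling_le_iff)
            then have "nat \<lceil>y / 2\<rceil> \<le> 1" by linarith
            then show ?thesis using y1 by linarith
          next
            case False
            then show ?thesis using y1 by linarith
          qed
          then show "real H1 \<le> y" using False by (simp add: H1_def max_def)
        qed
        have "V (a1, a2) p H \<le> V (a1, a2) p H1" by (rule V_mono) (simp add: H1_def)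
        also have "\<dots> \<le> C * real p powr \<eta> * ((real H1)\<^sup>2 * (real p powr (89/92) + real p powr (1 - 3 / (13 * real n))))"
          using C(2)[OF p H1(1,2) a] H1(3) by (simp add: y_def)
        also have "\<dots> \<le> C * real p powr \<eta> * (y\<^sup>2 * (real p powr (89/92) + real p powr (1 - 3 / (13 * real n))))"
          using C(1) H1(4) by (intro mult_left_mono mult_right_mono power_mono) auto
        also have "y\<^sup>2 * (real p powr (89/92) + real p powr (1 - 3 / (13 * real n)))
            = real p powr (89 / 92 + 2 / real n) + real p powr (1 + 23 / (13 * real n))"
        proof -
          have y2: "y\<^sup>2 = real p powr (2 / real n)" by (simp add: y_def power2_eq_square powr_add[symmetric])
          have "2 / real n + (1 - 3 / (13 * real n)) = 1 + 23 / (13 * real n)" using assms by (simp add: field_simps)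
          then show ?thesis unfolding y2 distrib_left powr_add[symmetric] by (simp add: add.commute)
        qed
        finally show ?thesis using False V0 by (simp add: f_def g_def xe y_def)
      qed
    qed
    then show "\<exists>C>0. \<forall>p\<in>{p. prime p}. \<forall>x\<in>X p. f p x \<le> C * real p powr \<eta> * g p x" using C(1) by blast
  qed (auto simp: X_def f_def prime_ge_2_nat)
  then obtain \<epsilon> where \<epsilon>: "\<epsilon> \<longlonglongrightarrow> 0" "\<And>p x. prime p \<Longrightarrow> x \<in> X p \<Longrightarrow> f p x \<le> g p x * real p powr \<epsilon> p" by blast
  show ?thesis
  proof (intro exI[of _ \<epsilon>] conjI allI impI)
    fix p H a1 a2 :: nat
    assume *: "prime p" "1 \<le> H" "H \<le> p - 1" "a1 \<in> {1..p - 1}" "a2 \<in> {1..p - 1}"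
    then have "(H, a1, a2) \<in> X p" by (simp add: X_def)
    from \<epsilon>(2)[OF *(1) this] show "\<bar>V (a1, a2) p H\<bar> \<le>
         (if real H \<ge> real p powr (1 / real n)
          then real H ^ 2 * real p powr (89 / 92)
               + real H ^ 2 * real p powr (1 - 3 / (13 * real n))
          else real p powr (89 / 92 + 2 / real n)
               + real p powr (1 + 23 / (13 * real n)))
         * real p powr \<epsilon> p" unfolding f_def g_def by simp
  qed (rule \<epsilon>(1))
qed

end
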